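(* The family of operators $\{\lambda D\}_{\lambda\in\mathbb{C}\setminus\{0\}}\cup\{\mu T_a\}_{a,\mu\in\mathbb{C}\setminus\{0\}}$ on $H(\mathbb{C})$ possesses a common hypercyclic subspace; that is, there exists a closed infinite-dimensional linear subspace $M\subset H(\mathbb{C})$ such that every $f\in M\setminus\{0\}$ is hypercyclic for $\lambda D$ for every $\lambda\in\mathbb{C}\setminus\{0\}$ and hypercyclic for $\mu T_a$ for all $a,\mu\in\mathbb{C}\setminus\{0\}$.
   Context: $H(\mathbb{C})$ is the Fréchet space of entire functions with the topology of uniform convergence on compact subsets of $\mathbb{C}$. The operators $D$ and $T_a$ ($a\in\mathbb{C}$) on $H(\mathbb{C})$ are defined by $Df=f'$ and $(T_af)(z)=f(z+a)$. A vector $x$ is hypercyclic for a continuous linear operator $T$ on a Fréchet space $X$ if its orbit $\{T^nx:n\ge 0\}$ is dense in $X$. A common hypercyclic subspace for a family of operators is a closed infinite-dimensional subspace in which each non-zero vector is hypercyclic for each operator of the family. *)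

theory Defs
  imports "HOL-Complex_Analysis.Complex_Analysis" "HOL-Library.Function_Algebras"
begin

section \<open>The space of entire functions\<close>

definition entire_functions :: "(complex \<Rightarrow> complex) set" where
  "entire_functions = {f. f holomorphic_on UNIV}"

text \<open>The basic neighbourhoods of an entire function \<open>f\<close> in the topology of uniform convergence
  on compact sets.\<close>

definition compact_nbhd ::
    "(complex \<Rightarrow> complex) \<Rightarrow> complex set \<Rightarrow> real \<Rightarrow> (complex \<Rightarrow> complex) set" where
  "compact_nbhd f K e = {g \<in> entire_functions. \<forall>z\<in>K. dist (g z) (f z) < e}"

definition entire_topology :: "(complex \<Rightarrow> complex) topology" where
  "entire_topology = topology (\<lambda>U. U \<subseteq> entire_functions \<and>
     (\<forall>f\<in>U. \<exists>K e. compact K \<and> 0 < e \<and> compact_nbhd f K e \<subseteq> U))"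

lemma openin_entire_topology:
  "openin entire_topology U \<longleftrightarrow> U \<subseteq> entire_functions \<and>
     (\<forall>f\<in>U. \<exists>K e. compact K \<and> 0 < e \<and> compact_nbhd f K e \<subseteq> U)"
proof -
  let ?P = "\<lambda>U. U \<subseteq> entire_functions \<and>
     (\<forall>f\<in>U. \<exists>K e. compact K \<and> 0 < e \<and> compact_nbhd f K e \<subseteq> U)"
  have int: "?P (S \<inter> T)" if S: "?P S" and T: "?P T" for S T
  proof (intro conjI ballI)
    fix f assume f: "f \<in> S \<inter> T"
    obtain K e where 1: "compact K" "0 < e" "compact_nbhd f K e \<subseteq> S" using S f by blast
    obtain L d where 2: "compact L" "0 < d" "compact_nbhd f L d \<subseteq> T" using T f by blast
    have "compact_nbhd f (K \<union> L) (min e d) \<subseteq> compact_nbhd f K e \<inter> compact_nbhd f L d"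
      by (auto simp: compact_nbhd_def)
    then show "\<exists>K e. compact K \<and> 0 < e \<and> compact_nbhd f K e \<subseteq> S \<inter> T"
      using 1 2 by (intro exI[of _ "K \<union> L"] exI[of _ "min e d"]) (auto simp: compact_Un)
  qed (use S in blast)
  have un: "?P (\<Union>\<K>)" if "\<forall>U\<in>\<K>. ?P U" for \<K>
  proof (intro conjI ballI)
    fix f assume "f \<in> \<Union>\<K>"
    then obtain U where U: "U \<in> \<K>" "f \<in> U" by blast
    have "\<exists>K e. compact K \<and> 0 < e \<and> compact_nbhd f K e \<subseteq> U"
      using bspec[OF that U(1)] U(2) by simp
    then obtain K e where K: "compact K" "0 < e" "compact_nbhd f K e \<subseteq> U" by (elim exE conjE)
    have "compact_nbhd f K e \<subseteq> \<Union>\<K>" using K(3) Union_upper[OF U(1)] by (rule subset_trans)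
    with K(1,2) show "\<exists>K e. compact K \<and> 0 < e \<and> compact_nbhd f K e \<subseteq> \<Union>\<K>"
      by (intro exI conjI)
  next
    show "\<Union>\<K> \<subseteq> entire_functions" using that by (intro Union_least) simp
  qed
  have "istopology ?P"
    unfolding istopology_def
    by (rule conjI, intro allI impI, erule (1) int, intro allI impI, erule un)
  then show ?thesis
    by (simp add: entire_topology_def topology_inverse')
qed

lemma topspace_entire_topology [simp]: "topspace entire_topology = entire_functions"
proof -
  have "openin entire_topology entire_functions"
    unfolding openin_entire_topology
    by (auto simp: compact_nbhd_def intro!: exI[of _ "{}"] exI[of _ 1])
  moreover have "topspace entire_topology \<subseteq> entire_functions"
    using openin_topspace[of entire_topology] by (simp only: openin_entire_topology)
  ultimately show ?thesis
    by (intro subset_antisym openin_subset)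
qed

lemma openin_compact_nbhd:
  assumes f: "f \<in> entire_functions" and K: "compact K"
  shows "openin entire_topology (compact_nbhd f K e)"
  unfolding openin_entire_topology
proof (intro conjI ballI)
  fix g assume g: "g \<in> compact_nbhd f K e"
  show "\<exists>L d. compact L \<and> 0 < d \<and> compact_nbhd g L d \<subseteq> compact_nbhd f K e"
  proof (cases "K = {}")
    case True
    then show ?thesis by (auto simp: compact_nbhd_def intro!: exI[of _ "{}"] exI[of _ 1])
  next
    case False
    have "continuous_on K (\<lambda>z. dist (g z) (f z))"
      using f g by (auto simp: entire_functions_def compact_nbhd_def
        intro!: continuous_intros holomorphic_on_imp_continuous_on intro: holomorphic_on_subset)
    from continuous_attains_sup[OF K False this]
    obtain w where w: "w \<in> K" "\<And>z. z \<in> K \<Longrightarrow> dist (g z) (f z) \<le> dist (g w) (f w)"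
      by (elim bexE) simp
    have "compact_nbhd g K (e - dist (g w) (f w)) \<subseteq> compact_nbhd f K e"
    proof
      fix h assume h: "h \<in> compact_nbhd g K (e - dist (g w) (f w))"
      have "dist (h z) (f z) < e" if "z \<in> K" for z
        using dist_triangle[of "h z" "f z" "g z"] w(2)[OF that] h that
        by (force simp: compact_nbhd_def)
      with h show "h \<in> compact_nbhd f K e" by (auto simp: compact_nbhd_def)
    qed
    moreover have "0 < e - dist (g w) (f w)" using g w(1) by (auto simp: compact_nbhd_def)
    ultimately show ?thesis using K by blast
  qed
qed (auto simp: compact_nbhd_def)

lemma limitin_entire_topology:
  assumes "\<forall>\<^sub>F n in F. f n \<in> entire_functions"
  shows "limitin entire_topology f l F \<longleftrightarrow>
    l \<in> entire_functions \<and> (\<forall>K. compact K \<longrightarrow> uniform_limit K f l F)"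
proof safe
  assume L: "limitin entire_topology f l F"
  then show l: "l \<in> entire_functions" by (simp add: limitin_def)
  fix K :: "complex set" assume K: "compact K"
  show "uniform_limit K f l F"
  proof (rule uniform_limitI)
    fix e :: real assume "0 < e"
    then have "l \<in> compact_nbhd l K e" using l by (simp add: compact_nbhd_def)
    then have "\<forall>\<^sub>F n in F. f n \<in> compact_nbhd l K e"
      using L openin_compact_nbhd[OF l K] by (simp add: limitin_def)
    then show "\<forall>\<^sub>F n in F. \<forall>x\<in>K. dist (f n x) (l x) < e"
      by eventually_elim (simp add: compact_nbhd_def)
  qed
next
  assume l: "l \<in> entire_functions" and u: "\<forall>K. compact K \<longrightarrow> uniform_limit K f l F"
  show "limitin entire_topology f l F"
    unfolding limitin_def
  proof (intro conjI allI impI)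
    fix U assume "openin entire_topology U \<and> l \<in> U"
    then obtain K e where K: "compact K" "0 < e" "compact_nbhd l K e \<subseteq> U"
      unfolding openin_entire_topology by blast
    have "\<forall>\<^sub>F n in F. \<forall>x\<in>K. dist (f n x) (l x) < e"
      using u K(1,2) uniform_limitD by blast
    with assms show "\<forall>\<^sub>F n in F. f n \<in> U"
      by eventually_elim (use K in \<open>auto simp: compact_nbhd_def\<close>)
  qed (use l in simp)
qed


section \<open>Linear structure\<close>

text \<open>Addition and zero are the pointwise ones of \<^theory>\<open>HOL-Library.Function_Algebras\<close>.\<close>

definition scale_fun :: "complex \<Rightarrow> (complex \<Rightarrow> complex) \<Rightarrow> (complex \<Rightarrow> complex)" where
  "scale_fun c f = (\<lambda>z. c * f z)"

interpretation complex_fun: vector_space scale_fun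
  by unfold_locales (auto simp: scale_fun_def algebra_simps fun_eq_iff)

lemma subspace_entire_functions: "complex_fun.subspace entire_functions"
  by (auto simp: complex_fun.subspace_def entire_functions_def scale_fun_def plus_fun_def
      zero_fun_def intro!: holomorphic_intros)

text \<open>For a subspace: having no finite spanning set.\<close>

definition infinite_dimensional :: "(complex \<Rightarrow> complex) set \<Rightarrow> bool" where
  "infinite_dimensional M \<longleftrightarrow> (\<nexists>B. finite B \<and> complex_fun.span B = M)"


section \<open>Hypercyclicity\<close>

definition hypercyclic :: "'a topology \<Rightarrow> ('a \<Rightarrow> 'a) \<Rightarrow> 'a \<Rightarrow> bool" where
  "hypercyclic X T x \<longleftrightarrow>
     x \<in> topspace X \<and> X closure_of {(T ^^ n) x | n. True} = topspace X"

definition common_hypercyclic_subspace ::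
    "((complex \<Rightarrow> complex) \<Rightarrow> (complex \<Rightarrow> complex)) set \<Rightarrow> (complex \<Rightarrow> complex) set \<Rightarrow> bool" where
  "common_hypercyclic_subspace \<F> M \<longleftrightarrow>
     complex_fun.subspace M \<and> closedin entire_topology M \<and> infinite_dimensional M \<and>
     (\<forall>f\<in>M - {0}. \<forall>T\<in>\<F>. hypercyclic entire_topology T f)"


section \<open>The operators\<close>

definition diff_op :: "(complex \<Rightarrow> complex) \<Rightarrow> (complex \<Rightarrow> complex)" where
  "diff_op f = deriv f"

definition translation_op :: "complex \<Rightarrow> (complex \<Rightarrow> complex) \<Rightarrow> (complex \<Rightarrow> complex)" where
  "translation_op a f = (\<lambda>z. f (z + a))"

definition scale_op ::
    "complex \<Rightarrow> ((complex \<Rightarrow> complex) \<Rightarrow> (complex \<Rightarrow> complex)) \<Rightarrow> (complex \<Rightarrow> complex) \<Rightarrow> (complex \<Rightarrow> complex)"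
  where "scale_op c T f = scale_fun c (T f)"

text \<open>These are continuous linear operators on the space of entire functions. Linearity of
  \<^const>\<open>diff_op\<close> only holds there, since \<^const>\<open>deriv\<close> is arbitrary at points of
  non-differentiability.\<close>

lemma continuous_map_entire_topology:
  assumes "\<And>f. f \<in> entire_functions \<Longrightarrow> T f \<in> entire_functions"
    and "\<And>f K e. f \<in> entire_functions \<Longrightarrow> compact K \<Longrightarrow> 0 < e \<Longrightarrow>
      \<exists>L d. compact L \<and> 0 < d \<and> (\<forall>g\<in>compact_nbhd f L d. T g \<in> compact_nbhd (T f) K e)"
  shows "continuous_map entire_topology entire_topology T"
  unfolding continuous_map_def
proof (intro conjI allI impI)
  fix U assume U: "openin entire_topology U"
  show "openin entire_topology {f \<in> topspace entire_topology. T f \<in> U}"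
    unfolding openin_entire_topology
  proof (intro conjI ballI)
    fix f assume f: "f \<in> {f \<in> topspace entire_topology. T f \<in> U}"
    then obtain K e where K: "compact K" "0 < e" "compact_nbhd (T f) K e \<subseteq> U"
      using U unfolding openin_entire_topology by blast
    obtain L d where "compact L" "0 < d" "\<forall>g\<in>compact_nbhd f L d. T g \<in> compact_nbhd (T f) K e"
      using assms(2)[OF _ K(1,2)] f by force
    then show "\<exists>L d. compact L \<and> 0 < d \<and>
        compact_nbhd f L d \<subseteq> {f \<in> topspace entire_topology. T f \<in> U}"
      using K(3) by (intro exI[of _ L] exI[of _ d]) (auto simp: compact_nbhd_def)
  qed auto
qed (use assms(1) in auto)

lemma continuous_map_scale_fun:
  "continuous_map entire_topology entire_topology (scale_fun c)"
proof (rule continuous_map_entire_topology)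
  show "scale_fun c f \<in> entire_functions" if "f \<in> entire_functions" for f
    using that complex_fun.subspace_scale[OF subspace_entire_functions] by blast
  fix f :: "complex \<Rightarrow> complex" and K :: "complex set" and e :: real
  assume f: "f \<in> entire_functions" and K: "compact K" "0 < e"
  have "scale_fun c g \<in> compact_nbhd (scale_fun c f) K e"
    if g: "g \<in> compact_nbhd f K (e / (norm c + 1))" for g
  proof -
    have "dist (c * g z) (c * f z) < e" if "z \<in> K" for z
    proof -
      have *: "dist (g z) (f z) < e / (norm c + 1)" using g that by (auto simp: compact_nbhd_def)
      have "dist (c * g z) (c * f z) = norm c * dist (g z) (f z)"
        by (simp add: dist_norm norm_mult flip: right_diff_distrib)
      also have "\<dots> \<le> (norm c + 1) * dist (g z) (f z)" by (simp add: mult_right_mono)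
      also have "\<dots> < e"
        using * by (simp add: pos_less_divide_eq add_nonneg_pos mult.commute)
      finally show ?thesis .
    qed
    moreover have "scale_fun c g \<in> entire_functions"
      using g complex_fun.subspace_scale[OF subspace_entire_functions]
      by (auto simp: compact_nbhd_def)
    ultimately show ?thesis by (auto simp: compact_nbhd_def scale_fun_def)
  qed
  moreover have "0 < e / (norm c + 1)" using K(2) by (simp add: add_nonneg_pos)
  ultimately show "\<exists>L d. compact L \<and> 0 < d \<and>
      (\<forall>g\<in>compact_nbhd f L d. scale_fun c g \<in> compact_nbhd (scale_fun c f) K e)"
    using K(1) by blast
qed

lemma continuous_map_diff_op: "continuous_map entire_topology entire_topology diff_op"
proof (rule continuous_map_entire_topology)
  show D: "diff_op f \<in> entire_functions" if "f \<in> entire_functions" for f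
    using that by (auto simp: diff_op_def entire_functions_def intro: holomorphic_deriv)
  fix f :: "complex \<Rightarrow> complex" and K :: "complex set" and e :: real
  assume f: "f \<in> entire_functions" and K: "compact K" "0 < e"
  obtain r where r: "\<And>z. z \<in> K \<Longrightarrow> norm z \<le> r"
    using K(1) compact_imp_bounded bounded_iff by metis
  have "diff_op g \<in> compact_nbhd (diff_op f) K e"
    if g: "g \<in> compact_nbhd f (cball 0 (r + 1)) (e / 2)" for g
  proof -
    have gh: "g holomorphic_on UNIV" and fh: "f holomorphic_on UNIV"
      using f g by (auto simp: compact_nbhd_def entire_functions_def)
    have "dist (deriv g z) (deriv f z) < e" if z: "z \<in> K" for z
    proof -
      let ?h = "\<lambda>w. g w - f w"
      have h: "?h holomorphic_on UNIV" using gh fh by (intro holomorphic_intros)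
      have "norm ((deriv ^^ 1) ?h z) \<le> fact 1 * (e / 2) / 1 ^ 1"
      proof (rule Cauchy_inequality)
        show "?h holomorphic_on ball z 1" using h holomorphic_on_subset by blast
        show "continuous_on (cball z 1) ?h"
          using h holomorphic_on_imp_continuous_on holomorphic_on_subset by blast
        fix w assume "norm (z - w) = 1"
        then have "w \<in> cball 0 (r + 1)"
          using r[OF z] norm_triangle_sub[of w z] by (simp add: norm_minus_commute)
        then have "dist (g w) (f w) < e / 2"
          using g by (auto simp: compact_nbhd_def)
        then show "norm (?h w) \<le> e / 2"
          by (simp add: dist_norm)
      qed simp
      moreover have "deriv ?h z = deriv g z - deriv f z"
        using gh fh by (intro deriv_diff) (auto simp: holomorphic_on_def)
      ultimately show ?thesis using K(2) by (simp add: dist_norm)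
    qed
    then show ?thesis
      using g D by (auto simp: compact_nbhd_def diff_op_def)
  qed
  then show "\<exists>L d. compact L \<and> 0 < d \<and>
      (\<forall>g\<in>compact_nbhd f L d. diff_op g \<in> compact_nbhd (diff_op f) K e)"
    using K(2) by (intro exI[of _ "cball 0 (r + 1)"] exI[of _ "e / 2"]) auto
qed

lemma continuous_map_translation_op:
  "continuous_map entire_topology entire_topology (translation_op a)"
proof (rule continuous_map_entire_topology)
  show T: "translation_op a f \<in> entire_functions" if f: "f \<in> entire_functions" for f
  proof -
    have "f \<circ> (\<lambda>z. z + a) holomorphic_on UNIV"
      using f by (intro holomorphic_on_compose_gen[where t = UNIV])
        (auto simp: entire_functions_def intro!: holomorphic_intros)
    then show ?thesis by (simp add: translation_op_def entire_functions_def o_def)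
  qed
  fix f :: "complex \<Rightarrow> complex" and K :: "complex set" and e :: real
  assume f: "f \<in> entire_functions" and K: "compact K" "0 < e"
  have "compact ((\<lambda>z. z + a) ` K)"
    using K(1) by (intro compact_continuous_image continuous_intros)
  moreover have "translation_op a g \<in> compact_nbhd (translation_op a f) K e"
    if "g \<in> compact_nbhd f ((\<lambda>z. z + a) ` K) e" for g
    using that T by (auto simp: compact_nbhd_def) (auto simp: translation_op_def)
  ultimately show "\<exists>L d. compact L \<and> 0 < d \<and>
      (\<forall>g\<in>compact_nbhd f L d. translation_op a g \<in> compact_nbhd (translation_op a f) K e)"
    using K(2) by blast
qed

lemma continuous_map_scale_op:
  assumes "continuous_map entire_topology entire_topology T"
  shows "continuous_map entire_topology entire_topology (scale_op c T)"
proof -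
  have "scale_op c T = scale_fun c \<circ> T" by (simp add: scale_op_def fun_eq_iff)
  with assms continuous_map_scale_fun show ?thesis by (metis continuous_map_compose)
qed

lemma diff_op_linear:
  assumes "f \<in> entire_functions" "g \<in> entire_functions"
  shows "diff_op (f + g) = diff_op f + diff_op g"
    and "diff_op (scale_fun c f) = scale_fun c (diff_op f)"
proof -
  have "f field_differentiable at z" "g field_differentiable at z" for z
    using assms by (auto simp: entire_functions_def holomorphic_on_def)
  then show "diff_op (f + g) = diff_op f + diff_op g"
      "diff_op (scale_fun c f) = scale_fun c (diff_op f)"
    by (auto simp: diff_op_def scale_fun_def plus_fun_def fun_eq_iff)
qed

lemma translation_op_linear:
  "translation_op a (f + g) = translation_op a f + translation_op a g"
  "translation_op a (scale_fun c f) = scale_fun c (translation_op a f)"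
  by (auto simp: translation_op_def scale_fun_def)

end

theory Submission
  imports Defs "HOL-Computational_Algebra.Fundamental_Theorem_Algebra"
begin

text \<open>
The subspace consists of entire functions \<open>f = (\<Sum>k. c k * f k)\<close>, where the generators \<open>f k\<close>, \<open>k \<ge> 1\<close>, are
entire and biorthogonal to the Taylor coefficients of certain degrees \<open>m 1 < m 2 < \<dots>\<close>. So the
coefficients \<open>c k\<close> are Taylor coefficients of \<open>f\<close> and satisfy \<open>|c k| \<le> B / \<rho> ^ m k\<close> for every \<open>\<rho>\<close>, with \<open>B\<close> a
bound for \<open>f\<close> on the disc of radius \<open>\<rho>\<close>. This makes the space closed (\<open>closedin_subsp\<close>), and
infinite-dimensional since it contains all generators. A nonzero \<open>f\<close> can be scaled so that some
coefficient \<open>c k0\<close> is \<open>1\<close>, and it is then steered towards all targets through the generator \<open>f k0\<close>.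

The generators are limits of polynomials that are corrected stage by stage. A correction is tiny on
a large disc, so that the polynomials converge, and starts at a high degree, so that the
biorthogonality survives. Each stage serves one task: a small open set of operators, a target
polynomial \<open>h\<close> and an index \<open>k0\<close>. After the correction every operator of the set has an iterate that
sends the polynomial with index \<open>k0\<close> close to \<open>h\<close> and the other ones close to \<open>0\<close>. The parameter sets being
second countable, countably many tasks reach all operators, and each task is repeated infinitely often.

For \<open>\<mu> T\<close> with \<open>T f(z) = f(z + a)\<close> the correction prescribes values on far away disjoint discs: if \<open>n a\<close> is
close to \<open>b\<close> and \<open>\<mu> ^ n * \<nu>\<close> is close to \<open>1\<close>, then a function that equals \<open>\<nu> * h (z - b)\<close> near \<open>b\<close> is
suitable. Runge's theorem for disjoint discs (\<open>runge_discs_vanishing\<close>) provides the polynomials. What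
has to be shown is that discs with a fixed separation can serve an open set of pairs \<open>(a, \<mu>)\<close>
(\<open>sweep_exponential\<close>), although the \<open>n\<close>-th power distinguishes parameters at distance \<open>1 / n\<close>. The count
is critical: a strip of fixed width at distance \<open>n\<close> serves an interval of length about \<open>1 / n\<close> of the
parameter \<open>ln |\<mu>| / |a|\<close> and all nearby values of the remaining ones, and the harmonic series diverges.
For \<open>\<lambda> D\<close> blocks of Taylor coefficients take the place of discs, and the same sweep with \<open>a = 1\<close> applies.

The generators that are born after a stage must not spoil it, although their coefficients are not
under control during the construction. For differentiation it is enough that they vanish to a very
high order at the origin. Translations, however, look at distant discs. Therefore an auxiliary
function is built along with the generators: it starts as \<open>z\<close> and is corrected to be bounded by \<open>1\<close> on
the discs of every translation stage. A new generator starts as its power with exponent \<open>m k\<close>, whence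
it is at most \<open>V ^ m k\<close> on all these discs and on any fixed disc around the origin, and the bound
\<open>|c k| \<le> B / (2 * V) ^ m k\<close> makes its contribution negligible when \<open>m k\<close> is large (\<open>subsp_steered\<close>).
\<close>

section \<open>Polynomial approximation on disjoint discs\<close>

definition poly_approximable :: "complex set \<Rightarrow> (complex \<Rightarrow> complex) \<Rightarrow> bool" where
  "poly_approximable K f \<longleftrightarrow> (\<forall>e>0. \<exists>p. \<forall>z\<in>K. norm (f z - poly p z) < e)"

lemma poly_approximableD:
  assumes "poly_approximable K f" "e > 0"
  obtains p where "\<And>z. z \<in> K \<Longrightarrow> norm (f z - poly p z) < e"
  using assms unfolding poly_approximable_def by meson

lemma poly_approximable_poly: "poly_approximable K (poly p)"
  unfolding poly_approximable_def by (auto intro!: exI[of _ p])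

lemma poly_approximable_cong:
  "(\<And>z. z \<in> K \<Longrightarrow> f z = g z) \<Longrightarrow> poly_approximable K f \<longleftrightarrow> poly_approximable K g"
  unfolding poly_approximable_def by auto

lemma poly_approximable_limit:
  assumes "\<And>e. e > 0 \<Longrightarrow> \<exists>g. poly_approximable K g \<and> (\<forall>z\<in>K. norm (f z - g z) < e)"
  shows "poly_approximable K f"
  unfolding poly_approximable_def
proof (intro allI impI)
  fix e :: real assume e: "e > 0"
  obtain g where g: "poly_approximable K g" "\<forall>z\<in>K. norm (f z - g z) < e/2"
    using assms[of "e/2"] e by auto
  obtain p where p: "\<And>z. z \<in> K \<Longrightarrow> norm (g z - poly p z) < e/2"
    using poly_approximableD[OF g(1), of "e/2"] e by auto
  have "norm (f z - poly p z) < e" if "z \<in> K" for z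
    using norm_triangle_ineq[of "f z - g z" "g z - poly p z"] g(2) p[OF that] that by fastforce
  then show "\<exists>p. \<forall>z\<in>K. norm (f z - poly p z) < e" by blast
qed

lemma poly_approximable_bounded:
  assumes "bounded K" "poly_approximable K f"
  obtains B where "B > 0" "\<And>z. z \<in> K \<Longrightarrow> norm (f z) \<le> B"
proof -
  obtain p where p: "\<And>z. z \<in> K \<Longrightarrow> norm (f z - poly p z) < 1"
    using poly_approximableD[OF assms(2), of 1] by auto
  have "compact (closure K)" using assms(1) by (simp add: compact_closure)
  then have "compact (poly p ` closure K)"
    by (intro compact_continuous_image) (auto intro: continuous_intros)
  then obtain C where C: "\<And>z. z \<in> closure K \<Longrightarrow> norm (poly p z) \<le> C"
    by (metis bounded_iff compact_imp_bounded image_eqI)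
  have "norm (f z) \<le> \<bar>C\<bar> + 1" if "z \<in> K" for z
    using p[OF that] C[of z] that closure_subset[of K] norm_triangle_sub[of "f z" "poly p z"] by force
  then show ?thesis by (intro that[of "\<bar>C\<bar> + 1"]) auto
qed

lemma poly_approximable_add:
  assumes "poly_approximable K f" "poly_approximable K g"
  shows "poly_approximable K (\<lambda>z. f z + g z)"
  unfolding poly_approximable_def
proof (intro allI impI)
  fix e :: real assume e: "e > 0"
  obtain p where p: "\<And>z. z \<in> K \<Longrightarrow> norm (f z - poly p z) < e/2"
    using poly_approximableD[OF assms(1), of "e/2"] e by auto
  obtain q where q: "\<And>z. z \<in> K \<Longrightarrow> norm (g z - poly q z) < e/2"
    using poly_approximableD[OF assms(2), of "e/2"] e by auto
  have "norm (f z + g z - poly (p + q) z) < e" if "z \<in> K" for z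
    using norm_triangle_ineq[of "f z - poly p z" "g z - poly q z"] p[OF that] q[OF that]
    by (simp add: algebra_simps)
  then show "\<exists>p. \<forall>z\<in>K. norm (f z + g z - poly p z) < e" by blast
qed

lemma poly_approximable_mult:
  assumes K: "bounded K" and f: "poly_approximable K f" and g: "poly_approximable K g"
  shows "poly_approximable K (\<lambda>z. f z * g z)"
  unfolding poly_approximable_def
proof (intro allI impI)
  fix e :: real assume e: "e > 0"
  obtain A where A: "A > 0" "\<And>z. z \<in> K \<Longrightarrow> norm (f z) \<le> A"
    using poly_approximable_bounded[OF K f] by metis
  obtain B where B: "B > 0" "\<And>z. z \<in> K \<Longrightarrow> norm (g z) \<le> B"
    using poly_approximable_bounded[OF K g] by metis
  define d where "d = min 1 (e / (2 * (A + B + 1)))"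
  have AB: "2 * (A + B + 1) > 0" using A B by simp
  have "d \<le> e / (2 * (A + B + 1))" by (simp add: d_def)
  then have d: "d > 0" "d \<le> 1" "d * (2 * (A + B + 1)) \<le> e"
    subgoal using e AB by (simp add: d_def)
    subgoal by (simp add: d_def)
    subgoal using \<open>d \<le> e / (2 * (A + B + 1))\<close> AB by (simp only: pos_le_divide_eq)
    done
  obtain p where p: "\<And>z. z \<in> K \<Longrightarrow> norm (f z - poly p z) < d"
    using poly_approximableD[OF f d(1)] by metis
  obtain q where q: "\<And>z. z \<in> K \<Longrightarrow> norm (g z - poly q z) < d"
    using poly_approximableD[OF g d(1)] by metis
  have "norm (f z * g z - poly (p * q) z) < e" if z: "z \<in> K" for z
  proof -
    have "f z * g z - poly (p * q) z = f z * (g z - poly q z) + poly q z * (f z - poly p z)"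
      by (simp add: algebra_simps)
    then have "norm (f z * g z - poly (p * q) z)
        \<le> norm (f z) * norm (g z - poly q z) + norm (poly q z) * norm (f z - poly p z)"
      by (metis norm_mult norm_triangle_ineq)
    also have "\<dots> \<le> A * d + (B + 1) * d"
    proof (intro add_mono mult_mono)
      show "norm (poly q z) \<le> B + 1"
        using norm_triangle_sub[of "poly q z" "g z"] q[OF z] d B(2)[OF z]
        by (simp add: norm_minus_commute)
    qed (use A B p[OF z] q[OF z] z in \<open>auto intro: less_imp_le\<close>)
    also have "\<dots> < e" using d A B e by (simp add: algebra_simps)
    finally show ?thesis .
  qed
  then show "\<exists>p. \<forall>z\<in>K. norm (f z * g z - poly p z) < e" by blast
qed

lemma poly_approximable_const: "poly_approximable K (\<lambda>_. c)"
proof -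
  have "poly [:c:] = (\<lambda>_. c)" by auto
  then show ?thesis using poly_approximable_poly[of K "[:c:]"] by metis
qed

lemma poly_approximable_ident: "poly_approximable K (\<lambda>z. z)"
proof -
  have "poly [:0, 1:] = (\<lambda>z. z :: complex)" by auto
  then show ?thesis using poly_approximable_poly[of K "[:0, 1:]"] by metis
qed

lemma poly_approximable_sum:
  "(\<And>i. i \<in> I \<Longrightarrow> poly_approximable K (f i)) \<Longrightarrow> poly_approximable K (\<lambda>z. \<Sum>i\<in>I. f i z)"
  by (induction I rule: infinite_finite_induct)
    (auto intro: poly_approximable_const poly_approximable_add)

lemma poly_approximable_prod:
  "bounded K \<Longrightarrow> (\<And>i. i \<in> I \<Longrightarrow> poly_approximable K (f i)) \<Longrightarrow>
    poly_approximable K (\<lambda>z. \<Prod>i\<in>I. f i z)"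
  by (induction I rule: infinite_finite_induct)
    (auto intro: poly_approximable_const poly_approximable_mult)

lemma poly_approximable_power:
  "bounded K \<Longrightarrow> poly_approximable K f \<Longrightarrow> poly_approximable K (\<lambda>z. f z ^ n)"
  by (induction n) (auto intro: poly_approximable_const poly_approximable_mult)

text \<open>Partial sums of the geometric series are polynomials in the approximants of \<open>g\<close>.\<close>
lemma geometric_poly_approximable:
  assumes K: "bounded K" and g: "poly_approximable K g" and q: "q < 1"
    "\<And>z. z \<in> K \<Longrightarrow> norm (g z) \<le> q"
  shows "poly_approximable K (\<lambda>z. 1 / (1 - g z))"
proof (rule poly_approximable_limit)
  fix e :: real assume e: "e > 0"
  show "\<exists>h. poly_approximable K h \<and> (\<forall>z\<in>K. norm (1 / (1 - g z) - h z) < e)"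
  proof (cases "K = {}")
    case False
    then have q0: "0 \<le> q" using q(2) norm_ge_zero order_trans by blast
    have "(\<lambda>n. q ^ n / (1 - q)) \<longlonglongrightarrow> 0 / (1 - q)"
      using q q0 by (intro tendsto_intros LIMSEQ_realpow_zero) auto
    then have "eventually (\<lambda>n. q ^ n / (1 - q) < e) sequentially"
      using e by (intro order_tendstoD) auto
    then obtain n where n: "q ^ n / (1 - q) < e" by (auto simp: eventually_sequentially)
    have "norm (1 / (1 - g z) - (\<Sum>i<n. g z ^ i)) < e" if z: "z \<in> K" for z
    proof -
      have ne: "g z \<noteq> 1" using q(2)[OF z] q(1) by auto
      have "1 / (1 - g z) - (\<Sum>i<n. g z ^ i) = g z ^ n / (1 - g z)"
        using ne by (simp add: sum_gp_strict divide_simps)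
      moreover have "1 - q \<le> norm (1 - g z)"
        using norm_triangle_ineq2[of 1 "g z"] q(2)[OF z] by simp
      ultimately have "norm (1 / (1 - g z) - (\<Sum>i<n. g z ^ i)) \<le> q ^ n / (1 - q)"
        using q(1) q(2)[OF z] q0 ne
        by (simp add: norm_divide norm_power frac_le power_mono)
      with n show ?thesis by simp
    qed
    then show ?thesis
      by (intro exI[of _ "\<lambda>z. \<Sum>i<n. g z ^ i"])
        (auto intro!: poly_approximable_sum poly_approximable_power K g)
  qed (use g in auto)
qed

text \<open>Runge's pole pushing. If \<open>1 / (u - z)\<close> is approximable and \<open>v\<close> is closer to \<open>u\<close> than half the
distance from \<open>u\<close> to \<open>K\<close>, then \<open>1 / (v - z)\<close> is a geometric series in \<open>(u - v) / (u - z)\<close>. Hence the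
admissible poles form an open and closed part of the connected complement of \<open>K\<close>, and a pole
far away from \<open>K\<close> is admissible by a geometric series in \<open>z\<close>.\<close>
lemma poly_approximable_inverse_linear:
  assumes K: "compact K" "connected (- K)" and w: "w \<notin> K"
  shows "poly_approximable K (\<lambda>z. 1 / (w - z))"
proof -
  have bK: "bounded K" using K(1) by (rule compact_imp_bounded)
  define P where "P w \<longleftrightarrow> poly_approximable K (\<lambda>z. 1 / (w - z))" for w
  have move: "P v" if u: "P u" "\<And>z. z \<in> K \<Longrightarrow> 2 * norm (v - u) \<le> norm (u - z)" "u \<notin> K" for u v
  proof -
    have ap: "poly_approximable K (\<lambda>z. (u - v) * (1 / (u - z)))"
      using u(1) unfolding P_def by (intro poly_approximable_mult bK poly_approximable_const)
    have bd: "norm ((u - v) * (1 / (u - z))) \<le> 1/2" if z: "z \<in> K" for z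
      using u(2)[OF z] u(3) z by (auto simp: norm_divide divide_simps norm_minus_commute)
    have "poly_approximable K (\<lambda>z. 1 / (u - z) * (1 / (1 - (u - v) * (1 / (u - z)))))"
      using u(1) unfolding P_def
      by (intro poly_approximable_mult geometric_poly_approximable[OF bK ap _ bd] bK) auto
    moreover have "1 / (u - z) * (1 / (1 - (u - v) * (1 / (u - z)))) = 1 / (v - z)" if "z \<in> K" for z
      using u(3) that bd[OF that] by (cases "v = z") (auto simp: divide_simps)
    ultimately show ?thesis unfolding P_def by (subst (asm) poly_approximable_cong) auto
  qed
  obtain R where R: "R > 0" "\<And>z. z \<in> K \<Longrightarrow> norm z \<le> R"
    using bK unfolding bounded_pos by auto
  define v where "v = complex_of_real (2 * R)"
  have vK: "v \<notin> K" using R(1) R(2)[of v] by (auto simp: v_def norm_mult)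
  have nv: "norm v = 2 * R" using R(1) by (simp add: v_def norm_mult)
  have Pv: "P v"
  proof -
    have ap: "poly_approximable K (\<lambda>z. z * (1 / v))"
      by (intro poly_approximable_mult bK poly_approximable_const poly_approximable_ident)
    have bd: "norm (z * (1 / v)) \<le> 1/2" if "z \<in> K" for z
      using R(2)[OF that] R(1) by (simp add: norm_divide norm_mult nv divide_simps)
    have "poly_approximable K (\<lambda>z. (1 / v) * (1 / (1 - z * (1 / v))))"
      by (intro poly_approximable_mult geometric_poly_approximable[OF bK ap _ bd] bK
          poly_approximable_const) auto
    moreover have "(1 / v) * (1 / (1 - z * (1 / v))) = 1 / (v - z)" if "z \<in> K" for z
      using R(1) vK that nv by (cases "v = 0") (auto simp: field_simps)
    ultimately show ?thesis unfolding P_def by (subst (asm) poly_approximable_cong) auto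
  qed
  show ?thesis
  proof (cases "K = {}")
    case True
    then show ?thesis by (auto simp: poly_approximable_def)
  next
    case False
    have gap: "\<exists>d>0. \<forall>z\<in>K. 4 * d \<le> norm (u - z)" if "u \<notin> K" for u
    proof -
      obtain d where "d > 0" "\<forall>z\<in>K. d \<le> dist u z"
        using separate_point_closed[OF compact_imp_closed[OF K(1)] \<open>u \<notin> K\<close>] by blast
      then show ?thesis by (intro exI[of _ "d / 4"]) (auto simp: dist_norm)
    qed
    have op: "\<exists>d>0. \<forall>x\<in>ball u d. P x \<longleftrightarrow> P u" if "u \<notin> K" for u
    proof -
      obtain d where d: "d > 0" "\<And>z. z \<in> K \<Longrightarrow> 4 * d \<le> norm (u - z)" using gap[OF \<open>u \<notin> K\<close>] by blast
      have "P x \<longleftrightarrow> P u" if x: "x \<in> ball u d" for x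
      proof
        have *: "4 * d \<le> norm (u - z)" "norm (x - u) < d" if "z \<in> K" for z
          using d(2)[OF that] x by (auto simp: dist_norm norm_minus_commute)
        assume "P x" then show "P u"
        proof (rule move)
          fix z assume z: "z \<in> K"
          show "2 * norm (u - x) \<le> norm (x - z)"
          proof -
            have "norm (u - z) \<le> norm (u - x) + norm (x - z)"
              using norm_triangle_ineq[of "u - x" "x - z"] by simp
            then show ?thesis using *[OF z] norm_minus_commute[of u x] d(1) by linarith
          qed
        next
          show "x \<notin> K"
          proof
            assume "x \<in> K"
            then show False using *[of x] norm_minus_commute[of u x] d(1) by linarith
          qed
        qed
      next
        assume "P u" then show "P x"
        proof (rule move)
          fix z assume z: "z \<in> K"
          show "2 * norm (x - u) \<le> norm (u - z)"
            using d(2)[OF z] x d(1) by (simp add: dist_norm norm_minus_commute)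
        qed fact
      qed
      with d(1) show ?thesis by blast
    qed
    have "P w"
    proof (rule connected_equivalence_relation[OF K(2), of v w "\<lambda>x y. P x \<longleftrightarrow> P y", THEN iffD1])
      fix u assume u: "u \<in> - K"
      obtain d where d: "d > 0" "\<forall>x\<in>ball u d. P x \<longleftrightarrow> P u" using op u by auto
      show "\<exists>T. openin (top_of_set (- K)) T \<and> u \<in> T \<and> (\<forall>x\<in>T. P u = P x)"
      proof (intro exI[of _ "ball u d \<inter> - K"] conjI ballI)
        show "P u = P x" if "x \<in> ball u d \<inter> - K" for x using d(2) that by blast
        show "openin (top_of_set (- K)) (ball u d \<inter> - K)" by (simp add: openin_open_Int Int_commute)
        show "u \<in> ball u d \<inter> - K" using d(1) u by simp
      qed
    qed (use vK w Pv in auto)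
    then show ?thesis by (simp add: P_def)
  qed
qed

lemma poly_approximable_inverse_poly:
  assumes K: "compact K" "connected (- K)" and Q: "\<And>z. z \<in> K \<Longrightarrow> poly Q z \<noteq> 0"
  shows "poly_approximable K (\<lambda>z. 1 / poly Q z)"
proof (cases "K = {}")
  case False
  then have Q0: "Q \<noteq> 0" using Q by auto
  define Z where "Z = {z. poly Q z = 0}"
  have dec: "poly Q z = lead_coeff Q * (\<Prod>w\<in>Z. (z - w) ^ order w Q)" for z
    by (subst (1) complex_poly_decompose[of Q, symmetric])
      (simp add: poly_prod poly_power Z_def)
  have bK: "bounded K" using K(1) by (rule compact_imp_bounded)
  have "poly_approximable K (\<lambda>z. 1 / lead_coeff Q * (\<Prod>w\<in>Z. (- 1 * (1 / (w - z))) ^ order w Q))"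
    using Q by (intro poly_approximable_mult poly_approximable_prod poly_approximable_power
        poly_approximable_const poly_approximable_inverse_linear bK K) (auto simp: Z_def)
  moreover have "1 / lead_coeff Q * (\<Prod>w\<in>Z. (- 1 * (1 / (w - z))) ^ order w Q) = 1 / poly Q z"
    if "z \<in> K" for z
  proof -
    have "- 1 * (1 / (w - z)) = inverse (z - w)" for w
      by (metis inverse_eq_divide inverse_minus_eq minus_diff_eq mult_minus1)
    then have "(\<Prod>w\<in>Z. (- 1 * (1 / (w - z))) ^ order w Q) = inverse (\<Prod>w\<in>Z. (z - w) ^ order w Q)"
      by (simp add: power_inverse prod_inversef[symmetric] o_def)
    then show ?thesis by (simp add: dec[of z] field_simps)
  qed
  ultimately show ?thesis by (subst (asm) poly_approximable_cong) auto
qed (auto simp: poly_approximable_def)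

text \<open>For large \<open>n\<close> the function \<open>1 / (1 + x ^ n)\<close> separates the inside of the unit circle from its outside;
this is what replaces Cauchy's integral formula in the approximation below.\<close>
lemma power_fraction_cutoff:
  fixes x :: complex
  assumes q: "0 \<le> q" "q ^ n \<le> 1/2"
  shows "norm x \<le> q \<Longrightarrow> norm (1 / (1 + x ^ n) - 1) \<le> 2 * q ^ n"
    and "1 \<le> q * norm x \<Longrightarrow> norm (1 / (1 + x ^ n)) \<le> 2 * q ^ n"
proof -
  assume x: "norm x \<le> q"
  then have xn: "norm (x ^ n) \<le> q ^ n" by (simp add: norm_power power_mono)
  have "1/2 \<le> norm (1 + x ^ n)"
    using norm_triangle_ineq2[of 1 "- (x ^ n)"] xn q by simp
  moreover have "1 + x ^ n \<noteq> 0" using calculation by force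
  then have "1 / (1 + x ^ n) - 1 = - (x ^ n) / (1 + x ^ n)" by (simp add: divide_simps)
  ultimately have "norm (1 / (1 + x ^ n) - 1) \<le> q ^ n / (1/2)"
    using xn q(1) by (simp only: norm_divide norm_minus_cancel) (intro frac_le, auto)
  then show "norm (1 / (1 + x ^ n) - 1) \<le> 2 * q ^ n" by simp
next
  assume x: "1 \<le> q * norm x"
  then have q0: "q > 0" using q(1) by (cases "q = 0") auto
  have "1 \<le> (q * norm x) ^ n" using x by (simp add: one_le_power)
  then have xn: "1 \<le> q ^ n * norm (x ^ n)" by (simp add: norm_power power_mult_distrib)
  have "1 / q ^ n \<le> norm (x ^ n)" using xn q0 by (simp add: divide_le_eq mult.commute)
  then have "1 / q ^ n - 1 \<le> norm (1 + x ^ n)"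
    using norm_triangle_ineq2[of "x ^ n" "-1"] by (simp add: add.commute)
  moreover have "1 / (2 * q ^ n) \<le> 1 / q ^ n - 1" using q q0 by (simp add: field_simps)
  ultimately have le: "1 / (2 * q ^ n) \<le> norm (1 + x ^ n)" by linarith
  have "norm (1 / (1 + x ^ n)) = 1 / norm (1 + x ^ n)" by (simp add: norm_divide)
  also have "\<dots> \<le> 1 / (1 / (2 * q ^ n))"
    using le q0 by (intro frac_le) auto
  finally show "norm (1 / (1 + x ^ n)) \<le> 2 * q ^ n" by simp
qed

text \<open>A rational function that is nearly \<open>1\<close> on the disc and nearly \<open>0\<close> on \<open>K\<close>. Its poles lie on a circle of
radius \<open>\<rho>\<close> around \<open>b\<close>, in the gap between the disc and \<open>K\<close>, so they can be pushed to infinity.\<close>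
lemma disc_cutoff:
  assumes K: "compact K" "connected (- (K \<union> cball b r))" and r: "0 < r" "K \<inter> cball b r = {}"
    and e: "0 < e"
  obtains \<kappa> where "poly_approximable (K \<union> cball b r) \<kappa>" "\<And>z. z \<in> K \<Longrightarrow> norm (\<kappa> z) \<le> e"
    "\<And>z. z \<in> cball b r \<Longrightarrow> norm (\<kappa> z - 1) \<le> e"
proof -
  obtain m where m: "r < m" "\<And>z. z \<in> K \<Longrightarrow> m \<le> norm (z - b)"
  proof (cases "K = {}")
    case False
    have "continuous_on K (\<lambda>z. norm (z - b))" by (intro continuous_intros)
    from continuous_attains_inf[OF K(1) False this]
    obtain w where "w \<in> K" "\<forall>z\<in>K. norm (w - b) \<le> norm (z - b)" by blast
    then show ?thesis using r by (intro that[of "norm (w - b)"]) (auto simp: dist_norm norm_minus_commute)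
  qed (use that[of "r + 1"] in auto)
  define \<rho> where "\<rho> = (r + m) / 2"
  have \<rho>: "r < \<rho>" "\<rho> < m" "0 < \<rho>" using m r by (auto simp: \<rho>_def)
  define q where "q = max (r / \<rho>) (\<rho> / m)"
  have q: "0 \<le> q" "q < 1" using \<rho> r m by (auto simp: q_def le_max_iff_disj)
  have "(\<lambda>n. q ^ n) \<longlonglongrightarrow> 0" using q by (intro LIMSEQ_realpow_zero) auto
  then have "eventually (\<lambda>n. q ^ n < min (1/2) (e/2)) sequentially"
    using e by (intro order_tendstoD) auto
  from eventually_happens[OF this] obtain n where "q ^ n < min (1/2) (e/2)" by auto
  then have n: "q ^ n \<le> 1/2" "2 * q ^ n \<le> e" by auto
  define x where "x z = (z - b) / of_real \<rho>" for z
  define Q where "Q = 1 + [:- b / of_real \<rho>, 1 / of_real \<rho>:] ^ n"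
  have Q: "poly Q z = 1 + x z ^ n" for z
    using \<rho> by (simp add: Q_def x_def poly_power diff_divide_distrib)
  have in1: "norm (x z) \<le> q" if "z \<in> cball b r" for z
  proof -
    have "norm (x z) \<le> r / \<rho>" using that \<rho>
      by (simp add: x_def norm_divide dist_norm norm_minus_commute divide_right_mono)
    then show ?thesis by (simp add: q_def)
  qed
  have in2: "1 \<le> q * norm (x z)" if "z \<in> K" for z
  proof -
    have "1 = \<rho> / m * (m / \<rho>)" using \<rho> by simp
    also have "\<dots> \<le> q * norm (x z)"
      using m(2)[OF that] \<rho> q by (intro mult_mono) (auto simp: q_def x_def norm_divide divide_right_mono)
    finally show ?thesis .
  qed
  define \<kappa> where "\<kappa> z = 1 / poly Q z" for z
  have c1: "norm (\<kappa> z - 1) \<le> 2 * q ^ n" if "z \<in> cball b r" for z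
    using power_fraction_cutoff(1)[OF q(1) n(1) in1[OF that]] by (simp add: \<kappa>_def Q)
  have c2: "norm (\<kappa> z) \<le> 2 * q ^ n" if "z \<in> K" for z
    using power_fraction_cutoff(2)[OF q(1) n(1) in2[OF that]] by (simp add: \<kappa>_def Q)
  have nz: "poly Q z \<noteq> 0" if "z \<in> K \<union> cball b r" for z
  proof
    assume "poly Q z = 0"
    then have 0: "x z ^ n = -1" by (simp add: Q add_eq_0_iff)
    then have n1: "norm (x z) ^ n = 1" by (metis norm_power norm_minus_cancel norm_one)
    have n0: "n \<noteq> 0" using n(1) by (cases n) auto
    show False
    proof (cases "z \<in> K")
      case True
      have "1 \<le> (q * norm (x z)) ^ n" using in2[OF True] by (rule one_le_power)
      then show False using n1 n(1) by (simp add: power_mult_distrib)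
    next
      case False
      then have "norm (x z) ^ n \<le> q ^ n" using in1 that by (intro power_mono) auto
      then show False using n1 n(1) by simp
    qed
  qed
  have "poly_approximable (K \<union> cball b r) \<kappa>"
    unfolding \<kappa>_def using K nz by (intro poly_approximable_inverse_poly) (auto intro: compact_Un)
  then show ?thesis using c1 c2 n(2) by (intro that[of \<kappa>]) (auto intro: order_trans)
qed

text \<open>An instance of Janiszewski's theorem.\<close>
lemma connected_complement_Un_cball:
  fixes K :: "complex set"
  assumes "compact K" "connected (- K)" "K \<inter> cball b r = {}"
  shows "connected (- (K \<union> cball b r))"
proof (rule Janiszewski_connected)
  show "connected (- cball b r)"
    by (rule connected_complement_bounded_convex) auto
qed (use assms in auto)

text \<open>With approximants \<open>p\<close>, \<open>q\<close> of the two pieces and a cutoff \<open>\<kappa>\<close>, the glued function is close to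
\<open>p + \<kappa> (q - p)\<close>.\<close>
lemma poly_approximable_glue_cball:
  assumes K: "compact K" "connected (- K)" and r: "0 < r" "K \<inter> cball b r = {}"
    and f: "poly_approximable K f" and g: "poly_approximable (cball b r) g"
  shows "poly_approximable (K \<union> cball b r) (\<lambda>z. if z \<in> cball b r then g z else f z)"
proof (rule poly_approximable_limit)
  fix e :: real assume e: "e > 0"
  let ?L = "K \<union> cball b r"
  have bL: "bounded ?L" using K(1) by (simp add: compact_imp_bounded)
  obtain p where p: "\<And>z. z \<in> K \<Longrightarrow> norm (f z - poly p z) < e/2"
    using poly_approximableD[OF f, of "e/2"] e by auto
  obtain q where q: "\<And>z. z \<in> cball b r \<Longrightarrow> norm (g z - poly q z) < e/2"
    using poly_approximableD[OF g, of "e/2"] e by (metis half_gt_zero)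
  obtain B where B: "B > 0" "\<And>z. z \<in> ?L \<Longrightarrow> norm (poly (q - p) z) \<le> B"
    using poly_approximable_bounded[OF bL poly_approximable_poly[of _ "q - p"]] by metis
  obtain \<kappa> where \<kappa>: "poly_approximable ?L \<kappa>" "\<And>z. z \<in> K \<Longrightarrow> norm (\<kappa> z) \<le> e / (2 * B)"
    "\<And>z. z \<in> cball b r \<Longrightarrow> norm (\<kappa> z - 1) \<le> e / (2 * B)"
    using disc_cutoff[OF K(1) connected_complement_Un_cball[OF K r(2)] r, of "e / (2 * B)"] B e
    by (auto simp del: mem_cball)
  let ?h = "\<lambda>z. poly p z + \<kappa> z * poly (q - p) z"
  have small: "t * norm (poly (q - p) z) \<le> e / 2" if "0 \<le> t" "t \<le> e / (2 * B)" "z \<in> ?L" for t z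
  proof -
    have "t * norm (poly (q - p) z) \<le> e / (2 * B) * B" using that B e by (intro mult_mono) auto
    then show ?thesis using B by simp
  qed
  have "norm ((if z \<in> cball b r then g z else f z) - ?h z) < e" if z: "z \<in> ?L" for z
  proof (cases "z \<in> cball b r")
    case True
    have "g z - ?h z = (g z - poly q z) - (\<kappa> z - 1) * poly (q - p) z" by (simp add: algebra_simps)
    then have "norm (g z - ?h z) \<le> norm (g z - poly q z) + norm (\<kappa> z - 1) * norm (poly (q - p) z)"
      by (metis norm_mult norm_triangle_ineq4)
    then show ?thesis using q[OF True] small[OF _ \<kappa>(3)[OF True] z] True by simp
  next
    case False
    then have zK: "z \<in> K" using z by auto
    have "f z - ?h z = (f z - poly p z) - \<kappa> z * poly (q - p) z" by (simp add: algebra_simps)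
    then have "norm (f z - ?h z) \<le> norm (f z - poly p z) + norm (\<kappa> z) * norm (poly (q - p) z)"
      by (metis norm_mult norm_triangle_ineq4)
    then show ?thesis using p[OF zK] small[OF _ \<kappa>(2)[OF zK] z] False by simp
  qed
  then show "\<exists>h. poly_approximable ?L h \<and>
      (\<forall>z\<in>?L. norm ((if z \<in> cball b r then g z else f z) - h z) < e)"
    by (intro exI[of _ ?h]) (auto intro!: poly_approximable_add poly_approximable_mult
        poly_approximable_poly bL \<kappa> simp del: poly_diff)
qed

lemma runge_discs:
  fixes G :: "complex \<Rightarrow> complex \<Rightarrow> complex"
  assumes B: "finite B" and r: "0 < r"
    and disj: "\<And>b b'. b \<in> B \<Longrightarrow> b' \<in> B \<Longrightarrow> b \<noteq> b' \<Longrightarrow> cball b r \<inter> cball b' r = {}"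
    and K: "compact K" "connected (- K)" "\<And>b. b \<in> B \<Longrightarrow> K \<inter> cball b r = {}"
    and G: "\<And>b. b \<in> B \<Longrightarrow> poly_approximable (cball b r) (G b)" and e: "0 < e"
  shows "\<exists>p. (\<forall>z\<in>K. norm (poly p z) < e) \<and> (\<forall>b\<in>B. \<forall>z\<in>cball b r. norm (G b z - poly p z) < e)"
proof -
  have "connected (- (K \<union> (\<Union>b\<in>B. cball b r))) \<and> (\<exists>\<Phi>. poly_approximable (K \<union> (\<Union>b\<in>B. cball b r)) \<Phi> \<and>
     (\<forall>z\<in>K. \<Phi> z = 0) \<and> (\<forall>b\<in>B. \<forall>z\<in>cball b r. \<Phi> z = G b z))"
    using B disj K(3) G
  proof (induction B)
    case empty
    show ?case using K(2) by (auto intro: poly_approximable_const)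
  next
    case (insert b B)
    let ?K = "K \<union> (\<Union>b\<in>B. cball b r)"
    have IH: "connected (- ?K) \<and> (\<exists>\<Phi>. poly_approximable ?K \<Phi> \<and>
     (\<forall>z\<in>K. \<Phi> z = 0) \<and> (\<forall>b\<in>B. \<forall>z\<in>cball b r. \<Phi> z = G b z))"
      by (rule insert.IH) (use insert.prems in auto)
    then obtain \<Phi> where \<Phi>: "poly_approximable ?K \<Phi>" "\<forall>z\<in>K. \<Phi> z = 0"
      "\<forall>b\<in>B. \<forall>z\<in>cball b r. \<Phi> z = G b z" by blast
    have co: "compact ?K" using K(1) insert.hyps(1) by (intro compact_Un compact_UN) auto
    have dj: "cball b' r \<inter> cball b r = {}" if "b' \<in> B" for b'
      using insert.prems(1)[of b' b] insert.hyps(2) that by (cases "b = b'") auto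
    have di: "?K \<inter> cball b r = {}"
      using insert.prems(2)[OF insertI1] dj by (simp only: Int_Un_distrib2 Int_UN_distrib2) (rule equals0I, auto simp only: Un_iff UN_iff empty_iff)
    let ?P = "\<lambda>z. if z \<in> cball b r then G b z else \<Phi> z"
    have eq: "K \<union> (\<Union>b\<in>insert b B. cball b r) = ?K \<union> cball b r" by blast
    have "poly_approximable (?K \<union> cball b r) ?P"
      using IH co di insert.prems(3)[of b] \<Phi>(1) r by (intro poly_approximable_glue_cball) auto
    moreover have "?P z = 0" if "z \<in> K" for z
    proof -
      have "z \<notin> cball b r" using di that by blast
      then show ?thesis using \<Phi>(2) that by (simp only: if_False)
    qed
    moreover have "?P z = G b' z" if "b' \<in> insert b B" "z \<in> cball b' r" for b' z
    proof (cases "b' = b")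
      case False
      then have "b' \<in> B" using that by simp
      moreover have "z \<notin> cball b r" using dj[OF \<open>b' \<in> B\<close>] that by blast
      ultimately show ?thesis using \<Phi>(3) that by (simp only: if_False)
    qed (use that in simp)
    moreover have "connected (- (?K \<union> cball b r))"
      using IH co di by (intro connected_complement_Un_cball) auto
    ultimately show ?case unfolding eq by (intro conjI exI[of _ ?P] ballI)
  qed
  then obtain \<Phi> where \<Phi>: "poly_approximable (K \<union> (\<Union>b\<in>B. cball b r)) \<Phi>" "\<forall>z\<in>K. \<Phi> z = 0"
      "\<forall>b\<in>B. \<forall>z\<in>cball b r. \<Phi> z = G b z" by blast
  obtain p where p: "\<And>z. z \<in> K \<union> (\<Union>b\<in>B. cball b r) \<Longrightarrow> norm (\<Phi> z - poly p z) < e"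
    using poly_approximableD[OF \<Phi>(1) e] by metis
  have "norm (poly p z) < e" if "z \<in> K" for z using p[of z] \<Phi>(2) that by simp
  moreover have "norm (G b z - poly p z) < e" if "b \<in> B" "z \<in> cball b r" for b z
  proof -
    have "z \<in> K \<union> (\<Union>b\<in>B. cball b r)" using that by blast
    then show ?thesis using p \<Phi>(3) that by metis
  qed
  ultimately show ?thesis by (intro exI[of _ p]) blast
qed

text \<open>The zero of order \<open>N\<close> at the origin keeps the Taylor coefficients of lower degree unchanged when the
polynomial is used as a correction. It comes from approximating \<open>G b / z ^ N\<close> instead of \<open>G b\<close>, which
is legitimate since none of the discs contains the origin.\<close>
lemma runge_discs_vanishing:
  fixes G :: "complex \<Rightarrow> complex poly"
  assumes B: "finite B" and r: "0 < r"
    and disj: "\<And>b b'. b \<in> B \<Longrightarrow> b' \<in> B \<Longrightarrow> b \<noteq> b' \<Longrightarrow> cball b r \<inter> cball b' r = {}"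
    and R: "0 \<le> R" "\<And>b. b \<in> B \<Longrightarrow> cball 0 R \<inter> cball b r = {}"
    and e: "0 < e"
  shows "\<exists>p. monom 1 N dvd p \<and> (\<forall>z\<in>cball 0 R. norm (poly p z) < e) \<and>
    (\<forall>b\<in>B. \<forall>z\<in>cball b r. norm (poly (G b) z - poly p z) < e)"
proof -
  let ?L = "cball 0 R \<union> (\<Union>b\<in>B. cball b r)"
  have "compact ?L" using B by (intro compact_Un compact_UN) auto
  then obtain S where S: "S > 0" "\<And>z. z \<in> ?L \<Longrightarrow> norm z \<le> S"
    using compact_imp_bounded bounded_pos by metis
  have n0: "z \<noteq> 0" if "b \<in> B" "z \<in> cball b r" for z b
  proof
    assume "z = 0"
    then have "0 \<in> cball 0 R \<inter> cball b r" using R(1) that(2) by simp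
    then show False using R(2)[OF that(1)] by blast
  qed
  define e' where "e' = e / S ^ N"
  have e': "e' > 0" "S ^ N * e' = e" using e S by (auto simp: e'_def)
  define H where "H b z = poly (G b) z * (1 / poly (monom 1 N) z)" for b z
  have "\<exists>p. (\<forall>z\<in>cball 0 R. norm (poly p z) < e') \<and> (\<forall>b\<in>B. \<forall>z\<in>cball b r. norm (H b z - poly p z) < e')"
  proof (rule runge_discs[OF B r disj _ _ R(2) _ e'(1)])
    show "connected (- cball (0::complex) R)" by (rule connected_complement_bounded_convex) auto
    show "poly_approximable (cball b r) (H b)" if "b \<in> B" for b
      unfolding H_def
    proof (intro poly_approximable_mult poly_approximable_poly poly_approximable_inverse_poly)
      show "connected (- cball b r)" by (rule connected_complement_bounded_convex) auto
    qed (use n0 that in \<open>auto simp: poly_monom\<close>)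
  qed auto
  then obtain p where p: "\<forall>z\<in>cball 0 R. norm (poly p z) < e'"
    "\<forall>b\<in>B. \<forall>z\<in>cball b r. norm (H b z - poly p z) < e'" by blast
  have scale: "norm (z ^ N * w) < e" if "z \<in> ?L" "norm w < e'" for z w
  proof -
    have "norm (z ^ N * w) \<le> S ^ N * norm w"
      using S(2)[OF that(1)] by (simp add: norm_mult norm_power mult_right_mono power_mono)
    also have "\<dots> < S ^ N * e'" using that S by simp
    finally show ?thesis using e' by simp
  qed
  let ?p = "monom 1 N * p"
  have "norm (poly ?p z) < e" if "z \<in> cball 0 R" for z
    using scale[of z "poly p z"] p(1) that by (simp add: poly_monom)
  moreover have "norm (poly (G b) z - poly ?p z) < e" if "b \<in> B" "z \<in> cball b r" for b z
  proof -
    have "poly (G b) z - poly ?p z = z ^ N * (H b z - poly p z)"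
      using n0[OF that] by (simp add: H_def poly_monom field_simps)
    then show ?thesis using scale[of z "H b z - poly p z"] p(2) that by (auto simp: Bex_def)
  qed
  ultimately show ?thesis by (intro exI[of _ ?p]) auto
qed

section \<open>Sweeping a neighbourhood of parameters\<close>

text \<open>Steps proportional to \<open>1 / (t0 + g G)\<close> cross every interval because the harmonic series diverges. This
is the reason why one-dimensional families such as \<open>|\<mu>|\<close> can be scanned with exponents \<open>n\<close> that grow
linearly, although \<open>\<mu> ^ n\<close> tolerates only an error of order \<open>1 / n\<close> in \<open>\<mu>\<close>.\<close>
lemma harmonic_sweep:
  fixes t0 G \<eta> x0 x1 :: real
  assumes "t0 > 0" "G > 0" "\<eta> > 0"
  obtains \<tau> :: "nat \<Rightarrow> real" and N where "mono \<tau>" "\<And>g. g < N \<Longrightarrow> x0 \<le> \<tau> g \<and> \<tau> g \<le> x1"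
    "\<And>x. x0 \<le> x \<Longrightarrow> x \<le> x1 \<Longrightarrow> \<exists>g<N. \<bar>x - \<tau> g\<bar> * (t0 + of_nat g * G) \<le> \<eta>"
proof -
  define s where "s i = \<eta> / (t0 + of_nat i * G)" for i :: nat
  have den: "t0 + of_nat i * G > 0" for i :: nat using assms by (simp add: add_pos_nonneg)
  have s0: "s i > 0" for i using assms den[of i] by (simp add: s_def)
  define \<tau> where "\<tau> g = x0 + (\<Sum>i<g. s i)" for g
  have mono: "mono \<tau>"
    unfolding \<tau>_def by (intro monoI add_left_mono sum_mono2) (auto intro: less_imp_le s0)
  have nsum: "\<not> summable s"
  proof
    assume "summable s"
    then have "summable (\<lambda>i. (t0 + G) / \<eta> * s i)" by (rule summable_mult)
    moreover have "norm (inverse (of_nat (Suc i)) :: real) \<le> (t0 + G) / \<eta> * s i" for i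
    proof -
      have "t0 + of_nat i * G \<le> (t0 + G) * of_nat (Suc i)"
        using assms by (simp add: algebra_simps)
      then have "1 / of_nat (Suc i) \<le> (t0 + G) / (t0 + of_nat i * G)"
        using den[of i] by (simp add: divide_le_eq pos_le_divide_eq mult.commute del: of_nat_Suc)
      then show ?thesis using assms by (simp add: s_def inverse_eq_divide del: of_nat_Suc)
    qed
    ultimately have "summable (\<lambda>i. inverse (of_nat (Suc i)) :: real)"
      by (rule summable_comparison_test'[where N = 0])
    then show False using not_summable_harmonic[where 'a = real]
        summable_Suc_iff[where f = "\<lambda>n. inverse (of_nat n) :: real"] by simp
  qed
  have ex: "\<exists>N. \<tau> N > x" for x
  proof (rule ccontr)
    assume "\<nexists>N. \<tau> N > x"
    then have "(\<Sum>i<n. s i) \<le> x - x0" for n by (simp add: \<tau>_def not_less algebra_simps)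
    then have "summable s" using s0 by (intro summableI_nonneg_bounded[of s "x - x0"]) (auto intro: less_imp_le)
    then show False using nsum by simp
  qed
  define N where "N = (LEAST N. \<tau> N > x1)"
  have N: "\<tau> N > x1" unfolding N_def by (rule LeastI_ex[OF ex])
  have below: "\<tau> g \<le> x1" if "g < N" for g using not_less_Least[OF that[unfolded N_def]] by simp
  show ?thesis
  proof (rule that[OF mono])
    show "x0 \<le> \<tau> g \<and> \<tau> g \<le> x1" if "g < N" for g
      using below[OF that] sum_nonneg[of "{..<g}" s] s0 by (auto simp: \<tau>_def less_imp_le)
    fix x assume x: "x0 \<le> x" "x \<le> x1"
    define h where "h = (LEAST h. \<tau> h > x)"
    have h: "\<tau> h > x" unfolding h_def by (rule LeastI_ex[OF ex])
    have "h \<noteq> 0" using h x by (intro notI) (simp add: \<tau>_def)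
    then obtain g where g: "h = Suc g" by (cases h) auto
    then have "\<not> \<tau> g > x" using not_less_Least[of g "\<lambda>h. \<tau> h > x"] by (simp add: h_def)
    moreover have "h \<le> N" unfolding h_def using N x by (intro Least_le) simp
    ultimately have "g < N" "\<bar>x - \<tau> g\<bar> \<le> s g" using h g by (auto simp: \<tau>_def)
    then show "\<exists>g<N. \<bar>x - \<tau> g\<bar> * (t0 + of_nat g * G) \<le> \<eta>"
      using den[of g] by (auto simp: s_def pos_le_divide_eq)
  qed
qed

lemma circle_net:
  assumes "0 < (e::real)"
  obtains P :: nat where "P > 0" "\<And>\<theta>. \<exists>p<P. \<exists>k::int. \<bar>\<theta> - 2 * pi * of_nat p / of_nat P - 2 * pi * of_int k\<bar> \<le> e"
proof -
  define P where "P = nat \<lceil>2 * pi / e\<rceil>"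
  have "2 * pi / e > 0" using assms by simp
  then have P: "P > 0" "2 * pi / e \<le> of_nat P" unfolding P_def by linarith+
  then have Pe: "2 * pi / of_nat P \<le> e" using assms by (simp add: field_simps)
  show ?thesis
  proof (rule that[OF P(1)])
    fix \<theta> :: real
    define m where "m = \<lfloor>\<theta> * of_nat P / (2 * pi)\<rfloor>"
    define p where "p = nat (m mod int P)"
    have p: "p < P" using P(1) by (simp add: p_def nat_less_iff)
    have "m = int p + int P * (m div int P)" using P(1) by (simp add: p_def)
    then have m: "of_int m = real p + real P * of_int (m div int P)"
      by (metis of_int_add of_int_mult of_int_of_nat_eq)
    have "\<bar>\<theta> * of_nat P / (2 * pi) - of_int m\<bar> \<le> 1" unfolding m_def by linarith
    moreover have "\<theta> - 2 * pi * of_int m / of_nat P = (\<theta> * of_nat P / (2 * pi) - of_int m) * (2 * pi / of_nat P)"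
      using P(1) by (simp add: field_simps)
    ultimately have "\<bar>\<theta> - 2 * pi * of_int m / of_nat P\<bar> \<le> 1 * (2 * pi / of_nat P)"
      by (simp only: abs_mult) (intro mult_mono, auto)
    also have "\<dots> \<le> e" using Pe by simp
    also have "2 * pi * of_int m / of_nat P = 2 * pi * of_nat p / of_nat P + 2 * pi * of_int (m div int P)"
      using P(1) by (simp add: m field_simps)
    finally have "\<bar>\<theta> - 2 * pi * of_nat p / of_nat P - 2 * pi * of_int (m div int P)\<bar> \<le> e"
      by (simp add: algebra_simps)
    then show "\<exists>p<P. \<exists>k::int. \<bar>\<theta> - 2 * pi * of_nat p / of_nat P - 2 * pi * of_int k\<bar> \<le> e"
      using p by blast
  qed
qed

text \<open>The points \<open>pos i\<close> are the centres of the discs on which an entire function is prescribed, up to the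
factor \<open>\<nu> i\<close>. The last clause limits the growth of the factors from left to right: under
differentiation a block of prescribed Taylor coefficients is disturbed by all later blocks, and the
clause keeps that disturbance small.\<close>
definition separated_sweep ::
    "real \<Rightarrow> real \<Rightarrow> real \<Rightarrow> 'i set \<Rightarrow> ('i \<Rightarrow> complex) \<Rightarrow> ('i \<Rightarrow> complex) \<Rightarrow> bool" where
  "separated_sweep T C R0 I pos \<nu> \<longleftrightarrow> finite I \<and>
    (\<forall>i\<in>I. R0 \<le> Re (pos i) \<and> \<nu> i \<noteq> 0 \<and> norm (\<nu> i) \<le> exp (T * Re (pos i))) \<and>
    (\<forall>i\<in>I. \<forall>j\<in>I. i \<noteq> j \<longrightarrow> C \<le> norm (pos i - pos j)) \<and>
    (\<forall>i\<in>I. \<forall>j\<in>I. Re (pos i) \<le> Re (pos j) \<longrightarrow>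
       norm (\<nu> j) \<le> norm (\<nu> i) * exp (T * (Re (pos j) - Re (pos i))))"

text \<open>Some iterate of \<open>f \<mapsto> \<mu> f(\<cdot> + a)\<close> looks at the disc around \<open>pos i\<close> and undoes the factor \<open>\<nu> i\<close>.\<close>
definition sweep_hits ::
    "real \<Rightarrow> real \<Rightarrow> 'i set \<Rightarrow> ('i \<Rightarrow> complex) \<Rightarrow> ('i \<Rightarrow> complex) \<Rightarrow> complex \<Rightarrow> complex \<Rightarrow> bool" where
  "sweep_hits \<delta> \<epsilon> I pos \<nu> a \<mu> \<longleftrightarrow>
    (\<exists>n. \<exists>i\<in>I. norm (of_nat n * a - pos i) < \<delta> \<and> norm (\<mu> ^ n * \<nu> i - 1) < \<epsilon>)"

text \<open>With \<open>\<mu> = exp \<zeta>\<close> one has to arrange that \<open>n a\<close> is close to \<open>pos i\<close> and that the exponent \<open>n \<zeta>\<close> plus the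
logarithm of \<open>\<nu> i\<close> is close to \<open>2 \<pi> \<i> \<int>\<close>. In the neighbourhood of \<open>(1, \<zeta>0)\<close> four real parameters are met as
follows. The quotient \<open>Re \<zeta> / Re a\<close>, the exponential rate per unit of length, is met by the rates \<open>\<tau> g\<close> of
\<open>harmonic_sweep\<close>, one for each vertical strip at abscissa \<open>tg\<close>. For given \<open>a\<close> let \<open>n0\<close> be the first index
with \<open>Re (n0 a) \<ge> tg\<close>. Then \<open>n0 a\<close> lies in a strip of width \<open>2\<close> and is met by a square grid of mesh \<open>d\<close>,
and the phase of \<open>exp (n0 \<zeta>)\<close> by \<open>P\<close> equally spaced phases.

The grid is finer than the required separation \<open>C\<close>. Therefore grid points are sorted into \<open>Q = U V P\<close>
classes, by column, by row modulo \<open>V\<close> and by phase, and the class with number \<open>idx\<close> is shifted to the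
right by \<open>M idx\<close>; the index \<open>n0\<close> becomes \<open>n0 + M idx\<close>. The shifts are bounded by \<open>M Q\<close>, a constant chosen
before \<open>\<kappa>\<close>, so that \<open>a\<close> and \<open>\<zeta>\<close> behave like \<open>1\<close> and \<open>\<zeta>0\<close> over that range.\<close>
lemma sweep_exponential:
  fixes \<zeta>0 :: complex
  defines "T \<equiv> \<bar>Re \<zeta>0\<bar> + 1"
  assumes C: "0 < C" and \<delta>: "0 < \<delta>" and \<epsilon>: "0 < \<epsilon>"
  shows "\<exists>\<kappa>>0. \<forall>R0. \<exists>(I :: (nat \<times> int) set) pos \<nu>. separated_sweep T C R0 I pos \<nu> \<and>
    (\<forall>a \<zeta>. norm (a - 1) < \<kappa> \<longrightarrow> norm (\<zeta> - \<zeta>0) < \<kappa> \<longrightarrow> sweep_hits \<delta> \<epsilon> I pos \<nu> a (exp \<zeta>))"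
proof -
  have T1: "T \<ge> 1" by (simp add: T_def)
  have "(exp \<longlongrightarrow> exp (0::complex)) (at 0)" by (intro tendsto_intros)
  then obtain \<epsilon>2 where \<epsilon>2: "\<epsilon>2 > 0" "\<And>E :: complex. E \<noteq> 0 \<Longrightarrow> norm E < \<epsilon>2 \<Longrightarrow> norm (exp E - 1) < \<epsilon>"
    unfolding LIM_eq using \<epsilon> by (metis diff_zero exp_zero)
  have \<epsilon>2': "norm (exp E - 1) < \<epsilon>" if "norm E < \<epsilon>2" for E :: complex
    using \<epsilon>2(2)[OF _ that] \<epsilon> by (cases "E = 0") auto
  define d where "d = min (1/2) (min (\<delta> / 4) (\<epsilon>2 / (8 * T)))"
  have d: "d > 0" "d \<le> 1/2" "d \<le> \<delta> / 4" "d \<le> \<epsilon>2 / (8 * T)"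
    using \<delta> \<epsilon>2(1) T1 by (auto simp: d_def)
  have Td: "T * d \<le> \<epsilon>2 / 8" using mult_left_mono[OF d(4), of T] T1 by simp
  define U where "U = nat \<lceil>2 / d\<rceil> + 1"
  have U: "2 / d < of_nat U" "of_nat U \<le> 2 / d + 2" using d(1) by (simp_all add: U_def) linarith+
  have dU: "d * of_nat U \<le> 3"
    using mult_left_mono[OF U(2), of d] d by (simp add: distrib_left)
  define V where "V = nat \<lceil>C / d\<rceil> + 1"
  have V: "V > 0" "C \<le> d * of_nat V"
  proof -
    have "C / d \<le> of_nat V" unfolding V_def by linarith
    then show "C \<le> d * of_nat V" using d(1) by (simp add: field_simps)
  qed (simp add: V_def)
  obtain P :: nat where P: "P > 0" "\<And>\<theta>. \<exists>p<P. \<exists>k::int. \<bar>\<theta> - 2 * pi * of_nat p / of_nat P - 2 * pi * of_int k\<bar> \<le> \<epsilon>2 / 8"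
    using circle_net[of "\<epsilon>2 / 8"] \<epsilon>2(1) by auto
  define Q where "Q = U * (V * P)"
  have U0: "U > 0" by (simp add: U_def)
  have Q: "Q > 0" using U0 V P by (simp add: Q_def)
  define M where "M = nat \<lceil>C\<rceil> + 3"
  have M: "C + 3 \<le> of_nat M" unfolding M_def by simp linarith
  have M0: "M > 0" by (simp add: M_def)
  define \<kappa> where "\<kappa> = min (1 / (2 * T)) (min (\<delta> / 4) (\<epsilon>2 / (8 * T)) / of_nat (M * Q))"
  have MQ: "of_nat (M * Q) > (0::real)" using M0 Q by simp
  have \<kappa>: "\<kappa> > 0" "\<kappa> \<le> 1 / (2 * T)" "of_nat (M * Q) * \<kappa> \<le> min (\<delta> / 4) (\<epsilon>2 / (8 * T))"
  proof -
    show "\<kappa> > 0" unfolding \<kappa>_def using MQ \<delta> \<epsilon>2(1) T1 by simp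
    show "\<kappa> \<le> 1 / (2 * T)" unfolding \<kappa>_def by simp
    have "\<kappa> \<le> min (\<delta> / 4) (\<epsilon>2 / (8 * T)) / of_nat (M * Q)" unfolding \<kappa>_def by simp
    then show "of_nat (M * Q) * \<kappa> \<le> min (\<delta> / 4) (\<epsilon>2 / (8 * T))"
      using MQ by (simp only: pos_le_divide_eq mult.commute)
  qed
  have MQk: "of_nat (M * Q) * \<kappa> \<le> \<delta> / 4" "of_nat (M * Q) * \<kappa> \<le> \<epsilon>2 / (8 * T)" using \<kappa>(3) by auto
  have "1 / (2 * T) \<le> 1 / 2" using T1 by simp
  then have \<kappa>12: "\<kappa> \<le> 1/2" using \<kappa>(2) by linarith
  have TMQk: "T * (of_nat (M * Q) * \<kappa>) \<le> \<epsilon>2 / 8"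
    using mult_left_mono[OF MQk(2), of T] T1 by simp
  have MQke: "of_nat (M * Q) * \<kappa> \<le> \<epsilon>2 / 8"
  proof -
    have "0 \<le> of_nat (M * Q) * \<kappa>" using MQ \<kappa>(1) by (intro mult_nonneg_nonneg) auto
    then have "1 * (of_nat (M * Q) * \<kappa>) \<le> T * (of_nat (M * Q) * \<kappa>)" by (rule mult_right_mono[OF T1])
    then show ?thesis using TMQk by linarith
  qed
  show ?thesis
  proof (intro exI[of _ \<kappa>] conjI allI \<kappa>(1))
    fix R0 :: real
    define t0 where "t0 = max R0 (of_nat (M * Q) + 3)"
    have t0: "R0 \<le> t0" "of_nat (M * Q) + 3 \<le> t0" "t0 > 0" using MQ by (auto simp: t0_def)
    obtain \<tau> N where \<tau>: "mono \<tau>" "\<And>g. g < N \<Longrightarrow> Re \<zeta>0 - 1 \<le> \<tau> g \<and> \<tau> g \<le> Re \<zeta>0 + 1"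
      "\<And>x. Re \<zeta>0 - 1 \<le> x \<Longrightarrow> x \<le> Re \<zeta>0 + 1 \<Longrightarrow> \<exists>g<N. \<bar>x - \<tau> g\<bar> * (t0 + of_nat g * of_nat (M * Q)) \<le> \<epsilon>2 / 16"
      using harmonic_sweep[OF t0(3) MQ, of "\<epsilon>2 / 16" "Re \<zeta>0 - 1" "Re \<zeta>0 + 1"] \<epsilon>2(1) by auto
    have \<tau>T: "\<bar>\<tau> g\<bar> \<le> T" if "g < N" for g using \<tau>(2)[OF that] by (auto simp: T_def)
    \<comment> \<open>\<open>j = g Q + idx\<close> encodes the strip \<open>g\<close> and the class \<open>idx = u + U (vm + V p)\<close>.\<close>
    define u where "u j = (j mod Q) mod U" for j
    define vm where "vm j = ((j mod Q) div U) mod V" for j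
    define p where "p j = ((j mod Q) div U) div V" for j
    define W where "W = \<lceil>(t0 + of_nat N * of_nat (M * Q) + 2) / d\<rceil> + 1"
    define I where "I = {(j, v). j < N * Q \<and> \<bar>v\<bar> \<le> W \<and> v mod int V = int (vm j)}"
    define pos where "pos = (\<lambda>(j, v). Complex (t0 + of_nat (M * j) + d * of_nat (u j)) (d * of_int v))"
    define \<nu> where "\<nu> = (\<lambda>(j, v). exp (Complex (- (\<tau> (j div Q) * Re (pos (j, v))))
      (- (of_nat (M * (j mod Q)) * Im \<zeta>0 + 2 * pi * of_nat (p j) / of_nat P))))"
    have gN: "j div Q < N" if "(j, v) \<in> I" for j v
      using that Q by (simp add: I_def less_mult_imp_div_less)
    have uU: "d * of_nat (u j) \<le> 3" "0 \<le> d * of_nat (u j)" for j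
    proof -
      have "u j \<le> U" using U0 by (simp add: u_def less_imp_le)
      then have "d * of_nat (u j) \<le> d * of_nat U" using d(1) by simp
      then show "d * of_nat (u j) \<le> 3" using dU by linarith
      show "0 \<le> d * of_nat (u j)" using d(1) by simp
    qed
    have Re_gap: "Re (pos (j, v)) + C \<le> Re (pos (k, w))" if "j < k" for j k v w
    proof -
      have "M * j + M \<le> M * k" using that by (metis Suc_leI mult_Suc_right add.commute mult_le_mono2)
      then have "real (M * j) + real M \<le> real (M * k)" by linarith
      then show ?thesis using uU[of j] uU[of k] M by (simp add: pos_def)
    qed
    have norm_\<nu>: "norm (\<nu> (j, v)) = exp (- (\<tau> (j div Q) * Re (pos (j, v))))" for j v
      by (simp add: \<nu>_def)
    have Re0: "t0 \<le> Re (pos i)" for i using uU by (cases i) (auto simp: pos_def intro!: add_nonneg_nonneg)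
    show "\<exists>(I :: (nat \<times> int) set) pos \<nu>. separated_sweep T C R0 I pos \<nu> \<and>
      (\<forall>a \<zeta>. norm (a - 1) < \<kappa> \<longrightarrow> norm (\<zeta> - \<zeta>0) < \<kappa> \<longrightarrow> sweep_hits \<delta> \<epsilon> I pos \<nu> a (exp \<zeta>))"
      unfolding separated_sweep_def
    proof (rule exI[of _ I], rule exI[of _ pos], rule exI[of _ \<nu>], intro conjI ballI impI allI)
      have "I \<subseteq> {..<N * Q} \<times> {-W..W}" by (auto simp: I_def)
      then show "finite I" by (rule finite_subset) auto
    next
      fix i assume "i \<in> I"
      show "R0 \<le> Re (pos i)" using Re0[of i] t0 by linarith
      show "\<nu> i \<noteq> 0" by (cases i) (simp add: \<nu>_def)
      obtain j v where i: "i = (j, v)" by (cases i)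
      have "- \<tau> (j div Q) * Re (pos i) \<le> T * Re (pos i)"
        using \<tau>T[OF gN] \<open>i \<in> I\<close> Re0[of i] t0 i by (intro mult_right_mono) (auto simp: abs_le_iff)
      then show "norm (\<nu> i) \<le> exp (T * Re (pos i))" by (simp add: i norm_\<nu>)
    next
      fix i i' assume i: "i \<in> I" "i' \<in> I" "i \<noteq> i'"
      obtain j v where jv: "i = (j, v)" by (cases i)
      obtain k w where kw: "i' = (k, w)" by (cases i')
      show "C \<le> norm (pos i - pos i')"
      proof (cases "j = k")
        case True
        then have "v \<noteq> w" "v mod int V = w mod int V" using i jv kw by (auto simp: I_def)
        then have "int V dvd v - w" by (simp add: mod_eq_dvd_iff)
        then have "int V \<le> \<bar>v - w\<bar>" using \<open>v \<noteq> w\<close>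
          by (metis abs_of_nat dvd_imp_le_int right_minus_eq)
        then have "real V \<le> \<bar>of_int v - of_int w\<bar>" by linarith
        then have "d * real V \<le> \<bar>d * (of_int v - of_int w)\<bar>" using d(1) by (simp add: abs_mult)
        also have "\<dots> = \<bar>Im (pos i - pos i')\<bar>" by (simp add: jv kw pos_def right_diff_distrib)
        also have "\<dots> \<le> norm (pos i - pos i')" by (rule abs_Im_le_cmod)
        finally show ?thesis using V(2) by linarith
      next
        case False
        then have "C \<le> \<bar>Re (pos i - pos i')\<bar>"
          using Re_gap[of j k v w] Re_gap[of k j w v] jv kw by (cases "j < k") auto
        then show ?thesis using abs_Re_le_cmod[of "pos i - pos i'"] by linarith
      qed
    next
      fix i i' assume i: "i \<in> I" "i' \<in> I" "Re (pos i) \<le> Re (pos i')"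
      obtain j v where jv: "i = (j, v)" by (cases i)
      obtain k w where kw: "i' = (k, w)" by (cases i')
      have "j \<le> k" using Re_gap[of k j w v] C i(3) jv kw by (cases "j \<le> k") auto
      then have "\<tau> (j div Q) \<le> \<tau> (k div Q)" using \<tau>(1) by (simp add: div_le_mono monoD)
      then have "0 \<le> (\<tau> (k div Q) - \<tau> (j div Q)) * Re (pos i)"
        using Re0[of i] t0 by (intro mult_nonneg_nonneg) auto
      moreover have "- \<tau> (k div Q) * (Re (pos i') - Re (pos i)) \<le> T * (Re (pos i') - Re (pos i))"
        using \<tau>T[OF gN] i kw by (intro mult_right_mono) (auto simp: abs_le_iff)
      ultimately have "- (\<tau> (k div Q) * Re (pos i')) \<le> - (\<tau> (j div Q) * Re (pos i)) + T * (Re (pos i') - Re (pos i))"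
        by (simp add: algebra_simps)
      then show "norm (\<nu> i') \<le> norm (\<nu> i) * exp (T * (Re (pos i') - Re (pos i)))"
        by (simp add: jv kw norm_\<nu> flip: exp_add)
    next
      fix a \<zeta> :: complex assume a: "norm (a - 1) < \<kappa>" and \<zeta>: "norm (\<zeta> - \<zeta>0) < \<kappa>"
      have Rea: "\<bar>Re a - 1\<bar> < \<kappa>" and Ima: "\<bar>Im a\<bar> < \<kappa>"
        using abs_Re_le_cmod[of "a - 1"] abs_Im_le_cmod[of "a - 1"] a by auto
      have Re\<zeta>: "\<bar>Re \<zeta> - Re \<zeta>0\<bar> < \<kappa>" and Im\<zeta>: "\<bar>Im \<zeta> - Im \<zeta>0\<bar> < \<kappa>"
        using abs_Re_le_cmod[of "\<zeta> - \<zeta>0"] abs_Im_le_cmod[of "\<zeta> - \<zeta>0"] \<zeta> by auto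
      have Rea2: "1/2 \<le> Re a" "Re a \<le> 3/2" "Re a > 0" using Rea \<kappa>12 by linarith+
      define x where "x = Re \<zeta> / Re a"
      have xa: "x * Re a = Re \<zeta>" using Rea2 by (simp add: x_def)
      have x1: "\<bar>x - Re \<zeta>0\<bar> \<le> 1"
      proof -
        have "(x - Re \<zeta>0) * Re a = (Re \<zeta> - Re \<zeta>0) - Re \<zeta>0 * (Re a - 1)" using xa by (simp add: algebra_simps)
        then have "\<bar>x - Re \<zeta>0\<bar> * Re a \<le> \<bar>Re \<zeta> - Re \<zeta>0\<bar> + \<bar>Re \<zeta>0\<bar> * \<bar>Re a - 1\<bar>"
          using Rea2 by (metis abs_mult abs_of_pos abs_triangle_ineq4)
        also have "\<dots> \<le> \<kappa> + \<bar>Re \<zeta>0\<bar> * \<kappa>" using Re\<zeta> Rea by (intro add_mono mult_left_mono) auto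
        also have "\<dots> = T * \<kappa>" by (simp add: T_def algebra_simps)
        also have "\<dots> \<le> 1/2" using mult_left_mono[OF \<kappa>(2), of T] T1 by simp
        finally have le: "\<bar>x - Re \<zeta>0\<bar> * Re a \<le> 1/2" .
        have "\<bar>x - Re \<zeta>0\<bar> * (1/2) \<le> \<bar>x - Re \<zeta>0\<bar> * Re a" using Rea2 by (intro mult_left_mono) auto
        from order_trans[OF this le] show ?thesis by simp
      qed
      then have xT: "\<bar>x\<bar> \<le> T" by (auto simp: T_def)
      obtain g where g: "g < N" "\<bar>x - \<tau> g\<bar> * (t0 + of_nat g * of_nat (M * Q)) \<le> \<epsilon>2 / 16"
        using \<tau>(3)[of x] x1 by (auto simp: abs_le_iff)
      define tg where "tg = t0 + real g * real (M * Q)"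
      have tg: "t0 \<le> tg" "tg \<le> t0 + of_nat N * of_nat (M * Q)" "tg > 0"
      proof -
        have "real g * real (M * Q) \<le> real N * real (M * Q)" using g(1) by (intro mult_right_mono) auto
        then show "tg \<le> t0 + of_nat N * of_nat (M * Q)" by (simp add: tg_def)
        show "t0 \<le> tg" by (simp add: tg_def)
        then show "tg > 0" using t0 by linarith
      qed
      \<comment> \<open>The real part of \<open>n * a\<close> advances by less than \<open>2\<close> per step, so the first index beyond \<open>tg\<close> lands in the strip.\<close>
      define n0 where "n0 = nat \<lceil>tg / Re a\<rceil>"
      have "tg / Re a > 0" using tg Rea2 by simp
      then have n0r: "tg / Re a \<le> of_nat n0" "of_nat n0 \<le> tg / Re a + 1" unfolding n0_def by linarith+
      have n0: "tg \<le> of_nat n0 * Re a" "of_nat n0 * Re a < tg + 2"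
      proof -
        show "tg \<le> of_nat n0 * Re a" using n0r(1) Rea2 by (simp add: pos_divide_le_eq)
        have "of_nat n0 * Re a \<le> (tg / Re a + 1) * Re a" using n0r(2) Rea2 by (intro mult_right_mono) auto
        then show "of_nat n0 * Re a < tg + 2" using Rea2 by (simp add: distrib_right)
      qed
      define uu where "uu = nat \<lfloor>(of_nat n0 * Re a - tg) / d\<rfloor>"
      have q0: "(of_nat n0 * Re a - tg) / d \<ge> 0" "(of_nat n0 * Re a - tg) / d < 2 / d"
        using n0 d(1) by (simp_all add: divide_strict_right_mono)
      then have uu: "uu < U" "\<bar>(of_nat n0 * Re a - tg) / d - of_nat uu\<bar> \<le> 1"
        using U(1) unfolding uu_def by linarith+
      have uu': "\<bar>of_nat n0 * Re a - tg - d * of_nat uu\<bar> \<le> d"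
      proof -
        have "of_nat n0 * Re a - tg - d * of_nat uu = d * ((of_nat n0 * Re a - tg) / d - of_nat uu)"
          using d(1) by (simp add: field_simps)
        then have "\<bar>of_nat n0 * Re a - tg - d * of_nat uu\<bar> = d * \<bar>(of_nat n0 * Re a - tg) / d - of_nat uu\<bar>"
          using d(1) by (simp add: abs_mult)
        also have "\<dots> \<le> d * 1" using uu(2) d(1) by (intro mult_left_mono) auto
        finally show ?thesis by simp
      qed
      define v where "v = \<lfloor>of_nat n0 * Im a / d\<rfloor>"
      have v1: "\<bar>of_nat n0 * Im a / d - of_int v\<bar> \<le> 1" unfolding v_def by linarith
      have v': "\<bar>of_nat n0 * Im a - d * of_int v\<bar> \<le> d"
      proof -
        have "of_nat n0 * Im a - d * of_int v = d * (of_nat n0 * Im a / d - of_int v)"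
          using d(1) by (simp add: field_simps)
        then have "\<bar>of_nat n0 * Im a - d * of_int v\<bar> = d * \<bar>of_nat n0 * Im a / d - of_int v\<bar>"
          using d(1) by (simp add: abs_mult)
        also have "\<dots> \<le> d * 1" using v1 d(1) by (intro mult_left_mono) auto
        finally show ?thesis by simp
      qed
      have vW: "\<bar>v\<bar> \<le> W"
      proof -
        have "\<bar>of_nat n0 * Im a\<bar> \<le> of_nat n0 * Re a"
          using Ima Rea2 \<kappa>12 by (simp add: abs_mult mult_left_mono)
        also have "\<dots> \<le> t0 + of_nat N * of_nat (M * Q) + 2" using n0 tg by linarith
        finally have "\<bar>of_nat n0 * Im a / d\<bar> \<le> (t0 + of_nat N * of_nat (M * Q) + 2) / d"
          using d(1) by (simp add: divide_right_mono)
        moreover have "\<bar>A\<bar> \<le> X \<Longrightarrow> \<bar>A - of_int v\<bar> \<le> 1 \<Longrightarrow> \<bar>v\<bar> \<le> \<lceil>X\<rceil> + 1" for A X :: real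
          by linarith
        ultimately show ?thesis unfolding W_def using v1 by blast
      qed
      obtain q k where q: "q < P" "\<bar>of_nat n0 * Im \<zeta> - 2 * pi * of_nat q / of_nat P - 2 * pi * of_int k\<bar> \<le> \<epsilon>2 / 8"
        using P(2)[of "of_nat n0 * Im \<zeta>"] by auto
      define w where "w = nat (v mod int V)"
      have w: "w < V" "int w = v mod int V" using V by (auto simp: w_def nat_less_iff)
      define idx where "idx = uu + U * (w + V * q)"
      have wq: "w + V * q < V * P"
      proof -
        have "w + V * q < V * Suc q" using w by simp
        also have "\<dots> \<le> V * P" using q(1) by (intro mult_le_mono2) simp
        finally show ?thesis .
      qed
      have idxQ: "idx < Q"
      proof -
        have "idx < U * Suc (w + V * q)" using uu(1) by (simp add: idx_def)
        also have "\<dots> \<le> U * (V * P)" using wq by (intro mult_le_mono2) simp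
        finally show ?thesis by (simp add: Q_def)
      qed
      define j where "j = g * Q + idx"
      have j: "j mod Q = idx" "j div Q = g" "u j = uu" "vm j = w" "p j = q"
      proof -
        show 1: "j mod Q = idx" "j div Q = g" using idxQ by (simp_all add: j_def)
        have 2: "idx mod U = uu" "idx div U = w + V * q" using uu(1) by (simp_all add: idx_def)
        show "u j = uu" by (simp add: u_def 1 2)
        show "vm j = w" "p j = q" using w(1) by (simp_all add: vm_def p_def 1 2)
      qed
      have jN: "j < N * Q"
      proof -
        have "j < Suc g * Q" using idxQ by (simp add: j_def)
        also have "\<dots> \<le> N * Q" using g(1) by (intro mult_le_mono1) simp
        finally show ?thesis .
      qed
      have I: "(j, v) \<in> I" using jN vW w j by (simp add: I_def)
      define J where "J = M * idx"
      have J: "real J * \<kappa> \<le> real (M * Q) * \<kappa>" using idxQ \<kappa>(1)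
        by (intro mult_right_mono of_nat_mono) (simp_all add: J_def)
      have Mj: "t0 + of_nat (M * j) = tg + of_nat J"
        by (simp add: j_def tg_def J_def algebra_simps)
      have pos: "pos (j, v) = Complex (tg + of_nat J + d * of_nat uu) (d * of_int v)"
        using Mj by (simp add: pos_def j)
      have Jx: "\<bar>of_nat J * y\<bar> \<le> real (M * Q) * \<kappa>" if "\<bar>y\<bar> < \<kappa>" for y
      proof -
        have "\<bar>of_nat J * y\<bar> \<le> real J * \<kappa>" using that by (simp add: abs_mult mult_left_mono)
        then show ?thesis using J by linarith
      qed
      have ReD: "\<bar>of_nat (n0 + J) * Re a - Re (pos (j, v))\<bar> \<le> d + real (M * Q) * \<kappa>"
      proof -
        have "of_nat (n0 + J) * Re a - Re (pos (j, v)) = (of_nat n0 * Re a - tg - d * of_nat uu) + of_nat J * (Re a - 1)"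
          by (simp add: pos algebra_simps)
        then show ?thesis using uu' Jx[OF Rea] by linarith
      qed
      have ImD: "\<bar>of_nat (n0 + J) * Im a - Im (pos (j, v))\<bar> \<le> d + real (M * Q) * \<kappa>"
      proof -
        have "of_nat (n0 + J) * Im a - Im (pos (j, v)) = (of_nat n0 * Im a - d * of_int v) + of_nat J * Im a"
          by (simp add: pos algebra_simps)
        then show ?thesis using v' Jx[OF Ima] by linarith
      qed
      have D: "norm (of_nat (n0 + J) * a - pos (j, v)) < \<delta>"
      proof -
        have e1: "of_nat (n0 + J) * a - pos (j, v)
          = (of_nat n0 * a - Complex (tg + d * of_nat uu) (d * of_int v)) + of_nat J * (a - 1)"
          by (simp add: pos complex_eq_iff algebra_simps)
        have "norm (of_nat n0 * a - Complex (tg + d * of_nat uu) (d * of_int v)) \<le> d + d"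
          using uu' v' cmod_le[of "of_nat n0 * a - Complex (tg + d * of_nat uu) (d * of_int v)"]
          by (simp add: diff_diff_eq)
        moreover have "norm (of_nat J * (a - 1)) < \<delta> / 2"
        proof -
          have "norm (of_nat J * (a - 1)) \<le> real J * \<kappa>" using a by (simp add: norm_mult mult_left_mono)
          then show ?thesis using J MQk(1) \<delta> by linarith
        qed
        ultimately show ?thesis unfolding e1 using d(3)
          norm_triangle_ineq[of "of_nat n0 * a - Complex (tg + d * of_nat uu) (d * of_int v)" "of_nat J * (a - 1)"]
          by linarith
      qed
      \<comment> \<open>The exponent of \<open>\<mu> ^ n * \<nu>\<close>, reduced by the multiple of \<open>2 \<pi> \<i>\<close> that the choice of phase leaves.\<close>
      define E where "E = of_nat (n0 + J) * \<zeta> + Complex (- (\<tau> g * Re (pos (j, v))))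
        (- (of_nat J * Im \<zeta>0 + 2 * pi * of_nat q / of_nat P)) - \<i> * of_real (2 * pi * of_int k)"
      have Eeq: "exp (of_nat (n0 + J) * \<zeta>) * \<nu> (j, v) = exp E"
      proof -
        have "exp (\<i> * of_real (2 * pi * of_int k)) = 1"
          using exp_integer_2pi[of "of_int k"] by (simp add: mult_ac)
        then show ?thesis by (simp add: E_def \<nu>_def j J_def exp_diff exp_add)
      qed
      have "\<bar>Re E\<bar> \<le> 3 * \<epsilon>2 / 8"
      proof -
        let ?b = "Re (pos (j, v))"
        have "Re E = x * (of_nat (n0 + J) * Re a - ?b) + (x - \<tau> g) * ?b"
          by (simp add: E_def xa[symmetric] algebra_simps)
        moreover have "\<bar>x * (of_nat (n0 + J) * Re a - ?b)\<bar> \<le> \<epsilon>2 / 4"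
        proof -
          have "\<bar>x * (of_nat (n0 + J) * Re a - ?b)\<bar> \<le> T * (d + real (M * Q) * \<kappa>)"
            unfolding abs_mult using xT ReD T1 by (intro mult_mono) auto
          then show ?thesis using Td TMQk by (simp add: distrib_left)
        qed
        moreover have "\<bar>(x - \<tau> g) * ?b\<bar> \<le> \<epsilon>2 / 8"
        proof -
          have "J \<le> M * Q" using idxQ by (simp add: J_def)
          then have "real J \<le> real (M * Q)" using of_nat_le_iff by blast
          then have "\<bar>?b\<bar> \<le> 2 * tg" using uU[of j] tg t0 by (simp add: pos j)
          then have "\<bar>x - \<tau> g\<bar> * \<bar>?b\<bar> \<le> \<bar>x - \<tau> g\<bar> * (2 * tg)" by (intro mult_left_mono) auto
          also have "\<dots> = 2 * (\<bar>x - \<tau> g\<bar> * tg)" by simp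
          also have "\<dots> \<le> 2 * (\<epsilon>2 / 16)" using g(2) unfolding tg_def by (rule mult_left_mono) simp
          finally show ?thesis by (simp add: abs_mult)
        qed
        ultimately show ?thesis by linarith
      qed
      moreover have "\<bar>Im E\<bar> \<le> \<epsilon>2 / 4"
      proof -
        have "Im E = (of_nat n0 * Im \<zeta> - 2 * pi * of_nat q / of_nat P - 2 * pi * of_int k) + of_nat J * (Im \<zeta> - Im \<zeta>0)"
          by (simp add: E_def algebra_simps)
        then show ?thesis using q(2) Jx[OF Im\<zeta>] MQke by linarith
      qed
      ultimately have "norm E < \<epsilon>2" using cmod_le[of E] \<epsilon>2(1) by linarith
      then have "norm (exp (of_nat (n0 + J) * \<zeta>) * \<nu> (j, v) - 1) < \<epsilon>" using \<epsilon>2' Eeq by simp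
      with D I show "sweep_hits \<delta> \<epsilon> I pos \<nu> a (exp \<zeta>)"
        unfolding sweep_hits_def exp_of_nat_mult[symmetric] by blast
    qed
  qed
qed

text \<open>A branch of the logarithm near \<open>\<mu>0\<close> turns \<open>\<mu>\<close> into \<open>exp \<zeta>\<close>.\<close>
lemma sweep_configuration:
  fixes \<mu>0 :: complex
  assumes "\<mu>0 \<noteq> 0" and C: "0 < C" "0 < \<delta>" "0 < \<epsilon>"
  shows "\<exists>\<kappa>>0. \<forall>R0. \<exists>(I :: (nat \<times> int) set) pos \<nu>.
    separated_sweep (\<bar>ln (norm \<mu>0)\<bar> + 1) C R0 I pos \<nu> \<and>
    (\<forall>a \<mu>. norm (a - 1) < \<kappa> \<longrightarrow> norm (\<mu> - \<mu>0) < \<kappa> \<longrightarrow> sweep_hits \<delta> \<epsilon> I pos \<nu> a \<mu>)"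
proof -
  have Re_Ln: "Re (Ln \<mu>0) = ln (norm \<mu>0)" using assms(1) by simp
  obtain \<kappa>1 where \<kappa>1: "\<kappa>1 > 0" and sweep: "\<forall>R0. \<exists>(I :: (nat \<times> int) set) pos \<nu>.
      separated_sweep (\<bar>ln (norm \<mu>0)\<bar> + 1) C R0 I pos \<nu> \<and>
      (\<forall>a \<zeta>. norm (a - 1) < \<kappa>1 \<longrightarrow> norm (\<zeta> - Ln \<mu>0) < \<kappa>1 \<longrightarrow> sweep_hits \<delta> \<epsilon> I pos \<nu> a (exp \<zeta>))"
    using sweep_exponential[OF C, of "Ln \<mu>0", unfolded Re_Ln] by (elim exE conjE) (rule that)
  have "isCont Ln 1" by (rule continuous_at_Ln) simp
  then have "(Ln \<longlongrightarrow> Ln 1) (at 1)" by (simp add: isCont_def)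
  then obtain d where d: "d > 0" "\<And>x. x \<noteq> 1 \<Longrightarrow> norm (x - 1) < d \<Longrightarrow> norm (Ln x) < \<kappa>1"
    unfolding LIM_eq using \<kappa>1 by (metis Ln_1 diff_zero)
  have lift: "\<exists>\<zeta>. exp \<zeta> = \<mu> \<and> norm (\<zeta> - Ln \<mu>0) < \<kappa>1"
    if "norm (\<mu> - \<mu>0) < min d (1/2) * norm \<mu>0" for \<mu>
  proof -
    have "\<mu> / \<mu>0 - 1 = (\<mu> - \<mu>0) / \<mu>0" using assms(1) by (simp add: diff_divide_distrib)
    then have *: "norm (\<mu> / \<mu>0 - 1) < min d (1/2)"
      using that assms(1) by (simp only: norm_divide pos_divide_less_eq zero_less_norm_iff not_False_eq_True)
    then have "\<mu> \<noteq> 0" by auto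
    have "norm (Ln (\<mu> / \<mu>0)) < \<kappa>1" using d(2)[of "\<mu> / \<mu>0"] * \<kappa>1 by (cases "\<mu> / \<mu>0 = 1") auto
    then show ?thesis using assms(1) \<open>\<mu> \<noteq> 0\<close>
      by (intro exI[of _ "Ln \<mu>0 + Ln (\<mu> / \<mu>0)"]) (simp add: exp_add)
  qed
  define \<kappa> where "\<kappa> = min \<kappa>1 (min d (1/2) * norm \<mu>0)"
  have \<kappa>: "\<kappa> > 0" "\<kappa> \<le> \<kappa>1" "\<kappa> \<le> min d (1/2) * norm \<mu>0" using \<kappa>1 d(1) assms(1) by (auto simp: \<kappa>_def)
  show ?thesis
  proof (intro exI[of _ \<kappa>] conjI allI \<kappa>(1))
    fix R0 :: real
    obtain I :: "(nat \<times> int) set" and pos \<nu> where I: "separated_sweep (\<bar>ln (norm \<mu>0)\<bar> + 1) C R0 I pos \<nu>"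
      "\<forall>a \<zeta>. norm (a - 1) < \<kappa>1 \<longrightarrow> norm (\<zeta> - Ln \<mu>0) < \<kappa>1 \<longrightarrow> sweep_hits \<delta> \<epsilon> I pos \<nu> a (exp \<zeta>)"
      using sweep[THEN spec, of R0] by (elim exE conjE) (rule that)
    have "sweep_hits \<delta> \<epsilon> I pos \<nu> a \<mu>" if "norm (a - 1) < \<kappa>" "norm (\<mu> - \<mu>0) < \<kappa>" for a \<mu>
    proof -
      obtain \<zeta> where "exp \<zeta> = \<mu>" "norm (\<zeta> - Ln \<mu>0) < \<kappa>1"
        using lift[OF order_less_le_trans[OF \<open>norm (\<mu> - \<mu>0) < \<kappa>\<close> \<kappa>(3)]] by blast
      then show ?thesis using I(2)[rule_format, of a \<zeta>] that(1) \<kappa>(2) by auto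
    qed
    with I(1) show "\<exists>(I :: (nat \<times> int) set) pos \<nu>. separated_sweep (\<bar>ln (norm \<mu>0)\<bar> + 1) C R0 I pos \<nu> \<and>
      (\<forall>a \<mu>. norm (a - 1) < \<kappa> \<longrightarrow> norm (\<mu> - \<mu>0) < \<kappa> \<longrightarrow> sweep_hits \<delta> \<epsilon> I pos \<nu> a \<mu>)"
      by blast
  qed
qed

text \<open>The counterpart of \<open>separated_sweep\<close> for differentiation: a member \<open>q\<close> of \<open>Q\<close> is the degree at which a
block of prescribed Taylor coefficients begins.\<close>
definition derivative_schedule :: "real \<Rightarrow> nat \<Rightarrow> nat \<Rightarrow> nat set \<Rightarrow> (nat \<Rightarrow> complex) \<Rightarrow> bool" where
  "derivative_schedule K N n0 Q \<nu> \<longleftrightarrow> finite Q \<and>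
    (\<forall>q\<in>Q. n0 \<le> q \<and> \<nu> q \<noteq> 0 \<and> norm (\<nu> q) \<le> K ^ (q + 1)) \<and>
    (\<forall>q\<in>Q. \<forall>q'\<in>Q. q < q' \<longrightarrow> q + N \<le> q' \<and> norm (\<nu> q') \<le> norm (\<nu> q) * K ^ (q' - q + 1))"

text \<open>The case \<open>a = 1\<close> of the sweep: those centres that are within \<open>1 / 4\<close> of a natural number \<open>q\<close> determine
\<open>q\<close>, and the separation of centres becomes a gap between these numbers. The bound \<open>K\<close> precedes the gap
\<open>N\<close>, which can thus be chosen to beat it.\<close>
lemma sweep_naturals:
  fixes \<mu>0 :: complex
  assumes \<mu>0: "\<mu>0 \<noteq> 0"
  shows "\<exists>K::real\<ge>1. \<forall>N \<epsilon>. \<epsilon> > 0 \<longrightarrow> (\<exists>\<kappa>>0. \<forall>n0. \<exists>Q \<nu>. derivative_schedule K N n0 Q \<nu> \<and>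
    (\<forall>\<mu>. norm (\<mu> - \<mu>0) < \<kappa> \<longrightarrow> (\<exists>q\<in>Q. norm (\<mu> ^ q * \<nu> q - 1) < \<epsilon>)))"
proof -
  define T where "T = \<bar>ln (norm \<mu>0)\<bar> + 1"
  define K where "K = exp T"
  have T: "T \<ge> 1" by (simp add: T_def)
  have K: "K \<ge> 1" using T by (simp add: K_def)
  have Kpow: "exp (T * x) \<le> K ^ n" if "x \<le> of_nat n" for x n
    using that T by (simp add: K_def mult_left_mono mult.commute flip: exp_of_nat_mult)
  show ?thesis
  proof (rule exI[of _ K], intro conjI allI impI K)
    fix N :: nat and \<epsilon> :: real assume \<epsilon>: "\<epsilon> > 0"
    have C: "(0::real) < of_nat N + 1" "(0::real) < 1/4" by auto
    obtain \<kappa> where \<kappa>: "\<kappa> > 0" and sweep: "\<forall>R0. \<exists>(I :: (nat \<times> int) set) pos \<nu>.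
        separated_sweep T (of_nat N + 1) R0 I pos \<nu> \<and>
        (\<forall>a \<mu>. norm (a - 1) < \<kappa> \<longrightarrow> norm (\<mu> - \<mu>0) < \<kappa> \<longrightarrow> sweep_hits (1/4) \<epsilon> I pos \<nu> a \<mu>)"
      using sweep_configuration[OF \<mu>0 C \<epsilon>, folded T_def] by (elim exE conjE) (rule that)
    show "\<exists>\<kappa>>0. \<forall>n0. \<exists>Q \<nu>. derivative_schedule K N n0 Q \<nu> \<and>
      (\<forall>\<mu>. norm (\<mu> - \<mu>0) < \<kappa> \<longrightarrow> (\<exists>q\<in>Q. norm (\<mu> ^ q * \<nu> q - 1) < \<epsilon>))"
    proof (intro exI[of _ \<kappa>] conjI allI \<kappa>)
      fix n0 :: nat
      obtain I :: "(nat \<times> int) set" and pos \<nu> where cfg: "separated_sweep T (of_nat N + 1) (of_nat n0 + 1) I pos \<nu>"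
        "\<forall>a \<mu>. norm (a - 1) < \<kappa> \<longrightarrow> norm (\<mu> - \<mu>0) < \<kappa> \<longrightarrow> sweep_hits (1/4) \<epsilon> I pos \<nu> a \<mu>"
        using sweep[THEN spec, of "of_nat n0 + 1"] by (elim exE conjE) (rule that)
      have I: "finite I"
        "\<And>i. i \<in> I \<Longrightarrow> of_nat n0 + 1 \<le> Re (pos i)" "\<And>i. i \<in> I \<Longrightarrow> \<nu> i \<noteq> 0"
        "\<And>i. i \<in> I \<Longrightarrow> norm (\<nu> i) \<le> exp (T * Re (pos i))"
        "\<And>i j. i \<in> I \<Longrightarrow> j \<in> I \<Longrightarrow> i \<noteq> j \<Longrightarrow> of_nat N + 1 \<le> norm (pos i - pos j)"
        "\<And>i j. i \<in> I \<Longrightarrow> j \<in> I \<Longrightarrow> Re (pos i) \<le> Re (pos j) \<Longrightarrow>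
           norm (\<nu> j) \<le> norm (\<nu> i) * exp (T * (Re (pos j) - Re (pos i)))"
        using cfg(1) unfolding separated_sweep_def by simp_all
      define near where "near n i \<longleftrightarrow> i \<in> I \<and> norm (of_nat n - pos i) < 1/4" for n :: nat and i
      have near_unique: "i = j" if "near n i" "near n j" for n i j
      proof (rule ccontr)
        assume "i \<noteq> j"
        then have "1 \<le> norm (pos i - pos j)" using I(5)[of i j] that by (auto simp: near_def)
        moreover have "norm (pos i - pos j) \<le> norm (of_nat n - pos j) + norm (of_nat n - pos i)"
          using norm_triangle_ineq4[of "of_nat n - pos j" "of_nat n - pos i"] by simp
        ultimately show False using that by (simp add: near_def)
      qed
      define Q where "Q = {n. \<exists>i. near n i}"
      define idx where "idx n = (SOME i. near n i)" for n
      have idx: "near n (idx n)" if "n \<in> Q" for n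
        using that unfolding Q_def idx_def by (auto intro: someI)
      have idxI: "idx n \<in> I" if "n \<in> Q" for n using idx[OF that] by (simp add: near_def)
      have Re_idx: "\<bar>of_nat n - Re (pos (idx n))\<bar> < 1/4" if "n \<in> Q" for n
        using idx[OF that] abs_Re_le_cmod[of "of_nat n - pos (idx n)"] by (simp add: near_def)
      have inj: "inj_on idx Q"
      proof (rule inj_onI)
        fix m n assume "m \<in> Q" "n \<in> Q" "idx m = idx n"
        then have "\<bar>of_nat m - Re (pos (idx n))\<bar> < 1/4" "\<bar>of_nat n - Re (pos (idx n))\<bar> < 1/4"
          using Re_idx[of m] Re_idx[of n] by simp_all
        then have "\<bar>of_nat m - of_nat n\<bar> < (1::real)" by linarith
        then show "m = n" by linarith
      qed
      have "idx ` Q \<subseteq> I" using idxI by auto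
      then have "finite Q" using inj I(1) finite_imageD finite_subset by blast
      moreover have "\<forall>q\<in>Q. n0 \<le> q \<and> \<nu> (idx q) \<noteq> 0 \<and> norm (\<nu> (idx q)) \<le> K ^ (q + 1)"
      proof (intro ballI conjI)
        fix q assume q: "q \<in> Q"
        show "n0 \<le> q" using Re_idx[OF q] I(2)[OF idxI[OF q]] by linarith
        show "\<nu> (idx q) \<noteq> 0" using I(3)[OF idxI[OF q]] .
        have "Re (pos (idx q)) \<le> of_nat q + 1" using Re_idx[OF q] by linarith
        then have "Re (pos (idx q)) \<le> of_nat (q + 1)" by simp
        then show "norm (\<nu> (idx q)) \<le> K ^ (q + 1)"
          using I(4)[OF idxI[OF q]] Kpow order_trans by blast
      qed
      moreover have "\<forall>q\<in>Q. \<forall>q'\<in>Q. q < q' \<longrightarrow> q + N \<le> q' \<and>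
        norm (\<nu> (idx q')) \<le> norm (\<nu> (idx q)) * K ^ (q' - q + 1)"
      proof (intro ballI impI conjI)
        fix q q' assume q: "q \<in> Q" "q' \<in> Q" "q < q'"
        have ne: "idx q \<noteq> idx q'" using q inj by (metis inj_onD less_irrefl)
        have "of_nat N + 1 \<le> norm (pos (idx q) - pos (idx q'))"
          using I(5)[OF idxI idxI ne] q by simp
        also have "pos (idx q) - pos (idx q') = (of_nat q' - pos (idx q')) - (of_nat q - pos (idx q)) - of_nat (q' - q)"
          using q by (simp add: of_nat_diff)
        also have "norm \<dots> \<le> norm (of_nat q' - pos (idx q')) + norm (of_nat q - pos (idx q)) + of_nat (q' - q)"
          using norm_triangle_ineq4[of "(of_nat q' - pos (idx q')) - (of_nat q - pos (idx q))" "of_nat (q' - q)"]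
            norm_triangle_ineq4[of "of_nat q' - pos (idx q')" "of_nat q - pos (idx q)"]
          by (simp only: norm_of_nat)
        also have "\<dots> \<le> 1/2 + of_nat (q' - q)"
          using idx[OF q(1)] idx[OF q(2)] by (simp add: near_def)
        finally show "q + N \<le> q'" using q(3) by linarith
        have "of_nat q + 1 \<le> real q'" using q(3) by linarith
        then have le: "Re (pos (idx q)) \<le> Re (pos (idx q'))"
          using Re_idx[OF q(1)] Re_idx[OF q(2)] by linarith
        have "Re (pos (idx q')) - Re (pos (idx q)) \<le> of_nat q' - of_nat q + 1"
          using Re_idx[OF q(1)] Re_idx[OF q(2)] by linarith
        then have "Re (pos (idx q')) - Re (pos (idx q)) \<le> of_nat (q' - q + 1)"
          using q(3) by (simp add: of_nat_diff)
        then have "norm (\<nu> (idx q)) * exp (T * (Re (pos (idx q')) - Re (pos (idx q)))) \<le> norm (\<nu> (idx q)) * K ^ (q' - q + 1)"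
          by (intro mult_left_mono Kpow) auto
        then show "norm (\<nu> (idx q')) \<le> norm (\<nu> (idx q)) * K ^ (q' - q + 1)"
          using I(6)[OF idxI idxI le] q by linarith
      qed
      moreover have "\<forall>\<mu>. norm (\<mu> - \<mu>0) < \<kappa> \<longrightarrow> (\<exists>q\<in>Q. norm (\<mu> ^ q * \<nu> (idx q) - 1) < \<epsilon>)"
      proof (intro allI impI)
        fix \<mu> assume "norm (\<mu> - \<mu>0) < \<kappa>"
        then obtain n i where n: "i \<in> I" "norm (of_nat n - pos i) < 1/4" "norm (\<mu> ^ n * \<nu> i - 1) < \<epsilon>"
          using cfg(2)[rule_format, of 1 \<mu>] \<kappa> by (auto simp: sweep_hits_def)
        then have "near n i" by (simp add: near_def)
        then have "n \<in> Q" unfolding Q_def by blast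
        moreover have "idx n = i" using near_unique[OF idx[OF \<open>n \<in> Q\<close>] \<open>near n i\<close>] .
        ultimately show "\<exists>q\<in>Q. norm (\<mu> ^ q * \<nu> (idx q) - 1) < \<epsilon>" using n(3) by auto
      qed
      ultimately show "\<exists>Q \<nu>. derivative_schedule K N n0 Q \<nu> \<and>
        (\<forall>\<mu>. norm (\<mu> - \<mu>0) < \<kappa> \<longrightarrow> (\<exists>q\<in>Q. norm (\<mu> ^ q * \<nu> q - 1) < \<epsilon>))"
        unfolding derivative_schedule_def by (intro exI[of _ Q] exI[of _ "\<lambda>q. \<nu> (idx q)"]) blast
    qed
  qed
qed

section \<open>Corrections that serve an open set of operators\<close>

text \<open>What a stage has to achieve, expressed for the final function \<open>f\<close>. If \<open>f\<close> is close on \<open>X\<close> to a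
combination of the \<open>G k\<close> in which \<open>G k0\<close> has coefficient \<open>1\<close>, then each operator of the family has an
iterate that brings \<open>f\<close> near \<open>h\<close>. The bound \<open>A\<close> on the coefficients is not known during the
construction; the error \<open>A * e\<close> still becomes small because \<open>e\<close> tends to \<open>0\<close> along the stages. The
error \<open>\<epsilon>\<close> stems from the width of the family and belongs to the task.\<close>
definition steers ::
    "((complex \<Rightarrow> complex) \<Rightarrow> (complex \<Rightarrow> complex)) set \<Rightarrow> complex poly \<Rightarrow> real \<Rightarrow> real \<Rightarrow>
     (nat \<Rightarrow> complex poly) \<Rightarrow> nat \<Rightarrow> nat \<Rightarrow> real \<Rightarrow> complex set \<Rightarrow> real \<Rightarrow> bool" where
  "steers \<O> h r \<epsilon> G s k0 e X \<theta> \<longleftrightarrow>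
    (\<forall>T\<in>\<O>. \<forall>f\<in>entire_functions. \<forall>c A. c k0 = 1 \<longrightarrow> (\<forall>k. norm (c k) \<le> A) \<longrightarrow>
       (\<forall>z\<in>X. norm (f z - (\<Sum>k=1..s. c k * poly (G k) z)) \<le> A * \<theta>) \<longrightarrow>
       (\<exists>n. \<forall>z\<in>cball 0 r. norm ((T ^^ n) f z - poly h z) \<le> A * e + \<epsilon>))"

text \<open>A correction \<open>P\<close> of the polynomials \<open>F k\<close>. Index \<open>0\<close> is reserved for an auxiliary function whose powers
start the later generators: it has to stay bounded by \<open>1\<close> on the part of \<open>X\<close> that is far from the
origin, so that these generators cannot become large there.\<close>
definition admissible_step ::
    "((complex \<Rightarrow> complex) \<Rightarrow> (complex \<Rightarrow> complex)) set \<Rightarrow> complex poly \<Rightarrow> real \<Rightarrow> real \<Rightarrow>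
     (nat \<Rightarrow> complex poly) \<Rightarrow> nat \<Rightarrow> real \<Rightarrow> nat \<Rightarrow> real \<Rightarrow> nat \<Rightarrow>
     (nat \<Rightarrow> complex poly) \<Rightarrow> real \<Rightarrow> complex set \<Rightarrow> real \<Rightarrow> bool" where
  "admissible_step \<O> h r \<epsilon> F s R N e k0 P R' X \<theta> \<longleftrightarrow> 0 < \<theta> \<and> X \<subseteq> cball 0 R' \<and>
    (\<forall>k. monom 1 N dvd P k \<and> (\<forall>z\<in>cball 0 R. norm (poly (P k) z) \<le> e)) \<and>
    (\<forall>z\<in>X. norm z \<le> r + 1 \<or> norm (poly (F 0 + P 0) z) \<le> 1) \<and>
    steers \<O> h r \<epsilon> (\<lambda>k. F k + P k) s k0 e X \<theta>"

definition insertable ::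
    "((complex \<Rightarrow> complex) \<Rightarrow> (complex \<Rightarrow> complex)) set \<Rightarrow> complex poly \<Rightarrow> real \<Rightarrow> real \<Rightarrow> bool" where
  "insertable \<O> h r \<epsilon> \<longleftrightarrow> (\<forall>F s R N e k0. 1 \<le> k0 \<longrightarrow> k0 \<le> s \<longrightarrow> 0 < e \<longrightarrow>
    (\<exists>P R' X \<theta>. admissible_step \<O> h r \<epsilon> F s R N e k0 P R' X \<theta>))"

lemma steers_mono:
  "steers \<O> h r \<epsilon> G s k0 e X \<theta> \<Longrightarrow> \<O>' \<subseteq> \<O> \<Longrightarrow> steers \<O>' h r \<epsilon> G s k0 e X \<theta>"
  unfolding steers_def by (simp only: subset_eq Ball_def) simp

lemma admissible_step_mono:
  assumes "\<O>' \<subseteq> \<O>" "admissible_step \<O> h r \<epsilon> F s R N e k0 P R' X \<theta>"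
  shows "admissible_step \<O>' h r \<epsilon> F s R N e k0 P R' X \<theta>"
  using assms(2) unfolding admissible_step_def
  by (elim conjE) (intro conjI; (assumption | rule steers_mono[OF _ assms(1)]))

lemma insertable_mono:
  assumes "insertable \<O> h r \<epsilon>" "\<O>' \<subseteq> \<O>"
  shows "insertable \<O>' h r \<epsilon>"
  unfolding insertable_def
proof (intro allI impI)
  fix F s R N e and k0 :: nat assume "1 \<le> k0" "k0 \<le> s" "0 < (e :: real)"
  then obtain P R' X \<theta> where "admissible_step \<O> h r \<epsilon> F s R N e k0 P R' X \<theta>"
    using assms(1) unfolding insertable_def by blast
  then show "\<exists>P R' X \<theta>. admissible_step \<O>' h r \<epsilon> F s R N e k0 P R' X \<theta>"
    by (intro exI admissible_step_mono[OF assms(2)])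
qed

lemma funpow_scale_translation:
  "(scale_op \<mu> (translation_op a) ^^ n) f = (\<lambda>z. \<mu> ^ n * f (z + of_nat n * a))"
  by (induction n) (auto simp: scale_op_def scale_fun_def translation_op_def algebra_simps)

lemma entire_higher_deriv: "f \<in> entire_functions \<Longrightarrow> (deriv ^^ n) f \<in> entire_functions"
  by (auto simp: entire_functions_def intro: holomorphic_higher_deriv)

lemma funpow_scale_diff:
  assumes "f \<in> entire_functions"
  shows "(scale_op c diff_op ^^ n) f = (\<lambda>z. c ^ n * (deriv ^^ n) f z)"
proof (induction n)
  case (Suc n)
  have "(deriv ^^ n) f field_differentiable at z" for z
    using entire_higher_deriv[OF assms, of n] by (simp add: entire_functions_def holomorphic_on_def)
  then have "deriv (\<lambda>z. c ^ n * (deriv ^^ n) f z) z = c ^ n * deriv ((deriv ^^ n) f) z" for z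
    by (rule deriv_cmult)
  then have "deriv (\<lambda>z. c ^ n * (deriv ^^ n) f z) = (\<lambda>z. c ^ n * (deriv ^^ Suc n) f z)" by (simp add: fun_eq_iff)
  moreover have "(scale_op c diff_op ^^ Suc n) f = (\<lambda>z. c * deriv ((scale_op c diff_op ^^ n) f) z)"
    by (simp add: scale_op_def scale_fun_def diff_op_def)
  ultimately show ?case using Suc by (simp add: fun_eq_iff del: funpow.simps)
qed auto

lemma finite_positive_lower_bound:
  assumes "finite I" "\<And>i. i \<in> I \<Longrightarrow> 0 < (g i :: real)"
  obtains m where "0 < m" "\<And>i. i \<in> I \<Longrightarrow> m \<le> g i"
proof (cases "I = {}")
  case False
  then show ?thesis using assms by (intro that[of "Min (g ` I)"]) auto
qed (use that[of 1] in auto)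

lemma poly_bounded_cball:
  obtains H where "H > 0" "\<And>z. z \<in> cball 0 r \<Longrightarrow> norm (poly h z :: complex) \<le> H"
proof -
  have "compact (poly h ` cball 0 r)" by (intro compact_continuous_image continuous_intros) auto
  then show ?thesis using compact_imp_bounded bounded_pos that by (metis imageI)
qed

section \<open>Multiples of translations\<close>

lemma translations_insertable:
  assumes a0: "a0 \<noteq> 0" and \<mu>0: "\<mu>0 \<noteq> 0" and r: "0 < r" and \<epsilon>: "0 < \<epsilon>"
  shows "\<exists>\<kappa>>0. insertable {scale_op \<mu> (translation_op a) | a \<mu>. norm (a - a0) < \<kappa> \<and> norm (\<mu> - \<mu>0) < \<kappa>} h r \<epsilon>"
proof -
  obtain H where H: "H > 0" "\<And>z. z \<in> cball 0 (r + 1) \<Longrightarrow> norm (poly h z) \<le> H"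
    using poly_bounded_cball[of "r + 1" h] by metis
  have "uniformly_continuous_on (cball 0 (r + 1)) (poly h)"
    by (intro compact_uniformly_continuous continuous_intros) auto
  then obtain d where d: "d > 0" "\<And>w z. w \<in> cball 0 (r + 1) \<Longrightarrow> z \<in> cball 0 (r + 1) \<Longrightarrow>
      dist w z < d \<Longrightarrow> dist (poly h w) (poly h z) < \<epsilon> / 2"
    unfolding uniformly_continuous_on_def using \<epsilon> by (metis half_gt_zero)
  define \<delta> where "\<delta> = min d 1"
  have \<delta>: "0 < \<delta>" "\<delta> \<le> d" "\<delta> \<le> 1" using d by (auto simp: \<delta>_def)
  define \<epsilon>1 where "\<epsilon>1 = min (1/2) (\<epsilon> / (2 * H))"
  have \<epsilon>1: "0 < \<epsilon>1" "\<epsilon>1 \<le> 1/2" "\<epsilon>1 * H \<le> \<epsilon> / 2"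
  proof -
    have "\<epsilon>1 \<le> \<epsilon> / (2 * H)" by (simp add: \<epsilon>1_def)
    then show "\<epsilon>1 * H \<le> \<epsilon> / 2" using H(1) by (simp add: field_simps)
  qed (use \<epsilon> H in \<open>auto simp: \<epsilon>1_def\<close>)
  have na0: "norm a0 > 0" using a0 by simp
  have pos: "0 < (2 * r + 3) / norm a0" "0 < \<delta> / norm a0" using r na0 \<delta> by auto
  define T where "T = \<bar>ln (norm \<mu>0)\<bar> + 1"
  obtain \<kappa>0 where \<kappa>0: "\<kappa>0 > 0" and sweep: "\<forall>R0. \<exists>(I :: (nat \<times> int) set) pos \<nu>.
      separated_sweep T ((2 * r + 3) / norm a0) R0 I pos \<nu> \<and>
      (\<forall>a \<mu>. norm (a - 1) < \<kappa>0 \<longrightarrow> norm (\<mu> - \<mu>0) < \<kappa>0 \<longrightarrow> sweep_hits (\<delta> / norm a0) \<epsilon>1 I pos \<nu> a \<mu>)"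
    using sweep_configuration[OF \<mu>0 pos \<epsilon>1(1), folded T_def] by (elim exE conjE) (rule that)
  define \<kappa> where "\<kappa> = min \<kappa>0 (\<kappa>0 * norm a0)"
  have \<kappa>: "\<kappa> > 0" "\<kappa> \<le> \<kappa>0" "\<kappa> \<le> \<kappa>0 * norm a0" using \<kappa>0 na0 by (auto simp: \<kappa>_def)
  define \<O> where "\<O> = {scale_op \<mu> (translation_op a) | a \<mu>. norm (a - a0) < \<kappa> \<and> norm (\<mu> - \<mu>0) < \<kappa>}"
  have "insertable \<O> h r \<epsilon>"
    unfolding insertable_def
  proof (intro allI impI)
    fix F :: "nat \<Rightarrow> complex poly" and s :: nat and R :: real and N :: nat and e :: real and k0 :: nat
    assume k0: "1 \<le> k0" "k0 \<le> s" and e: "0 < e"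
    \<comment> \<open>The discs have to avoid the disc of radius \<open>R\<close>, where the correction must be small, and the origin.\<close>
    define S where "S = max R 0"
    obtain I :: "(nat \<times> int) set" and pos \<nu> where
      cfg: "separated_sweep T ((2 * r + 3) / norm a0) ((S + r + 2) / norm a0) I pos \<nu>"
        "\<forall>a \<mu>. norm (a - 1) < \<kappa>0 \<longrightarrow> norm (\<mu> - \<mu>0) < \<kappa>0 \<longrightarrow> sweep_hits (\<delta> / norm a0) \<epsilon>1 I pos \<nu> a \<mu>"
      using sweep[THEN spec, of "(S + r + 2) / norm a0"] by (elim exE conjE) (rule that)
    have I: "finite I"
      "\<And>i. i \<in> I \<Longrightarrow> (S + r + 2) / norm a0 \<le> Re (pos i)" "\<And>i. i \<in> I \<Longrightarrow> \<nu> i \<noteq> 0"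
      "\<And>i j. i \<in> I \<Longrightarrow> j \<in> I \<Longrightarrow> i \<noteq> j \<Longrightarrow> (2 * r + 3) / norm a0 \<le> norm (pos i - pos j)"
      using cfg(1) unfolding separated_sweep_def by simp_all
    define b where "b i = a0 * pos i" for i
    have b_far: "S + r + 2 \<le> norm (b i)" if "i \<in> I" for i
    proof -
      have "(S + r + 2) / norm a0 \<le> norm (pos i)" using I(2)[OF that] complex_Re_le_cmod[of "pos i"] by linarith
      then show ?thesis using na0 by (simp add: b_def norm_mult pos_divide_le_eq mult.commute)
    qed
    have b_sep: "2 * r + 3 \<le> norm (b i - b j)" if "i \<in> I" "j \<in> I" "i \<noteq> j" for i j
      using I(4)[OF that] na0 by (simp add: b_def norm_mult pos_divide_le_eq mult.commute flip: right_diff_distrib)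
    have inj: "inj_on b I" using b_sep r by (intro inj_onI) force
    obtain m where m: "0 < m" "\<And>i. i \<in> I \<Longrightarrow> m \<le> norm (\<nu> i)"
      using finite_positive_lower_bound[OF I(1), of "\<lambda>i. norm (\<nu> i)"] I(3) by auto
    define t where "t = min (min e 1) (e * m / (4 * (of_nat s + 1)))"
    have t: "0 < t" "t \<le> e" "t \<le> 1" "of_nat s * t \<le> e * m / 4"
    proof -
      have "t \<le> e * m / (4 * (of_nat s + 1))" by (simp add: t_def)
      then have "of_nat s * t \<le> of_nat s * (e * m / (4 * (of_nat s + 1)))" by (rule mult_left_mono) simp
      also have "\<dots> \<le> e * m / 4" using e m by (simp add: divide_simps)
      finally show "of_nat s * t \<le> e * m / 4" .
    qed (use e m in \<open>auto simp: t_def\<close>)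
    define \<nu>' where "\<nu>' w = \<nu> (inv_into I b w)" for w
    have \<nu>': "\<nu>' (b i) = \<nu> i" if "i \<in> I" for i using inj that by (simp add: \<nu>'_def)
    \<comment> \<open>Adding \<open>G k (b i)\<close> cancels \<open>F k\<close> near \<open>b i\<close> and, for \<open>k = k0\<close>, plants a scaled copy of \<open>h\<close> there.\<close>
    define G where "G k w = (if k = k0 then smult (\<nu>' w) (pcompose h [:-w, 1:]) else 0) - F k" for k w
    have dj: "cball w (r + 1) \<inter> cball w' (r + 1) = {}" if "w \<in> b ` I" "w' \<in> b ` I" "w \<noteq> w'" for w w'
    proof -
      have "2 * (r + 1) < dist w w'" using that b_sep by (force simp: dist_norm)
      then show ?thesis by (intro disjoint_cballI) simp
    qed
    have d0: "cball 0 S \<inter> cball w (r + 1) = {}" if "w \<in> b ` I" for w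
    proof -
      have "S + (r + 1) < dist 0 w" using that b_far by force
      then show ?thesis by (intro disjoint_cballI)
    qed
    have "\<forall>k. \<exists>p. monom 1 N dvd p \<and> (\<forall>z\<in>cball 0 S. norm (poly p z) < t) \<and>
        (\<forall>w\<in>b ` I. \<forall>z\<in>cball w (r + 1). norm (poly (G k w) z - poly p z) < t)"
      using r I(1) t(1) dj d0 by (intro allI runge_discs_vanishing) (auto simp: S_def)
    then obtain P where P: "\<And>k. monom 1 N dvd P k" "\<And>k z. z \<in> cball 0 S \<Longrightarrow> norm (poly (P k) z) < t"
      "\<And>k w z. w \<in> b ` I \<Longrightarrow> z \<in> cball w (r + 1) \<Longrightarrow> norm (poly (G k w) z - poly (P k) z) < t"
      by metis
    define X where "X = (\<Union>w\<in>b ` I. cball w (r + 1))"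
    have "bounded X" unfolding X_def using I(1) by (intro bounded_UN) auto
    then obtain R' where "\<forall>x\<in>X. norm x \<le> R'" unfolding bounded_iff by blast
    then have R': "X \<subseteq> cball 0 R'" by auto
    have near: "norm ((if k = k0 then \<nu> i * poly h (z - b i) else 0) - poly (F k + P k) z) < t"
      if "i \<in> I" "z \<in> cball (b i) (r + 1)" for i k z
      using P(3)[of "b i" z k] that \<nu>'[OF that(1)] by (auto simp: G_def poly_pcompose algebra_simps)
    show "\<exists>P R' X \<theta>. admissible_step \<O> h r \<epsilon> F s R N e k0 P R' X \<theta>"
      unfolding admissible_step_def steers_def
    proof (rule exI[of _ P], rule exI[of _ R'], rule exI[of _ X], rule exI[of _ "e * m / 4"],
        intro conjI ballI allI impI R')
      show "0 < e * m / 4" using e m by simp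
      show "monom 1 N dvd P k" for k by (rule P(1))
      show "norm (poly (P k) z) \<le> e" if "z \<in> cball 0 R" for k z
      proof -
        have "z \<in> cball 0 S" using that by (simp add: S_def le_max_iff_disj)
        then show ?thesis using P(2)[of z k] t(2) by linarith
      qed
      show "norm z \<le> r + 1 \<or> norm (poly (F 0 + P 0) z) \<le> 1" if z: "z \<in> X" for z
      proof -
        obtain i where "i \<in> I" "z \<in> cball (b i) (r + 1)" using z by (auto simp: X_def)
        from near[OF this, of 0] have "norm (- poly (F 0 + P 0) z) < t" using k0 by simp
        then show ?thesis using t(3) by (simp only: norm_minus_cancel) linarith
      qed
    next
      fix T f c A assume T: "T \<in> \<O>" and f: "f \<in> entire_functions" and c: "c k0 = 1" "\<forall>k. norm (c k) \<le> A"
        and close: "\<forall>z\<in>X. norm (f z - (\<Sum>k=1..s. c k * poly (F k + P k) z)) \<le> A * (e * m / 4)"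
      have A: "0 \<le> A" using c(2) norm_ge_zero order_trans by blast
      obtain a \<mu> where T: "T = scale_op \<mu> (translation_op a)" "norm (a - a0) < \<kappa>" "norm (\<mu> - \<mu>0) < \<kappa>"
        using T by (auto simp: \<O>_def)
      have "a / a0 - 1 = (a - a0) / a0" using a0 by (simp add: diff_divide_distrib)
      then have "norm (a / a0 - 1) < \<kappa>0" using T(2) \<kappa>(3) na0 by (simp add: norm_divide pos_divide_less_eq)
      then obtain n i where n: "i \<in> I" "norm (of_nat n * (a / a0) - pos i) < \<delta> / norm a0"
        "norm (\<mu> ^ n * \<nu> i - 1) < \<epsilon>1"
        using cfg(2)[rule_format, of "a / a0" \<mu>] T(3) \<kappa>(2) by (auto simp: sweep_hits_def)
      have "of_nat n * a - b i = a0 * (of_nat n * (a / a0) - pos i)" using a0 by (simp add: b_def algebra_simps)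
      then have nb: "norm (of_nat n * a - b i) < \<delta>" using n(2) na0 by (simp add: norm_mult pos_less_divide_eq mult.commute)
      have "norm (\<mu> ^ n * \<nu> i) \<le> 2"
        using norm_triangle_sub[of "\<mu> ^ n * \<nu> i" 1] n(3) \<epsilon>1(2) by simp
      then have \<mu>m: "norm (\<mu> ^ n) * m \<le> 2"
        using mult_left_mono[OF m(2)[OF n(1)], of "norm (\<mu> ^ n)"] by (simp add: norm_mult)
      have "norm ((T ^^ n) f z - poly h z) \<le> A * e + \<epsilon>" if z: "z \<in> cball 0 r" for z
      proof -
        define w where "w = z + of_nat n * a"
        define y where "y = w - b i"
        have yz: "norm (y - z) < \<delta>" using nb by (simp add: y_def w_def)
        have y: "y \<in> cball 0 (r + 1)"
          using yz z \<delta>(3) norm_triangle_sub[of y z] by simp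
        then have w: "w \<in> cball (b i) (r + 1)" by (simp add: y_def dist_norm norm_minus_commute)
        have wX: "w \<in> X" using w n(1) by (auto simp: X_def)
        have "norm (f w - \<nu> i * poly h y) \<le> A * (e * m / 2)"
        proof -
          have "(\<Sum>k=1..s. c k * (if k = k0 then \<nu> i * poly h y else 0)) = \<nu> i * poly h y"
            using k0 c(1) by (simp add: if_distrib cong: if_cong)
          then have eq: "f w - \<nu> i * poly h y = (f w - (\<Sum>k=1..s. c k * poly (F k + P k) w))
             - (\<Sum>k=1..s. c k * ((if k = k0 then \<nu> i * poly h y else 0) - poly (F k + P k) w))"
            by (simp add: right_diff_distrib sum_subtractf)
          have "norm (f w - \<nu> i * poly h y) \<le> norm (f w - (\<Sum>k=1..s. c k * poly (F k + P k) w))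
             + norm (\<Sum>k=1..s. c k * ((if k = k0 then \<nu> i * poly h y else 0) - poly (F k + P k) w))"
            unfolding eq by (rule norm_triangle_ineq4)
          also have "\<dots> \<le> A * (e * m / 4) + (\<Sum>k=1..s. A * t)"
          proof (intro add_mono sum_norm_le)
            fix k
            have "norm ((if k = k0 then \<nu> i * poly h y else 0) - poly (F k + P k) w) \<le> t"
              using near[OF n(1) w, of k] unfolding y_def by (rule less_imp_le)
            then show "norm (c k * ((if k = k0 then \<nu> i * poly h y else 0) - poly (F k + P k) w)) \<le> A * t"
              using c(2) A by (simp only: norm_mult) (intro mult_mono, auto)
          qed (use close wX in auto)
          also have "(\<Sum>k=1..s. A * t) = A * (of_nat s * t)" by simp
          also have "A * (of_nat s * t) \<le> A * (e * m / 4)" using t(4) A by (rule mult_left_mono)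
          finally show ?thesis by simp
        qed
        then have "norm (\<mu> ^ n) * norm (f w - \<nu> i * poly h y) \<le> norm (\<mu> ^ n) * (A * (e * m / 2))"
          by (rule mult_left_mono) simp
        also have "\<dots> = A * e / 2 * (norm (\<mu> ^ n) * m)" by simp
        also have "\<dots> \<le> A * e / 2 * 2" using \<mu>m A e by (intro mult_left_mono) auto
        finally have t1: "norm (\<mu> ^ n * (f w - \<nu> i * poly h y)) \<le> A * e" by (simp add: norm_mult)
        have "norm ((\<mu> ^ n * \<nu> i - 1) * poly h y) \<le> \<epsilon>1 * H"
          using n(3) H(2)[OF y] \<epsilon>1(1) H(1) unfolding norm_mult by (intro mult_mono) auto
        then have t2: "norm ((\<mu> ^ n * \<nu> i - 1) * poly h y) \<le> \<epsilon> / 2" using \<epsilon>1(3) by linarith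
        have t3: "norm (poly h y - poly h z) \<le> \<epsilon> / 2"
          using d(2)[of y z] y z yz \<delta>(2) by (simp add: dist_norm)
        have "(T ^^ n) f z - poly h z = \<mu> ^ n * (f w - \<nu> i * poly h y) + (\<mu> ^ n * \<nu> i - 1) * poly h y + (poly h y - poly h z)"
          by (simp add: T(1) funpow_scale_translation w_def algebra_simps)
        also have "norm \<dots> \<le> A * e + \<epsilon> / 2 + \<epsilon> / 2" by (intro norm_triangle_mono t1 t2 t3)
        finally show ?thesis by simp
      qed
      then show "\<exists>n. \<forall>z\<in>cball 0 r. norm ((T ^^ n) f z - poly h z) \<le> A * e + \<epsilon>" by blast
    qed
  qed
  then show ?thesis using \<kappa>(1) unfolding \<O>_def by blast
qed

section \<open>Multiples of differentiation\<close>

text \<open>The \<open>j\<close>-fold primitive that vanishes to order \<open>j\<close> at the origin.\<close>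
definition iterated_integral :: "nat \<Rightarrow> complex poly \<Rightarrow> complex poly" where
  "iterated_integral j h = (\<Sum>i\<le>degree h. monom (coeff h i * fact i / fact (i + j)) (i + j))"

lemma iterated_integral_0: "iterated_integral 0 h = h"
  by (simp add: iterated_integral_def poly_as_sum_of_monoms)

lemma pderiv_iterated_integral: "pderiv (iterated_integral (Suc j) h) = iterated_integral j h"
proof -
  have "pderiv (monom (coeff h i * fact i / fact (i + Suc j)) (i + Suc j)) = monom (coeff h i * fact i / fact (i + j)) (i + j)" for i
    by (simp add: pderiv_monom divide_simps del: of_nat_Suc)
  then show ?thesis 
    unfolding iterated_integral_def higher_pderiv_sum[of 1, simplified] by (simp only:)
qed

lemma higher_pderiv_iterated_integral:
  "(pderiv ^^ n) (iterated_integral (n + j) h) = iterated_integral j h"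
  by (induction n) (simp_all add: funpow_Suc_right pderiv_iterated_integral del: funpow.simps(2))

lemma higher_pderiv_eq_0: "degree p < n \<Longrightarrow> (pderiv ^^ n) p = 0" for p :: "complex poly"
proof (induction n arbitrary: p)
  case (Suc n)
  show ?case
  proof (cases "degree p = 0")
    case True
    then have "pderiv p = 0" by (simp add: pderiv_eq_0_iff)
    then show ?thesis by (simp only: funpow_Suc_right o_apply higher_pderiv_0)
  next
    case False
    then show ?thesis using Suc by (simp add: funpow_Suc_right degree_pderiv del: funpow.simps)
  qed
qed auto

lemma monom_dvd_iterated_integral: "N \<le> j \<Longrightarrow> monom 1 N dvd iterated_integral j h"
  unfolding iterated_integral_def
proof (intro dvd_sum)
  fix i assume "N \<le> j"
  then have "monom c (i + j) = monom 1 N * monom c (i + j - N)" for c :: complex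
    by (simp add: mult_monom)
  then show "monom 1 N dvd monom (coeff h i * fact i / fact (i + j)) (i + j)" by (metis dvd_triv_left)
qed

lemma norm_iterated_integral_le:
  assumes "norm z \<le> r"
  shows "norm (poly (iterated_integral j h) z) \<le> (\<Sum>i\<le>degree h. norm (coeff h i) * r ^ i) * (r ^ j / fact j)"
proof -
  have r: "0 \<le> r" using assms norm_ge_zero order_trans by blast
  have "norm (poly (iterated_integral j h) z) \<le> (\<Sum>i\<le>degree h. norm (coeff h i) * r ^ i * (r ^ j / fact j))"
    unfolding iterated_integral_def poly_sum
  proof (intro sum_norm_le)
    fix i
    have "(fact i * fact j :: nat) \<le> fact (i + j)" by (intro dvd_imp_le fact_fact_dvd_fact) auto
    then have "real (fact i * fact j) \<le> real (fact (i + j))" using of_nat_le_iff by blast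
    then have "fact i / fact (i + j) \<le> (1 / fact j :: real)"
      by (simp add: divide_simps mult.commute)
    then have "fact i / fact (i + j) * norm z ^ (i + j) \<le> (1 / fact j :: real) * r ^ (i + j)"
      using assms r by (intro mult_mono power_mono) auto
    then have "norm (coeff h i) * (fact i / fact (i + j) * norm z ^ (i + j)) \<le> norm (coeff h i) * ((1 / fact j :: real) * r ^ (i + j))"
      by (rule mult_left_mono) simp
    then show "norm (poly (monom (coeff h i * fact i / fact (i + j)) (i + j)) z) \<le> norm (coeff h i) * r ^ i * (r ^ j / fact j)"
      by (simp add: poly_monom norm_mult norm_divide norm_power power_add mult_ac)
  qed
  then show ?thesis by (simp only: sum_distrib_right)
qed

lemma exp_series_tail:
  fixes x e :: real
  assumes "0 \<le> x" "0 < e"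
  obtains N where "\<And>J. finite J \<Longrightarrow> (\<And>j. j \<in> J \<Longrightarrow> N \<le> j) \<Longrightarrow> (\<Sum>j\<in>J. x ^ j / fact j) \<le> e"
proof -
  have sm: "summable (\<lambda>j. x ^ j / fact j)"
    using summable_exp[of x] by (simp add: divide_inverse mult.commute)
  obtain N where N: "\<And>n. n \<ge> N \<Longrightarrow> norm (\<Sum>i. x ^ (i + n) / fact (i + n)) < e"
    using suminf_exist_split[OF assms(2) sm] by auto
  show ?thesis
  proof (rule that[of N])
    fix J :: "nat set" assume J: "finite J" "\<And>j. j \<in> J \<Longrightarrow> N \<le> j"
    have "(\<Sum>j\<in>J. x ^ j / fact j) = (\<Sum>i\<in>(\<lambda>j. j - N) ` J. x ^ (i + N) / fact (i + N))"
      using J(2) by (subst sum.reindex) (auto intro!: inj_onI sum.cong simp: eq_diff_iff)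
    also have "\<dots> \<le> (\<Sum>i. x ^ (i + N) / fact (i + N))"
      using J(1) assms sm by (intro sum_le_suminf) (auto simp: summable_iff_shift[of "\<lambda>j. x ^ j / fact j"])
    also have "\<dots> \<le> e" using N[of N] by simp
    finally show "(\<Sum>j\<in>J. x ^ j / fact j) \<le> e" .
  qed
qed

lemma higher_deriv_poly: "(deriv ^^ n) (poly p) = poly ((pderiv ^^ n) p)" for p :: "complex poly"
proof (induction n)
  case (Suc n)
  have "deriv (poly q) = poly (pderiv q)" for q :: "complex poly"
    by (rule ext) (rule DERIV_imp_deriv, rule poly_DERIV)
  then show ?case using Suc by simp
qed auto

lemma poly_entire: "poly p \<in> entire_functions"
proof -
  have "poly p holomorphic_on UNIV" for p :: "complex poly"
    by (auto simp: holomorphic_on_def field_differentiable_def intro!: exI poly_DERIV[THEN DERIV_subset])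
  then show ?thesis by (simp add: entire_functions_def)
qed

lemma higher_deriv_perturbation:
  assumes f: "f \<in> entire_functions" and B: "\<And>z. z \<in> cball 0 (r + 1) \<Longrightarrow> norm (f z - poly p z) \<le> B"
    and z: "norm z \<le> r"
  shows "norm ((deriv ^^ n) f z - poly ((pderiv ^^ n) p) z) \<le> fact n * B"
proof -
  have fh: "f holomorphic_on UNIV" and ph: "poly p holomorphic_on UNIV"
    using f poly_entire[of p] by (simp_all add: entire_functions_def)
  let ?g = "\<lambda>w. f w - poly p w"
  have g: "?g holomorphic_on UNIV" using fh ph by (intro holomorphic_intros)
  have "norm ((deriv ^^ n) ?g z) \<le> fact n * B / 1 ^ n"
  proof (rule Cauchy_inequality)
    show "?g holomorphic_on ball z 1" using g holomorphic_on_subset by blast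
    show "continuous_on (cball z 1) ?g"
      using g holomorphic_on_imp_continuous_on holomorphic_on_subset by blast
    fix w assume "norm (z - w) = 1"
    then have "norm w \<le> r + 1" using z norm_triangle_sub[of w z] by (simp add: norm_minus_commute)
    then show "norm (?g w) \<le> B" using B by simp
  qed simp
  moreover have "(deriv ^^ n) ?g z = (deriv ^^ n) f z - poly ((pderiv ^^ n) p) z"
    using higher_deriv_diff[OF fh ph open_UNIV UNIV_I, of n z] by (simp add: higher_deriv_poly)
  ultimately show ?thesis by simp
qed

text \<open>The correction of index \<open>k0\<close> is the sum of \<open>\<nu> q\<close> times the \<open>q\<close>-fold primitive of \<open>h\<close>. Differentiating \<open>q\<close>
times kills the earlier blocks and turns the current one into \<open>\<nu> q * h\<close>; a later block \<open>q'\<close> leaves a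
primitive of order \<open>q' - q\<close>, whose size \<open>(K r) ^ (q' - q) / fact (q' - q)\<close> is negligible once the gaps are
long. The base \<open>K\<close> enters through the growth bound for the factors in the schedule.\<close>
lemma derivatives_insertable:
  assumes \<mu>0: "\<mu>0 \<noteq> 0" and r: "0 < r" and \<epsilon>: "0 < \<epsilon>"
  shows "\<exists>\<kappa>>0. insertable {scale_op \<mu> diff_op | \<mu>. norm (\<mu> - \<mu>0) < \<kappa>} h r \<epsilon>"
proof -
  obtain H where H: "H > 0" "\<And>z. z \<in> cball 0 r \<Longrightarrow> norm (poly h z) \<le> H"
    using poly_bounded_cball[of r h] by metis
  define \<epsilon>1 where "\<epsilon>1 = min (1/2) (\<epsilon> / (2 * H))"
  have \<epsilon>1: "0 < \<epsilon>1" "\<epsilon>1 \<le> 1/2" "\<epsilon>1 * H \<le> \<epsilon> / 2"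
  proof -
    have "\<epsilon>1 \<le> \<epsilon> / (2 * H)" by (simp add: \<epsilon>1_def)
    then show "\<epsilon>1 * H \<le> \<epsilon> / 2" using H(1) by (simp add: field_simps)
  qed (use \<epsilon> H in \<open>auto simp: \<epsilon>1_def\<close>)
  define L where "L \<rho> = (\<Sum>i\<le>degree h. norm (coeff h i) * \<rho> ^ i)" for \<rho> :: real
  have L0: "0 \<le> L \<rho>" if "0 \<le> \<rho>" for \<rho> using that by (auto simp: L_def intro!: sum_nonneg)
  obtain K :: real where K: "K \<ge> 1" and sweep: "\<forall>N \<epsilon>. \<epsilon> > 0 \<longrightarrow> (\<exists>\<kappa>>0. \<forall>n0. \<exists>Q \<nu>.
      derivative_schedule K N n0 Q \<nu> \<and> (\<forall>\<mu>. norm (\<mu> - \<mu>0) < \<kappa> \<longrightarrow> (\<exists>q\<in>Q. norm (\<mu> ^ q * \<nu> q - 1) < \<epsilon>)))"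
    using sweep_naturals[OF \<mu>0] by (elim exE conjE) (rule that)
  have tail_pos: "0 < e / (K * (L \<rho> + 1))" if "0 \<le> \<rho>" "0 < e" for e \<rho>
    using K L0[OF that(1)] that by simp
  obtain N1 where N1: "\<And>J. finite J \<Longrightarrow> (\<And>j. j \<in> J \<Longrightarrow> N1 \<le> j) \<Longrightarrow>
      (\<Sum>j\<in>J. (K * r) ^ j / fact j) \<le> (\<epsilon> / 4) / (K * (L r + 1))"
    using exp_series_tail[of "K * r" "(\<epsilon> / 4) / (K * (L r + 1))"] tail_pos[of r "\<epsilon> / 4"] r K \<epsilon> by auto
  obtain \<kappa> where \<kappa>: "\<kappa> > 0" and sweep': "\<forall>n0. \<exists>Q \<nu>. derivative_schedule K (max N1 (degree h + 1)) n0 Q \<nu> \<and>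
      (\<forall>\<mu>. norm (\<mu> - \<mu>0) < \<kappa> \<longrightarrow> (\<exists>q\<in>Q. norm (\<mu> ^ q * \<nu> q - 1) < \<epsilon>1))"
    using sweep[THEN spec, THEN spec, THEN mp, OF \<epsilon>1(1), of "max N1 (degree h + 1)"] by (elim exE conjE) (rule that)
  define \<O> where "\<O> = {scale_op \<mu> diff_op | \<mu>. norm (\<mu> - \<mu>0) < \<kappa>}"
  have "insertable \<O> h r \<epsilon>"
    unfolding insertable_def
  proof (intro allI impI)
    fix F :: "nat \<Rightarrow> complex poly" and s :: nat and R :: real and N :: nat and e :: real and k0 :: nat
    assume k0: "1 \<le> k0" "k0 \<le> s" and e: "0 < e"
    define S where "S = max R 0"
    have S: "0 \<le> S" by (simp add: S_def)
    obtain N2 where N2: "\<And>J. finite J \<Longrightarrow> (\<And>j. j \<in> J \<Longrightarrow> N2 \<le> j) \<Longrightarrow>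
        (\<Sum>j\<in>J. (K * S) ^ j / fact j) \<le> e / (K * (L S + 1))"
      using exp_series_tail[of "K * S" "e / (K * (L S + 1))"] tail_pos[OF S e] S K by auto
    define n0 where "n0 = max (max N N2) (Suc (Max (degree ` F ` {..s})))"
    have n0: "N \<le> n0" "N2 \<le> n0" "\<And>k. k \<le> s \<Longrightarrow> degree (F k) < n0"
    proof -
      fix k assume "k \<le> s"
      then have "degree (F k) \<le> Max (degree ` F ` {..s})" by (intro Max_ge) auto
      then show "degree (F k) < n0" unfolding n0_def by linarith
    qed (auto simp: n0_def)
    obtain Q \<nu> where sched: "derivative_schedule K (max N1 (degree h + 1)) n0 Q \<nu>"
      and hit: "\<forall>\<mu>. norm (\<mu> - \<mu>0) < \<kappa> \<longrightarrow> (\<exists>q\<in>Q. norm (\<mu> ^ q * \<nu> q - 1) < \<epsilon>1)"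
      using sweep'[THEN spec, of n0] by (elim exE conjE) (rule that)
    have cfg: "finite Q" using sched by (simp add: derivative_schedule_def)
    have Q: "n0 \<le> q" "\<nu> q \<noteq> 0" "norm (\<nu> q) \<le> K ^ (q + 1)" if "q \<in> Q" for q
      using sched that unfolding derivative_schedule_def by simp_all
    have gap: "q + N1 \<le> q'" "q + degree h < q'" "norm (\<nu> q') \<le> norm (\<nu> q) * K ^ (q' - q + 1)"
      if "q \<in> Q" "q' \<in> Q" "q < q'" for q q'
      using sched that unfolding derivative_schedule_def by force+
    obtain m where m: "0 < m" "\<And>q. q \<in> Q \<Longrightarrow> m \<le> norm (\<nu> q) / fact q"
      using finite_positive_lower_bound[OF cfg, of "\<lambda>q. norm (\<nu> q) / fact q"] Q(2) by auto
    define p where "p = (\<Sum>q\<in>Q. smult (\<nu> q) (iterated_integral q h))"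
    define P where "P k = (if k = k0 then p else 0)" for k
    have p_small: "norm (poly p z) \<le> e" if "norm z \<le> S" for z
    proof -
      have "norm (poly p z) \<le> (\<Sum>q\<in>Q. K * L S * ((K * S) ^ q / fact q))"
        unfolding p_def poly_sum
      proof (intro sum_norm_le)
        fix q assume q: "q \<in> Q"
        have "norm (poly (smult (\<nu> q) (iterated_integral q h)) z) \<le> K ^ (q + 1) * (L S * (S ^ q / fact q))"
          unfolding poly_smult norm_mult
          using Q(3)[OF q] norm_iterated_integral_le[OF that, of q h] K by (intro mult_mono) (auto simp: L_def)
        then show "norm (poly (smult (\<nu> q) (iterated_integral q h)) z) \<le> K * L S * ((K * S) ^ q / fact q)"
          by (simp add: power_mult_distrib mult_ac)
      qed
      also have "\<dots> = K * L S * (\<Sum>q\<in>Q. (K * S) ^ q / fact q)" by (simp add: sum_distrib_left)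
      also have "\<dots> \<le> K * (L S + 1) * (e / (K * (L S + 1)))"
        using N2[OF cfg] Q(1) n0(2) K L0[OF S] S by (intro mult_mono) (auto intro!: sum_nonneg intro: order_trans)
      also have "\<dots> = e" using K L0[OF S] by simp
      finally show ?thesis .
    qed
    have deriv_p: "norm (\<mu> ^ q * poly ((pderiv ^^ q) p) z - poly h z) \<le> \<epsilon>"
      if q: "q \<in> Q" and \<mu>: "norm (\<mu> ^ q * \<nu> q - 1) < \<epsilon>1" and z: "norm z \<le> r" for q \<mu> z
    proof -
      have \<mu>2: "norm (\<mu> ^ q) * norm (\<nu> q) \<le> 2"
        using norm_triangle_sub[of "\<mu> ^ q * \<nu> q" 1] \<mu> \<epsilon>1(2) by (simp add: norm_mult)
      define Q' where "Q' = {q'\<in>Q. q < q'}"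
      have Q'Q: "Q' \<subseteq> Q" "finite Q'" using cfg by (auto simp: Q'_def)
      have dterm: "(pderiv ^^ q) (iterated_integral q' h) =
          (if q' = q then h else if q < q' then iterated_integral (q' - q) h else 0)" if q': "q' \<in> Q" for q'
      proof (cases q q' rule: linorder_cases)
        case less
        then show ?thesis using higher_pderiv_iterated_integral[of q "q' - q" h] by simp
      next
        case equal
        then show ?thesis using higher_pderiv_iterated_integral[of q 0 h] by (simp add: iterated_integral_0)
      next
        case greater
        have "q = (q - q') + q'" using greater by simp
        then have "(pderiv ^^ q) (iterated_integral q' h) = (pderiv ^^ (q - q')) ((pderiv ^^ q') (iterated_integral (q' + 0) h))"
          by (metis funpow_add o_apply add_0_right)
        also have "\<dots> = (pderiv ^^ (q - q')) h"
          by (simp only: higher_pderiv_iterated_integral iterated_integral_0)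
        also have "\<dots> = 0" using gap(2)[OF q' q greater] greater by (intro higher_pderiv_eq_0) linarith
        finally show ?thesis using greater by simp
      qed
      have "(pderiv ^^ q) p = (\<Sum>q'\<in>Q. smult (\<nu> q') ((pderiv ^^ q) (iterated_integral q' h)))"
        by (simp add: p_def higher_pderiv_sum higher_pderiv_smult)
      also have "\<dots> = (\<Sum>q'\<in>Q. smult (\<nu> q') (if q' = q then h else 0)
          + smult (\<nu> q') (if q < q' then iterated_integral (q' - q) h else 0))"
        by (intro sum.cong) (auto simp: dterm)
      also have "\<dots> = smult (\<nu> q) h + (\<Sum>q'\<in>Q'. smult (\<nu> q') (iterated_integral (q' - q) h))"
      proof -
        have "(\<Sum>q'\<in>Q. smult (\<nu> q') (if q' = q then h else 0)) = (\<Sum>q'\<in>Q. if q' = q then smult (\<nu> q) h else 0)"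
          by (intro sum.cong) auto
        then have "(\<Sum>q'\<in>Q. smult (\<nu> q') (if q' = q then h else 0)) = smult (\<nu> q) h"
          using q cfg by simp
        moreover have "(\<Sum>q'\<in>Q. smult (\<nu> q') (if q < q' then iterated_integral (q' - q) h else 0)) =
            (\<Sum>q'\<in>Q'. smult (\<nu> q') (iterated_integral (q' - q) h))"
          using cfg by (intro sum.mono_neutral_cong_right) (auto simp: Q'_def)
        ultimately show ?thesis by (simp only: sum.distrib)
      qed
      finally have "\<mu> ^ q * poly ((pderiv ^^ q) p) z - poly h z =
          (\<mu> ^ q * \<nu> q - 1) * poly h z + (\<Sum>q'\<in>Q'. \<mu> ^ q * \<nu> q' * poly (iterated_integral (q' - q) h) z)"
        by (simp add: poly_sum algebra_simps sum_distrib_left)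
      also have "norm \<dots> \<le> \<epsilon> / 2 + \<epsilon> / 2"
      proof (intro norm_triangle_mono)
        have "norm ((\<mu> ^ q * \<nu> q - 1) * poly h z) \<le> \<epsilon>1 * H"
          using \<mu> H(2)[of z] z \<epsilon>1(1) H(1) unfolding norm_mult by (intro mult_mono) auto
        then show "norm ((\<mu> ^ q * \<nu> q - 1) * poly h z) \<le> \<epsilon> / 2" using \<epsilon>1(3) by linarith
        have "norm (\<Sum>q'\<in>Q'. \<mu> ^ q * \<nu> q' * poly (iterated_integral (q' - q) h) z)
            \<le> (\<Sum>q'\<in>Q'. 2 * K * L r * ((K * r) ^ (q' - q) / fact (q' - q)))"
        proof (intro sum_norm_le)
          fix q' assume q': "q' \<in> Q'"
          then have "norm (\<mu> ^ q) * norm (\<nu> q') \<le> norm (\<mu> ^ q) * (norm (\<nu> q) * K ^ (q' - q + 1))"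
            using gap(3)[OF q] by (intro mult_left_mono) (auto simp: Q'_def)
          also have "\<dots> = (norm (\<mu> ^ q) * norm (\<nu> q)) * K ^ (q' - q + 1)" by simp
          also have "\<dots> \<le> 2 * K ^ (q' - q + 1)" using \<mu>2 K by (intro mult_right_mono) auto
          finally have "norm (\<mu> ^ q * \<nu> q') * norm (poly (iterated_integral (q' - q) h) z)
              \<le> 2 * K ^ (q' - q + 1) * (L r * (r ^ (q' - q) / fact (q' - q)))"
            using norm_iterated_integral_le[OF z, of "q' - q" h] K
            by (intro mult_mono) (auto simp: norm_mult L_def)
          then show "norm (\<mu> ^ q * \<nu> q' * poly (iterated_integral (q' - q) h) z)
              \<le> 2 * K * L r * ((K * r) ^ (q' - q) / fact (q' - q))"
            by (simp add: norm_mult power_mult_distrib mult_ac)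
        qed
        also have "\<dots> = 2 * K * L r * (\<Sum>q'\<in>Q'. (K * r) ^ (q' - q) / fact (q' - q))" by (simp add: sum_distrib_left)
        also have "(\<Sum>q'\<in>Q'. (K * r) ^ (q' - q) / fact (q' - q)) = (\<Sum>j\<in>(\<lambda>q'. q' - q) ` Q'. (K * r) ^ j / fact j)"
          by (subst sum.reindex) (auto intro!: inj_onI simp: Q'_def)
        also have "2 * K * L r * \<dots> \<le> 2 * K * (L r + 1) * ((\<epsilon> / 4) / (K * (L r + 1)))"
        proof (intro mult_mono N1)
          show "N1 \<le> j" if "j \<in> (\<lambda>q'. q' - q) ` Q'" for j
            using that gap(1)[OF q] by (force simp: Q'_def)
        qed (use K L0[of r] r Q'Q in \<open>auto intro!: sum_nonneg\<close>)
        also have "\<dots> = 2 * (K * (L r + 1)) * (\<epsilon> / 4 / (K * (L r + 1)))" by simp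
        also have "\<dots> = \<epsilon> / 2"
        proof -
          have "K * (L r + 1) \<noteq> 0" using K L0[of r] r by auto
          moreover have "x \<noteq> 0 \<Longrightarrow> 2 * x * (\<epsilon> / 4 / x) = \<epsilon> / 2" for x by simp
          ultimately show ?thesis by blast
        qed
        finally show "norm (\<Sum>q'\<in>Q'. \<mu> ^ q * \<nu> q' * poly (iterated_integral (q' - q) h) z) \<le> \<epsilon> / 2" .
      qed
      finally show ?thesis by simp
    qed
    show "\<exists>P R' X \<theta>. admissible_step \<O> h r \<epsilon> F s R N e k0 P R' X \<theta>"
      unfolding admissible_step_def steers_def
    proof (rule exI[of _ P], rule exI[of _ "r + 1"], rule exI[of _ "cball 0 (r + 1)"], rule exI[of _ "e * m / 2"],
        intro conjI ballI allI impI subset_refl)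
      show "0 < e * m / 2" using e m by simp
      show "monom 1 N dvd P k" for k
        unfolding P_def p_def using Q(1) n0(1)
        by (auto intro!: dvd_sum dvd_smult monom_dvd_iterated_integral intro: order_trans)
      show "norm (poly (P k) z) \<le> e" if "z \<in> cball 0 R" for k z
        using p_small[of z] that e by (auto simp: P_def S_def le_max_iff_disj)
      show "norm z \<le> r + 1 \<or> norm (poly (F 0 + P 0) z) \<le> 1" if "z \<in> cball 0 (r + 1)" for z
        using that by simp
    next
      fix T f c A assume T: "T \<in> \<O>" and f: "f \<in> entire_functions" and c: "c k0 = 1" "\<forall>k. norm (c k) \<le> A"
        and close: "\<forall>z\<in>cball 0 (r + 1). norm (f z - (\<Sum>k=1..s. c k * poly (F k + P k) z)) \<le> A * (e * m / 2)"
      have A: "0 \<le> A" using c(2) norm_ge_zero order_trans by blast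
      obtain \<mu> where T: "T = scale_op \<mu> diff_op" "norm (\<mu> - \<mu>0) < \<kappa>" using T by (auto simp: \<O>_def)
      obtain q where q: "q \<in> Q" "norm (\<mu> ^ q * \<nu> q - 1) < \<epsilon>1" using hit T(2) by blast
      have \<mu>2: "norm (\<mu> ^ q) * norm (\<nu> q) \<le> 2"
        using norm_triangle_sub[of "\<mu> ^ q * \<nu> q" 1] q(2) \<epsilon>1(2) by (simp add: norm_mult)
      define G where "G = (\<Sum>k=1..s. smult (c k) (F k + P k))"
      have G: "(pderiv ^^ q) G = (pderiv ^^ q) p"
      proof -
        have F0: "(pderiv ^^ q) (F k) = 0" if "k \<le> s" for k
          using n0(3)[OF that] Q(1)[OF q(1)] by (intro higher_pderiv_eq_0) linarith
        have "(pderiv ^^ q) G = (\<Sum>k=1..s. smult (c k) ((pderiv ^^ q) (P k)))"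
          unfolding G_def using F0 by (simp add: higher_pderiv_sum higher_pderiv_smult higher_pderiv_add)
        also have "\<dots> = (\<Sum>k=1..s. if k = k0 then (pderiv ^^ q) p else 0)"
          using c(1) by (intro sum.cong) (auto simp: P_def)
        also have "\<dots> = (pderiv ^^ q) p" using k0 by simp
        finally show ?thesis .
      qed
      have "norm ((T ^^ q) f z - poly h z) \<le> A * e + \<epsilon>" if z: "z \<in> cball 0 r" for z
      proof -
        have "norm ((deriv ^^ q) f z - poly ((pderiv ^^ q) p) z) \<le> fact q * (A * (e * m / 2))"
          unfolding G[symmetric] using close z
          by (intro higher_deriv_perturbation[OF f, of r]) (auto simp: G_def poly_sum)
        then have "norm (\<mu> ^ q) * norm ((deriv ^^ q) f z - poly ((pderiv ^^ q) p) z)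
            \<le> norm (\<mu> ^ q) * (fact q * (A * (e * m / 2)))" by (rule mult_left_mono) simp
        also have "\<dots> = A * e / 2 * (norm (\<mu> ^ q) * (fact q * m))" by simp
        also have "\<dots> \<le> A * e / 2 * 2"
        proof (rule mult_left_mono)
          have "fact q * m \<le> norm (\<nu> q)" using m(2)[OF q(1)] by (simp add: pos_le_divide_eq mult.commute)
          then have "norm (\<mu> ^ q) * (fact q * m) \<le> norm (\<mu> ^ q) * norm (\<nu> q)" by (rule mult_left_mono) simp
          then show "norm (\<mu> ^ q) * (fact q * m) \<le> 2" using \<mu>2 by linarith
        qed (use A e in simp)
        finally have t1: "norm (\<mu> ^ q * ((deriv ^^ q) f z - poly ((pderiv ^^ q) p) z)) \<le> A * e"
          by (simp add: norm_mult)
        have t2: "norm (\<mu> ^ q * poly ((pderiv ^^ q) p) z - poly h z) \<le> \<epsilon>"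
          using deriv_p[OF q] z by simp
        have "(T ^^ q) f z - poly h z = \<mu> ^ q * ((deriv ^^ q) f z - poly ((pderiv ^^ q) p) z)
            + (\<mu> ^ q * poly ((pderiv ^^ q) p) z - poly h z)"
          by (simp add: T(1) funpow_scale_diff[OF f] algebra_simps)
        also have "norm \<dots> \<le> A * e + \<epsilon>" by (intro norm_triangle_mono t1 t2)
        finally show ?thesis .
      qed
      then show "\<exists>n. \<forall>z\<in>cball 0 r. norm ((T ^^ n) f z - poly h z) \<le> A * e + \<epsilon>" by blast
    qed
  qed
  then show ?thesis using \<kappa> unfolding \<O>_def by blast
qed

section \<open>The closed subspace generated by a staged construction\<close>

lemma steers_cong:
  assumes "\<And>k. 1 \<le> k \<Longrightarrow> k \<le> s \<Longrightarrow> G k = G' k"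
  shows "steers \<O> h r \<epsilon> G s k0 e X \<theta> = steers \<O> h r \<epsilon> G' s k0 e X \<theta>"
proof -
  have "(\<Sum>k=1..s. c k * poly (G k) z) = (\<Sum>k=1..s. c k * poly (G' k) z)" for c z
    using assms by (intro sum.cong) auto
  then show ?thesis by (simp add: steers_def)
qed

definition taylor_coeff :: "nat \<Rightarrow> (complex \<Rightarrow> complex) \<Rightarrow> complex" where
  "taylor_coeff n f = (deriv ^^ n) f 0 / fact n"

lemma taylor_coeff_add:
  "f \<in> entire_functions \<Longrightarrow> g \<in> entire_functions \<Longrightarrow>
    taylor_coeff n (f + g) = taylor_coeff n f + taylor_coeff n g"
  unfolding taylor_coeff_def entire_functions_def plus_fun_def
  by (subst higher_deriv_add[of _ UNIV]) (auto simp: add_divide_distrib)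

lemma taylor_coeff_diff:
  "f \<in> entire_functions \<Longrightarrow> g \<in> entire_functions \<Longrightarrow>
    taylor_coeff n (\<lambda>z. f z - g z) = taylor_coeff n f - taylor_coeff n g"
  unfolding taylor_coeff_def entire_functions_def
  by (subst higher_deriv_diff[of _ UNIV]) (auto simp: diff_divide_distrib)

lemma taylor_coeff_scale:
  "f \<in> entire_functions \<Longrightarrow> taylor_coeff n (scale_fun c f) = c * taylor_coeff n f"
  unfolding taylor_coeff_def entire_functions_def scale_fun_def
  by (subst higher_deriv_cmult[of _ UNIV]) auto

lemma taylor_coeff_zero: "taylor_coeff n 0 = 0"
proof -
  have "(0 :: complex \<Rightarrow> complex) = scale_fun 0 0" by (simp add: scale_fun_def fun_eq_iff)
  moreover have "(0 :: complex \<Rightarrow> complex) \<in> entire_functions"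
    by (auto simp: entire_functions_def zero_fun_def)
  ultimately show ?thesis using taylor_coeff_scale[of 0 n 0] by simp
qed

lemma taylor_coeff_poly: "taylor_coeff n (poly p) = coeff p n"
proof -
  have "poly ((pderiv ^^ n) p) 0 = fact n * coeff p n" for p :: "complex poly"
  proof (induction n arbitrary: p)
    case (Suc n)
    then show ?case by (simp add: funpow_Suc_right coeff_pderiv algebra_simps del: funpow.simps)
  qed (simp add: poly_0_coeff_0)
  then show ?thesis by (simp add: taylor_coeff_def higher_deriv_poly)
qed

lemma norm_taylor_coeff_le:
  assumes f: "f \<in> entire_functions" and \<rho>: "0 < \<rho>" and B: "\<And>z. z \<in> cball 0 \<rho> \<Longrightarrow> norm (f z) \<le> B"
  shows "norm (taylor_coeff n f) \<le> B / \<rho> ^ n"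
proof -
  have fh: "f holomorphic_on UNIV" using f by (simp add: entire_functions_def)
  have "norm ((deriv ^^ n) f 0) \<le> fact n * B / \<rho> ^ n"
  proof (rule Cauchy_inequality)
    show "f holomorphic_on ball 0 \<rho>" using fh holomorphic_on_subset by blast
    show "continuous_on (cball 0 \<rho>) f"
      using fh holomorphic_on_imp_continuous_on holomorphic_on_subset by blast
  qed (use \<rho> B in auto)
  then have "norm ((deriv ^^ n) f 0) / fact n \<le> fact n * B / \<rho> ^ n / fact n" by (rule divide_right_mono) simp
  then show ?thesis by (simp add: taylor_coeff_def norm_divide)
qed

lemma entire_bounded_cball:
  assumes "f \<in> entire_functions"
  obtains B where "B > 0" "\<And>z. z \<in> cball 0 \<rho> \<Longrightarrow> norm (f z) \<le> B"
proof -
  have "continuous_on (cball 0 \<rho>) f"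
    using assms holomorphic_on_imp_continuous_on holomorphic_on_subset
    unfolding entire_functions_def by blast
  then have "compact (f ` cball 0 \<rho>)" by (intro compact_continuous_image) auto
  then show ?thesis using compact_imp_bounded bounded_pos that by (metis imageI)
qed

text \<open>The outcome of the staged construction. \<open>F s k\<close> for \<open>k \<le> s\<close> are the current polynomials at stage \<open>s\<close>, which
changes them by at most \<open>e s\<close> on the disc of radius \<open>R s\<close> and then starts a new generator of order
\<open>m (Suc s)\<close> as a power of the auxiliary polynomial. Stage \<open>s\<close> works on the task with number \<open>task s\<close> through
the generator \<open>dir s\<close>, and is idle when that generator does not exist yet. The bounds by \<open>\<theta>\<close> say that
neither the later corrections nor the later generators can undo what it has achieved.\<close>
locale stages =
  fixes F :: "nat \<Rightarrow> nat \<Rightarrow> complex poly" and R e :: "nat \<Rightarrow> real" and m task dir :: "nat \<Rightarrow> nat"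
    and Ops :: "nat \<Rightarrow> ((complex \<Rightarrow> complex) \<Rightarrow> (complex \<Rightarrow> complex)) set"
    and h :: "nat \<Rightarrow> complex poly" and r \<epsilon> :: "nat \<Rightarrow> real"
  assumes F00: "F 0 0 = [:0, 1:]"
    and e_pos: "0 < e s" and e_half: "e (Suc s) \<le> e s / 2" and e_0: "e 0 \<le> 1"
    and R_ge: "real s \<le> R s" and R_Suc: "R s \<le> R (Suc s)"
    and m_0: "1 \<le> m 0" and m_Suc: "m s < m (Suc s)"
    and degree_lt: "k \<le> s \<Longrightarrow> degree (F (Suc s) k) < m (Suc s)"
    and step_dvd: "k \<le> s \<Longrightarrow> monom 1 (Suc (m s)) dvd F (Suc s) k - F s k"
    and step_small: "k \<le> s \<Longrightarrow> z \<in> cball 0 (R s) \<Longrightarrow> norm (poly (F (Suc s) k - F s k) z) \<le> e s"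
    and new: "F (Suc s) (Suc s) = F (Suc s) 0 ^ m (Suc s)"
    and goal: "1 \<le> dir s \<Longrightarrow> dir s \<le> s \<Longrightarrow> \<exists>X \<theta>. X \<subseteq> cball 0 (R (Suc s)) \<and>
        (\<forall>z\<in>X. norm z \<le> r (task s) + 1 \<or> norm (poly (F (Suc s) 0) z) \<le> 1) \<and>
        4 * (real s + 1) * e (Suc s) \<le> \<theta> \<and> 4 * (1/2) ^ m (Suc s) \<le> \<theta> \<and>
        steers (Ops (task s)) (h (task s)) (r (task s)) (\<epsilon> (task s)) (F (Suc s)) s (dir s) (e s) X \<theta>"
begin

lemma e_le_power: "e s \<le> (1/2) ^ s"
proof (induction s)
  case (Suc s)
  have "(1/2) ^ Suc s = (1/2) ^ s / (2 :: real)" by simp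
  then show ?case using e_half[of s] Suc.IH by linarith
qed (use e_0 in simp)

lemma e_mono: "s \<le> t \<Longrightarrow> e t \<le> e s"
proof (induction t rule: dec_induct)
  case (step n)
  then show ?case using e_half[of n] e_pos[of n] by linarith
qed auto

lemma R_mono: "s \<le> t \<Longrightarrow> R s \<le> R t"
  using R_Suc by (rule lift_Suc_mono_le)

lemma m_mono: "s \<le> t \<Longrightarrow> m s \<le> m t"
  by (rule lift_Suc_mono_le[of m]) (rule less_imp_le[OF m_Suc])

lemma m_strict: "s < t \<Longrightarrow> m s < m t"
  using m_Suc by (rule lift_Suc_mono_less)

lemma m_ge: "s + 1 \<le> m s"
proof (induction s)
  case (Suc s)
  then show ?case using m_Suc[of s] by linarith
qed (use m_0 in simp)

lemma m_add: "m s + j \<le> m (s + j)"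
proof (induction j)
  case (Suc j)
  then show ?case using m_Suc[of "s + j"] by simp
qed simp

lemma stage_dist:
  assumes "k \<le> s" "s \<le> t" "z \<in> cball 0 (R s)"
  shows "norm (poly (F t k) z - poly (F s k) z) \<le> 2 * e s"
proof -
  have "norm (poly (F t k) z - poly (F s k) z) \<le> 2 * e s - 2 * e t"
    using assms(2)
  proof (induction t rule: dec_induct)
    case (step n)
    have "z \<in> cball 0 (R n)" using assms(3) R_mono[OF step.hyps(1)] by simp
    then have "norm (poly (F (Suc n) k) z - poly (F n k) z) \<le> e n"
      using step_small[of k n z] assms(1) step.hyps by simp
    then have "norm (poly (F (Suc n) k) z - poly (F s k) z) \<le> e n + (2 * e s - 2 * e n)"
      using norm_triangle_ineq[of "poly (F (Suc n) k) z - poly (F n k) z" "poly (F n k) z - poly (F s k) z"] step.IH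
      by simp
    then show ?case using e_half[of n] by linarith
  qed simp
  then show ?thesis using e_pos[of t] by linarith
qed

text \<open>The generators are \<open>gen k\<close> with \<open>k \<ge> 1\<close>; the auxiliary function is \<open>gen 0\<close>.\<close>
definition gen :: "nat \<Rightarrow> complex \<Rightarrow> complex" where
  "gen k z = lim (\<lambda>s. poly (F s k) z)"

lemma stage_gap_tendsto: "(\<lambda>s. 2 * e s) \<longlonglongrightarrow> 0"
proof (rule Lim_null_comparison)
  show "(\<lambda>s. 2 * (1/2) ^ s :: real) \<longlonglongrightarrow> 0" by (intro tendsto_mult_right_zero LIMSEQ_realpow_zero) auto
  show "eventually (\<lambda>s. norm (2 * e s) \<le> 2 * (1/2) ^ s) sequentially"
    using e_le_power e_pos by (intro always_eventually) (auto simp: less_imp_le)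
qed

lemma gen_tendsto: "(\<lambda>s. poly (F s k) z) \<longlonglongrightarrow> gen k z"
proof -
  have "Cauchy (\<lambda>s. poly (F s k) z)"
  proof (rule metric_CauchyI)
    fix \<eta> :: real assume \<eta>: "\<eta> > 0"
    have "eventually (\<lambda>s. 2 * e s < \<eta> / 2) sequentially"
      using \<eta> by (intro order_tendstoD(2)[OF stage_gap_tendsto]) simp
    then obtain s1 where s1: "\<And>s. s \<ge> s1 \<Longrightarrow> 2 * e s < \<eta> / 2" by (auto simp: eventually_sequentially)
    define s where "s = max s1 (max k (nat \<lceil>norm z\<rceil>))"
    have s: "2 * e s < \<eta> / 2" "k \<le> s" "z \<in> cball 0 (R s)"
    proof -
      have "norm z \<le> real s" unfolding s_def by linarith
      then show "z \<in> cball 0 (R s)" using R_ge[of s] by simp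
    qed (use s1 in \<open>auto simp: s_def\<close>)
    have "dist (poly (F t k) z) (poly (F t' k) z) < \<eta>" if "t \<ge> s" "t' \<ge> s" for t t'
      using stage_dist[OF s(2) that(1) s(3)] stage_dist[OF s(2) that(2) s(3)] s(1)
        dist_triangle2[of "poly (F t k) z" "poly (F t' k) z" "poly (F s k) z"] by (simp add: dist_norm)
    then show "\<exists>M. \<forall>t\<ge>M. \<forall>t'\<ge>M. dist (poly (F t k) z) (poly (F t' k) z) < \<eta>" by blast
  qed
  then show ?thesis unfolding gen_def using Cauchy_convergent convergent_LIMSEQ_iff by blast
qed

lemma gen_dist:
  assumes "k \<le> s" "z \<in> cball 0 (R s)"
  shows "norm (gen k z - poly (F s k) z) \<le> 2 * e s"
proof (rule LIMSEQ_le_const2)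
  show "(\<lambda>t. norm (poly (F t k) z - poly (F s k) z)) \<longlonglongrightarrow> norm (gen k z - poly (F s k) z)"
    by (intro tendsto_intros gen_tendsto)
  show "\<exists>N. \<forall>t\<ge>N. norm (poly (F t k) z - poly (F s k) z) \<le> 2 * e s"
    using stage_dist[OF assms(1) _ assms(2)] by blast
qed

lemma gen_uniform_limit: "uniform_limit (cball 0 \<rho>) (\<lambda>s. poly (F s k)) (gen k) sequentially"
proof (rule uniform_limitI)
  fix \<eta> :: real assume \<eta>: "\<eta> > 0"
  have "eventually (\<lambda>s. 2 * e s < \<eta>) sequentially"
    using \<eta> by (rule order_tendstoD(2)[OF stage_gap_tendsto])
  moreover have "eventually (\<lambda>s. s \<ge> max k (nat \<lceil>\<rho>\<rceil>)) sequentially" by (rule eventually_ge_at_top)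
  ultimately show "eventually (\<lambda>s. \<forall>z\<in>cball 0 \<rho>. dist (poly (F s k) z) (gen k z) < \<eta>) sequentially"
  proof eventually_elim
    case (elim s)
    show ?case
    proof
      fix z :: complex assume "z \<in> cball 0 \<rho>"
      moreover have "\<rho> \<le> R s" using elim(2) R_ge[of s] by linarith
      ultimately have "norm (gen k z - poly (F s k) z) \<le> 2 * e s" using elim(2) by (intro gen_dist) auto
      then show "dist (poly (F s k) z) (gen k z) < \<eta>" using elim(1) by (simp add: dist_norm norm_minus_commute)
    qed
  qed
qed

lemma gen_entire: "gen k \<in> entire_functions"
proof -
  have "gen k holomorphic_on UNIV"
  proof (rule holomorphic_uniform_sequence[of UNIV "\<lambda>s. poly (F s k)"])
    show "poly (F s k) holomorphic_on UNIV" for s using poly_entire[of "F s k"] by (simp add: entire_functions_def)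
    fix x :: complex
    have "cball x 1 \<subseteq> cball 0 (norm x + 1)"
    proof
      fix y assume "y \<in> cball x 1"
      then show "y \<in> cball 0 (norm x + 1)"
        using norm_triangle_sub[of y x] by (simp add: dist_norm norm_minus_commute)
    qed
    then have "uniform_limit (cball x 1) (\<lambda>s. poly (F s k)) (gen k) sequentially"
      using gen_uniform_limit uniform_limit_on_subset by blast
    then show "\<exists>d>0. cball x d \<subseteq> UNIV \<and> uniform_limit (cball x d) (\<lambda>s. poly (F s k)) (gen k) sequentially"
      by (intro exI[of _ 1]) auto
  qed auto
  then show ?thesis by (simp add: entire_functions_def)
qed

lemma coeff_step:
  assumes "k \<le> s" "i \<le> m s"
  shows "coeff (F (Suc s) k) i = coeff (F s k) i"
proof -
  obtain q where "F (Suc s) k - F s k = monom 1 (Suc (m s)) * q" using step_dvd[OF assms(1)] by blast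
  then have "coeff (F (Suc s) k - F s k) i = 0" using assms(2) by (simp add: coeff_monom_mult)
  then show ?thesis by simp
qed

text \<open>The auxiliary polynomial keeps a simple zero with derivative \<open>1\<close> at the origin, so its \<open>n\<close>-th power has
leading Taylor term \<open>z ^ n\<close>.\<close>
lemma base_shape: "\<exists>u. F s 0 = monom 1 1 * u \<and> coeff u 0 = 1"
proof (induction s)
  case 0
  show ?case using F00 by (intro exI[of _ 1]) (simp add: monom_altdef)
next
  case (Suc s)
  then obtain u where u: "F s 0 = monom 1 1 * u" "coeff u 0 = 1" by blast
  obtain q where q: "F (Suc s) 0 - F s 0 = monom 1 (Suc (m s)) * q" using step_dvd[of 0 s] by auto
  have "monom (1::complex) (Suc (m s)) = monom 1 1 * monom 1 (m s)" by (simp add: mult_monom)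
  then have "F (Suc s) 0 = monom 1 1 * (u + monom 1 (m s) * q)" using q u(1) by (simp add: algebra_simps)
  moreover have "coeff (u + monom 1 (m s) * q) 0 = 1" using u(2) m_ge[of s] by (simp add: coeff_monom_mult)
  ultimately show ?case by blast
qed

lemma coeff_new:
  shows "i < m (Suc s) \<Longrightarrow> coeff (F (Suc s) (Suc s)) i = 0"
    and "coeff (F (Suc s) (Suc s)) (m (Suc s)) = 1"
proof -
  obtain u where u: "F (Suc s) 0 = monom 1 1 * u" "coeff u 0 = 1" using base_shape by blast
  have "F (Suc s) (Suc s) = monom 1 (m (Suc s)) * u ^ m (Suc s)"
    by (simp add: new u(1) power_mult_distrib monom_power)
  moreover have "coeff (u ^ n) 0 = 1" for n using u(2) by (simp add: poly_0_coeff_0[symmetric] poly_power)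
  ultimately show "i < m (Suc s) \<Longrightarrow> coeff (F (Suc s) (Suc s)) i = 0"
    "coeff (F (Suc s) (Suc s)) (m (Suc s)) = 1" by (auto simp: coeff_monom_mult)
qed

lemma coeff_stage:
  assumes "1 \<le> k" "1 \<le> j" "max j k \<le> s"
  shows "coeff (F s k) (m j) = (if j = k then 1 else 0)"
  using assms(3)
proof (induction s rule: dec_induct)
  case base
  show ?case
  proof (cases "j \<le> k")
    case True
    obtain k' where "k = Suc k'" using assms(1) by (cases k) auto
    then show ?thesis using True m_strict[of j k] coeff_new(1)[of "m j" k'] coeff_new(2)[of k']
      by (cases "j = k") (auto simp: max_def)
  next
    case False
    then obtain j' where j': "j = Suc j'" by (cases j) auto
    have "degree (F (Suc j') k) < m (Suc j')" using False j' by (intro degree_lt) simp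
    then show ?thesis using False j' by (simp add: coeff_eq_0)
  qed
next
  case (step n)
  then have "m j \<le> m n" by (intro m_mono) simp
  then show ?case using step by (subst coeff_step) auto
qed

text \<open>The generators are biorthogonal to the Taylor coefficients of degrees \<open>m j\<close>: the coefficient vanishes
for \<open>j < k\<close> by the order of the zero and for \<open>j > k\<close> because \<open>m j\<close> exceeds all degrees present when it is
chosen, and later corrections start beyond \<open>m j\<close>.\<close>
lemma taylor_coeff_gen:
  assumes "1 \<le> k" "1 \<le> j"
  shows "taylor_coeff (m j) (gen k) = (if j = k then 1 else 0)"
proof -
  have "norm (taylor_coeff (m j) (gen k) - (if j = k then 1 else 0)) \<le> 2 * e s" if s: "max j k \<le> s" "1 \<le> s" for s
  proof -
    have "norm (taylor_coeff (m j) (\<lambda>z. gen k z - poly (F s k) z)) \<le> 2 * e s / 1 ^ m j"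
    proof (rule norm_taylor_coeff_le)
      show "(\<lambda>z. gen k z - poly (F s k) z) \<in> entire_functions"
        using gen_entire[of k] poly_entire[of "F s k"] by (auto simp: entire_functions_def intro!: holomorphic_intros)
      show "norm (gen k z - poly (F s k) z) \<le> 2 * e s" if "z \<in> cball 0 1" for z
        using that s R_ge[of s] by (intro gen_dist) auto
    qed simp
    then show ?thesis
      using coeff_stage[OF assms s(1)] by (simp add: taylor_coeff_diff gen_entire poly_entire taylor_coeff_poly)
  qed
  then have "\<exists>N. \<forall>s\<ge>N. norm (taylor_coeff (m j) (gen k) - (if j = k then 1 else 0)) \<le> 2 * e s"
    by (intro exI[of _ "max 1 (max j k)"]) auto
  then have "norm (taylor_coeff (m j) (gen k) - (if j = k then 1 else 0)) \<le> 0"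
    by (rule LIMSEQ_le_const[OF stage_gap_tendsto])
  then show ?thesis by simp
qed

lemma base_bounded:
  obtains W where "W > 0" "\<And>s z. z \<in> cball 0 \<rho> \<Longrightarrow> norm (poly (F s 0) z) \<le> W"
proof -
  define S where "S = nat \<lceil>\<rho>\<rceil>"
  have S: "\<rho> \<le> R S" using R_ge[of S] unfolding S_def by linarith
  have "\<exists>W>0. \<forall>z\<in>cball 0 \<rho>. norm (poly (F s 0) z) \<le> W" for s
    using poly_bounded_cball[of \<rho> "F s 0"] by metis
  then obtain W where W: "\<And>s. W s > 0" "\<And>s z. z \<in> cball 0 \<rho> \<Longrightarrow> norm (poly (F s 0) z) \<le> W s" by metis
  define W' where "W' = (\<Sum>s\<le>S. W s) + 2"
  have le: "W s \<le> (\<Sum>s\<le>S. W s)" if "s \<le> S" for s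
    using that W(1) by (intro member_le_sum) (auto intro: less_imp_le)
  show ?thesis
  proof (rule that[of W'])
    have "0 \<le> (\<Sum>s\<le>S. W s)" using W(1) by (intro sum_nonneg) (simp add: less_imp_le)
    then show "W' > 0" by (simp add: W'_def)
    fix s :: nat and z assume z: "z \<in> cball (0::complex) \<rho>"
    show "norm (poly (F s 0) z) \<le> W'"
    proof (cases "s \<le> S")
      case True
      then show ?thesis using W(2)[OF z, of s] le[OF True] by (simp add: W'_def)
    next
      case False
      have "norm (poly (F s 0) z - poly (F S 0) z) \<le> 2 * e S" using z S False by (intro stage_dist) auto
      moreover have "e S \<le> 1" using e_mono[of 0 S] e_0 by simp
      ultimately show ?thesis using W(2)[OF z, of S] le[of S]
          norm_triangle_sub[of "poly (F s 0) z" "poly (F S 0) z"] by (simp add: W'_def)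
    qed
  qed
qed

lemma gen_le_power:
  assumes k: "1 \<le> k" and z: "z \<in> cball 0 (R k)" and W: "norm (poly (F k 0) z) \<le> W"
  shows "norm (gen k z) \<le> (W + 2) ^ m k"
proof -
  obtain k' where k': "k = Suc k'" using k by (cases k) auto
  have W0: "0 \<le> W" using W norm_ge_zero order_trans by blast
  have "norm (poly (F k k) z) \<le> W ^ m k" using W by (simp add: k' new poly_power norm_power power_mono)
  moreover have "norm (gen k z - poly (F k k) z) \<le> 2 * e k" using z by (intro gen_dist) auto
  moreover have "e k \<le> 1" using e_mono[of 0 k] e_0 by simp
  ultimately have "norm (gen k z) \<le> W ^ m k + 2"
    using norm_triangle_sub[of "gen k z" "poly (F k k) z"] by linarith
  also have "\<dots> \<le> (W + 2) ^ m k"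
  proof -
    obtain n where "m k = Suc n" using m_ge[of k] by (cases "m k") auto
    moreover have "W * W ^ n + 2 * 1 \<le> W * (W + 2) ^ n + 2 * (W + 2) ^ n"
      using W0 by (intro add_mono mult_left_mono power_mono one_le_power) auto
    ultimately show ?thesis by (simp add: algebra_simps)
  qed
  finally show ?thesis .
qed

text \<open>The base \<open>V\<close> does not depend on \<open>k\<close>: the generators are powers, up to a bounded error, of auxiliary
polynomials that converge locally uniformly. By Cauchy's estimates on a disc of radius larger than
\<open>V\<close> this makes every expansion along the generators converge.\<close>
lemma gen_growth:
  obtains V where "V \<ge> 1" "\<And>k z. 1 \<le> k \<Longrightarrow> z \<in> cball 0 \<rho> \<Longrightarrow> norm (gen k z) \<le> V ^ m k"
proof -
  obtain W where W: "W > 0" "\<And>s z. z \<in> cball 0 \<rho> \<Longrightarrow> norm (poly (F s 0) z) \<le> W"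
    using base_bounded[of \<rho>] by metis
  have "\<exists>B>0. \<forall>z\<in>cball 0 \<rho>. norm (gen k z) \<le> B" for k
    using entire_bounded_cball[OF gen_entire[of k], of \<rho>] by metis
  then obtain B where B: "\<And>k. B k > 0" "\<And>k z. z \<in> cball 0 \<rho> \<Longrightarrow> norm (gen k z) \<le> B k" by metis
  define S where "S = nat \<lceil>\<rho>\<rceil>"
  define V where "V = (W + 2) + (\<Sum>k\<le>S. B k)"
  have sB: "0 \<le> (\<Sum>k\<le>S. B k)" using B(1) by (intro sum_nonneg) (simp add: less_imp_le)
  have V1: "V \<ge> 1" "W + 2 \<le> V" using sB W(1) by (auto simp: V_def)
  show ?thesis
  proof (rule that[OF V1(1)])
    fix k :: nat and z assume k: "1 \<le> k" and z: "z \<in> cball (0::complex) \<rho>"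
    show "norm (gen k z) \<le> V ^ m k"
    proof (cases "k \<le> S")
      case True
      have "B k \<le> (\<Sum>k\<le>S. B k)" using True B(1) by (intro member_le_sum) (auto intro: less_imp_le)
      then have "B k \<le> V" using W(1) by (simp add: V_def)
      also have "V \<le> V ^ m k" using V1(1) m_ge[of k] by (intro self_le_power) auto
      finally show ?thesis using B(2)[OF z, of k] by linarith
    next
      case False
      then have "\<rho> \<le> R k" using R_ge[of k] unfolding S_def by linarith
      then have "norm (gen k z) \<le> (W + 2) ^ m k" using z W(2) k by (intro gen_le_power) auto
      also have "\<dots> \<le> V ^ m k" using V1 W(1) by (intro power_mono) auto
      finally show ?thesis .
    qed
  qed
qed

text \<open>Requiring an entire function to equal its own expansion makes the space closed at once, as the
expansion depends continuously on the function.\<close>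
definition subsp :: "(complex \<Rightarrow> complex) set" where
  "subsp = {f \<in> entire_functions. \<forall>z. f z = (\<Sum>k. taylor_coeff (m (Suc k)) f * gen (Suc k) z)}"

text \<open>The disc of radius \<open>\<rho>\<close> depends on \<open>z\<close> only, so for fixed \<open>z\<close> the expansion is a continuous functional.\<close>
lemma expansion_bound:
  fixes z :: complex
  obtains \<rho> where "\<rho> > 0" "z \<in> cball 0 \<rho>" "\<And>f B k. f \<in> entire_functions \<Longrightarrow> (\<And>w. w \<in> cball 0 \<rho> \<Longrightarrow> norm (f w) \<le> B) \<Longrightarrow>
    norm (taylor_coeff (m (Suc k)) f * gen (Suc k) z) \<le> B * (1/2) ^ k"
proof -
  obtain V where V: "V \<ge> 1" "\<And>k w. 1 \<le> k \<Longrightarrow> w \<in> cball 0 (norm z) \<Longrightarrow> norm (gen k w) \<le> V ^ m k"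
    using gen_growth[of "norm z"] by metis
  define \<rho> where "\<rho> = 2 * (V + norm z)"
  have \<rho>: "\<rho> > 0" "2 * V \<le> \<rho>" using V(1) by (auto simp: \<rho>_def intro: add_pos_nonneg)
  show ?thesis
  proof (rule that[OF \<rho>(1)])
    show "z \<in> cball 0 \<rho>" using V(1) by (simp add: \<rho>_def)
    fix f B k assume f: "f \<in> entire_functions" and B: "\<And>w. w \<in> cball 0 \<rho> \<Longrightarrow> norm (f w) \<le> B"
    have "norm (f 0) \<le> B" using B[of 0] \<rho>(1) by simp
    then have B0: "0 \<le> B" using norm_ge_zero[of "f 0"] by linarith
    let ?n = "m (Suc k)"
    have "norm (taylor_coeff ?n f) \<le> B / \<rho> ^ ?n" by (rule norm_taylor_coeff_le[OF f \<rho>(1) B])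
    also have "\<dots> \<le> B / (2 * V) ^ ?n"
      using B0 V(1) \<rho>(2) by (intro divide_left_mono power_mono) auto
    finally have "norm (taylor_coeff ?n f * gen (Suc k) z) \<le> B / (2 * V) ^ ?n * V ^ ?n"
      unfolding norm_mult using V B0 by (intro mult_mono) auto
    also have "\<dots> = B * (1/2) ^ ?n" using V(1) by (simp add: power_mult_distrib power_one_over)
    also have "\<dots> \<le> B * (1/2) ^ k" using m_ge[of "Suc k"] B0 by (intro mult_left_mono power_decreasing) auto
    finally show "norm (taylor_coeff ?n f * gen (Suc k) z) \<le> B * (1/2) ^ k" .
  qed
qed

lemma expansion_summable:
  assumes "f \<in> entire_functions"
  shows "summable (\<lambda>k. norm (taylor_coeff (m (Suc k)) f * gen (Suc k) z))"
proof -
  obtain \<rho> where \<rho>: "\<And>f B k. f \<in> entire_functions \<Longrightarrow> (\<And>w. w \<in> cball 0 \<rho> \<Longrightarrow> norm (f w) \<le> B) \<Longrightarrow>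
    norm (taylor_coeff (m (Suc k)) f * gen (Suc k) z) \<le> B * (1/2) ^ k"
    using expansion_bound[of z] by metis
  obtain B where B: "\<And>w. w \<in> cball 0 \<rho> \<Longrightarrow> norm (f w) \<le> B" using entire_bounded_cball[OF assms] by metis
  have "summable (\<lambda>k. B * (1/2) ^ k)" by (intro summable_mult summable_geometric) auto
  moreover have "norm (taylor_coeff (m (Suc k)) f * gen (Suc k) z) \<le> B * (1/2) ^ k" for k
    using assms B by (rule \<rho>)
  ultimately show ?thesis by (intro summable_norm_comparison_test[of _ "\<lambda>k. B * (1/2) ^ k"]) blast+
qed

lemma subspace_subsp: "complex_fun.subspace subsp"
  unfolding complex_fun.subspace_def
proof (intro conjI ballI allI)
  have z: "(0 :: complex \<Rightarrow> complex) \<in> entire_functions"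
    using subspace_entire_functions complex_fun.subspace_0 by blast
  show "0 \<in> subsp" using z by (simp add: subsp_def taylor_coeff_zero)
next
  fix f g assume fg: "f \<in> subsp" "g \<in> subsp"
  then have E: "f \<in> entire_functions" "g \<in> entire_functions" by (auto simp: subsp_def)
  have "(\<Sum>k. taylor_coeff (m (Suc k)) (f + g) * gen (Suc k) z) = f z + g z" for z
  proof -
    have "(\<Sum>k. taylor_coeff (m (Suc k)) (f + g) * gen (Suc k) z)
        = (\<Sum>k. taylor_coeff (m (Suc k)) f * gen (Suc k) z + taylor_coeff (m (Suc k)) g * gen (Suc k) z)"
      using E by (simp add: taylor_coeff_add distrib_right)
    also have "\<dots> = (\<Sum>k. taylor_coeff (m (Suc k)) f * gen (Suc k) z) + (\<Sum>k. taylor_coeff (m (Suc k)) g * gen (Suc k) z)"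
      using E by (intro suminf_add[symmetric] summable_norm_cancel[OF expansion_summable])
    finally show ?thesis using fg by (simp add: subsp_def)
  qed
  then show "f + g \<in> subsp"
    using complex_fun.subspace_add[OF subspace_entire_functions E] by (simp add: subsp_def)
next
  fix c f assume f: "f \<in> subsp"
  then have E: "f \<in> entire_functions" by (auto simp: subsp_def)
  have "(\<Sum>k. taylor_coeff (m (Suc k)) (scale_fun c f) * gen (Suc k) z) = c * f z" for z
  proof -
    have "(\<Sum>k. taylor_coeff (m (Suc k)) (scale_fun c f) * gen (Suc k) z)
        = (\<Sum>k. c * (taylor_coeff (m (Suc k)) f * gen (Suc k) z))"
      using E by (simp add: taylor_coeff_scale mult.assoc)
    also have "\<dots> = c * (\<Sum>k. taylor_coeff (m (Suc k)) f * gen (Suc k) z)"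
      using E by (intro suminf_mult summable_norm_cancel[OF expansion_summable])
    finally show ?thesis using f by (simp add: subsp_def)
  qed
  then show "scale_fun c f \<in> subsp"
    using complex_fun.subspace_scale[OF subspace_entire_functions E] by (simp add: subsp_def) (simp add: scale_fun_def)
qed

lemma closedin_subsp: "closedin entire_topology subsp"
  unfolding closedin_def
proof
  show "subsp \<subseteq> topspace entire_topology" by (auto simp: subsp_def)
  show "openin entire_topology (topspace entire_topology - subsp)"
    unfolding openin_entire_topology
  proof (intro conjI ballI)
    fix f assume "f \<in> topspace entire_topology - subsp"
    then have f: "f \<in> entire_functions" "f \<notin> subsp" by auto
    then obtain z where z: "f z \<noteq> (\<Sum>k. taylor_coeff (m (Suc k)) f * gen (Suc k) z)" by (auto simp: subsp_def)
    define S where "S f = (\<Sum>k. taylor_coeff (m (Suc k)) f * gen (Suc k) z)" for f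
    define d where "d = norm (f z - S f) / 4"
    have d: "d > 0" using z by (simp add: d_def S_def)
    obtain \<rho> where \<rho>: "\<rho> > 0" "z \<in> cball 0 \<rho>" "\<And>f B k. f \<in> entire_functions \<Longrightarrow> (\<And>w. w \<in> cball 0 \<rho> \<Longrightarrow> norm (f w) \<le> B) \<Longrightarrow>
      norm (taylor_coeff (m (Suc k)) f * gen (Suc k) z) \<le> B * (1/2) ^ k"
      using expansion_bound[of z] by metis
    have "g \<notin> subsp" if g: "g \<in> compact_nbhd f (cball 0 \<rho>) d" for g
    proof
      assume "g \<in> subsp"
      then have gz: "g z = S g" by (simp add: subsp_def S_def)
      have gE: "g \<in> entire_functions" and close: "\<And>w. w \<in> cball 0 \<rho> \<Longrightarrow> norm (g w - f w) \<le> d"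
        using g by (auto simp: compact_nbhd_def dist_norm less_imp_le)
      have gfE: "(\<lambda>w. g w - f w) \<in> entire_functions"
        using gE f(1) by (auto simp: entire_functions_def intro: holomorphic_on_diff)
      have "S g - S f = (\<Sum>k. taylor_coeff (m (Suc k)) g * gen (Suc k) z - taylor_coeff (m (Suc k)) f * gen (Suc k) z)"
        unfolding S_def using gE f(1) by (intro suminf_diff summable_norm_cancel[OF expansion_summable])
      also have "\<dots> = (\<Sum>k. taylor_coeff (m (Suc k)) (\<lambda>w. g w - f w) * gen (Suc k) z)"
        using gE f(1) by (simp add: taylor_coeff_diff left_diff_distrib)
      also have "norm \<dots> \<le> (\<Sum>k. d * (1/2) ^ k)"
      proof (rule norm_suminf_le)
        show "norm (taylor_coeff (m (Suc k)) (\<lambda>w. g w - f w) * gen (Suc k) z) \<le> d * (1/2) ^ k" for k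
          using gfE close by (rule \<rho>(3))
        show "summable (\<lambda>k. d * (1/2) ^ k)" by (intro summable_mult summable_geometric) auto
      qed
      also have "\<dots> = 2 * d" by (subst suminf_mult) (auto simp: suminf_geometric intro: summable_geometric)
      finally have "norm (S g - S f) \<le> 2 * d" .
      moreover have "norm (g z - f z) \<le> d" using close \<rho>(2) .
      moreover have "f z - S f = (S g - S f) - (g z - f z)" using gz by simp
      ultimately have "norm (f z - S f) \<le> 3 * d" using norm_triangle_ineq4[of "S g - S f" "g z - f z"] by simp
      then show False using d by (simp add: d_def)
    qed
    then have "compact_nbhd f (cball 0 \<rho>) d \<subseteq> topspace entire_topology - subsp" by (auto simp: compact_nbhd_def)
    then show "\<exists>K d. compact K \<and> 0 < d \<and> compact_nbhd f K d \<subseteq> topspace entire_topology - subsp"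
      using d by (intro exI[of _ "cball 0 \<rho>"] exI[of _ d]) auto
  qed auto
qed

lemma gen_in_subsp: "gen (Suc j) \<in> subsp"
proof -
  have "(\<Sum>k. taylor_coeff (m (Suc k)) (gen (Suc j)) * gen (Suc k) z) = gen (Suc j) z" for z
  proof -
    have "(\<lambda>k. taylor_coeff (m (Suc k)) (gen (Suc j)) * gen (Suc k) z) = (\<lambda>k. if k = j then gen (Suc k) z else 0)"
      by (auto simp: taylor_coeff_gen fun_eq_iff)
    then show ?thesis using sums_single[of j "\<lambda>k. gen (Suc k) z"] by (simp add: sums_unique[symmetric])
  qed
  then show ?thesis using gen_entire by (simp add: subsp_def)
qed

lemma taylor_coeff_sum:
  "finite A \<Longrightarrow> (\<And>v. v \<in> A \<Longrightarrow> v \<in> entire_functions) \<Longrightarrow>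
    taylor_coeff n (\<Sum>v\<in>A. scale_fun (u v) v) = (\<Sum>v\<in>A. u v * taylor_coeff n v)"
proof (induction A rule: finite_induct)
  case (insert x A)
  have "(\<Sum>v\<in>A. scale_fun (u v) v) \<in> entire_functions"
    using insert.prems by (intro complex_fun.subspace_sum[OF subspace_entire_functions]
      complex_fun.subspace_scale[OF subspace_entire_functions]) auto
  moreover have "scale_fun (u x) x \<in> entire_functions"
    using insert.prems by (intro complex_fun.subspace_scale[OF subspace_entire_functions]) auto
  ultimately have "taylor_coeff n (scale_fun (u x) x + (\<Sum>v\<in>A. scale_fun (u v) v)) =
      u x * taylor_coeff n x + taylor_coeff n (\<Sum>v\<in>A. scale_fun (u v) v)"
    using insert.prems by (subst taylor_coeff_add) (simp_all add: taylor_coeff_scale)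
  then show ?case using insert by (simp only: sum.insert insertI1 insertI2 simp_thms)
qed (simp add: taylor_coeff_zero)

lemma infinite_dimensional_subsp: "infinite_dimensional subsp"
  unfolding infinite_dimensional_def
proof
  assume "\<exists>B. finite B \<and> complex_fun.span B = subsp"
  then obtain B where B: "finite B" "complex_fun.span B = subsp" by blast
  define G where "G = range (\<lambda>j. gen (Suc j))"
  have inj: "inj (\<lambda>j. gen (Suc j))"
  proof (rule injI)
    fix i j assume "gen (Suc i) = gen (Suc j)"
    then have "taylor_coeff (m (Suc i)) (gen (Suc j)) = 1" using taylor_coeff_gen[of "Suc i" "Suc i"] by simp
    then show "i = j" using taylor_coeff_gen[of "Suc j" "Suc i"] by (auto split: if_splits)
  qed
  have "\<not> complex_fun.dependent G"
  proof
    assume "complex_fun.dependent G"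
    then obtain A u v where A: "finite A" "A \<subseteq> G" "(\<Sum>v\<in>A. scale_fun (u v) v) = 0" "v \<in> A" "u v \<noteq> 0"
      unfolding complex_fun.dependent_explicit by blast
    then obtain j where j: "v = gen (Suc j)" by (auto simp: G_def)
    have AE: "w \<in> entire_functions" if "w \<in> A" for w using that A(2) gen_entire by (auto simp: G_def)
    have "0 = taylor_coeff (m (Suc j)) (\<Sum>v\<in>A. scale_fun (u v) v)" using A(3) by (simp add: taylor_coeff_zero)
    also have "\<dots> = (\<Sum>w\<in>A. u w * taylor_coeff (m (Suc j)) w)" by (rule taylor_coeff_sum[OF A(1) AE])
    also have "\<dots> = (\<Sum>w\<in>A. if w = v then u v else 0)"
    proof (rule sum.cong[OF refl])
      fix w assume "w \<in> A"
      then obtain i where i: "w = gen (Suc i)" using A(2) by (auto simp: G_def)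
      have "w = v \<longleftrightarrow> i = j" using inj by (auto simp: i j inj_def)
      then show "u w * taylor_coeff (m (Suc j)) w = (if w = v then u v else 0)"
        by (auto simp: i j taylor_coeff_gen)
    qed
    also have "\<dots> = u v" using A(1,4) by simp
    finally show False using A(5) by simp
  qed
  moreover have "G \<subseteq> complex_fun.span B" unfolding B(2) using gen_in_subsp by (auto simp: G_def)
  ultimately have "finite G" using complex_fun.independent_span_bound[OF B(1)] by blast
  then show False using inj finite_imageD unfolding G_def by blast
qed
end

context stages begin

text \<open>At a stage \<open>s\<close> for the given task, three kinds of terms make up \<open>f\<close> on \<open>X\<close>: the polynomials of stage \<open>s\<close>,
which steer; the later corrections of generators up to \<open>s\<close>, of size \<open>e (Suc s)\<close>; and the generators
beyond \<open>s\<close>. The latter are at most \<open>V ^ m k\<close> on \<open>X\<close>, where \<open>V\<close> depends on the task but not on the stage, and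
have coefficients of size \<open>(2 V) ^ - m k\<close>.\<close>
lemma subsp_steered:
  assumes f: "f \<in> subsp" and k0: "1 \<le> k0" "taylor_coeff (m k0) f = 1"
    and recur: "\<And>n. \<exists>s\<ge>n. task s = i \<and> dir s = k0" and \<epsilon>: "0 < \<epsilon> i" and T: "T \<in> Ops i"
  shows "\<exists>n. \<forall>z\<in>cball 0 (r i). norm ((T ^^ n) f z - poly (h i) z) \<le> 2 * \<epsilon> i"
proof -
  have fE: "f \<in> entire_functions" using f by (simp add: subsp_def)
  obtain W where W: "W > 0" "\<And>s z. z \<in> cball 0 (r i + 1) \<Longrightarrow> norm (poly (F s 0) z) \<le> W"
    using base_bounded[of "r i + 1"] by metis
  define U where "U = max 1 W"
  \<comment> \<open>\<open>U\<close> bounds the auxiliary polynomial on \<open>X\<close>; \<open>3\<close> absorbs the changes after stage \<open>s\<close>.\<close>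
  define V where "V = U + 3"
  have V: "V \<ge> 1" "V > 0" by (auto simp: V_def U_def)
  obtain B where B: "B > 0" "\<And>z. z \<in> cball 0 (2 * V) \<Longrightarrow> norm (f z) \<le> B"
    using entire_bounded_cball[OF fE, of "2 * V"] by metis
  define c where "c k = taylor_coeff (m k) f" for k
  have c1: "norm (c k) * V ^ m k \<le> B * (1/2) ^ m k" for k
  proof -
    have "norm (c k) \<le> B / (2 * V) ^ m k"
      unfolding c_def using V by (intro norm_taylor_coeff_le[OF fE _ B(2)]) auto
    then have "norm (c k) * V ^ m k \<le> B / (2 * V) ^ m k * V ^ m k" using V by (intro mult_right_mono) auto
    also have "\<dots> = B * (1/2) ^ m k" using V by (simp add: power_mult_distrib power_one_over)
    finally show ?thesis .
  qed
  have c2: "norm (c k) \<le> B" for k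
  proof -
    have "norm (c k) * 1 \<le> norm (c k) * V ^ m k" using V by (intro mult_left_mono one_le_power) auto
    also have "\<dots> \<le> B * (1/2) ^ m k" by (rule c1)
    also have "\<dots> \<le> B * 1" using B(1) by (intro mult_left_mono power_le_one) auto
    finally show ?thesis by simp
  qed
  have "(\<lambda>s. B * (2 * e s)) \<longlonglongrightarrow> B * 0" by (intro tendsto_intros stage_gap_tendsto)
  then have "eventually (\<lambda>s. B * (2 * e s) < \<epsilon> i) sequentially" using \<epsilon> by (intro order_tendstoD(2)) simp_all
  then obtain s1 where s1: "\<And>s. s \<ge> s1 \<Longrightarrow> B * (2 * e s) < \<epsilon> i" by (auto simp: eventually_sequentially)
  obtain s where s: "s \<ge> max s1 k0" "task s = i" "dir s = k0" using recur by blast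
  have Be: "B * e s \<le> \<epsilon> i"
  proof -
    have "0 < B * e s" using B(1) e_pos by simp
    then show ?thesis using s1[of s] s(1) by simp
  qed
  have d: "1 \<le> dir s" "dir s \<le> s" using s k0 by auto
  obtain X \<theta> where X: "X \<subseteq> cball 0 (R (Suc s))"
      "\<forall>z\<in>X. norm z \<le> r i + 1 \<or> norm (poly (F (Suc s) 0) z) \<le> 1"
      "4 * (real s + 1) * e (Suc s) \<le> \<theta>" "4 * (1/2) ^ m (Suc s) \<le> \<theta>"
      "steers (Ops i) (h i) (r i) (\<epsilon> i) (F (Suc s)) s k0 (e s) X \<theta>"
    using goal[OF d] unfolding s(2,3) by (elim exE conjE) (rule that)
  have "norm (f z - (\<Sum>k=1..s. c k * poly (F (Suc s) k) z)) \<le> B * \<theta>" if z: "z \<in> X" for z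
  proof -
    have zR: "z \<in> cball 0 (R (Suc s))" using X(1) z by blast
    have e1: "e (Suc s) \<le> 1/2" using e_half[of s] e_mono[of 0 s] e_0 by simp
    have base: "norm (poly (F (Suc s) 0) z) \<le> U"
      using X(2) z W(2)[of z "Suc s"] by (auto simp: U_def le_max_iff_disj)
    have far: "norm (gen (Suc s + j) z) \<le> V ^ m (Suc s + j)" for j
    proof -
      have "norm (poly (F (Suc s + j) 0) z - poly (F (Suc s) 0) z) \<le> 2 * e (Suc s)"
        using zR by (intro stage_dist) auto
      then have "norm (poly (F (Suc s + j) 0) z) \<le> U + 1"
        using base e1 norm_triangle_sub[of "poly (F (Suc s + j) 0) z" "poly (F (Suc s) 0) z"] by linarith
      moreover have "z \<in> cball 0 (R (Suc s + j))" using zR R_mono[of "Suc s" "Suc s + j"] by simp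
      ultimately have "norm (gen (Suc s + j) z) \<le> (U + 1 + 2) ^ m (Suc s + j)"
        by (intro gen_le_power) auto
      then show ?thesis by (simp add: V_def add.assoc)
    qed
    let ?t = "\<lambda>k. c (Suc k) * gen (Suc k) z"
    have sm: "summable ?t" unfolding c_def using fE by (intro summable_norm_cancel[OF expansion_summable])
    have "f z = suminf ?t" using f by (simp add: subsp_def c_def)
    also have "\<dots> = (\<Sum>j. ?t (j + s)) + (\<Sum>k<s. ?t k)" by (rule suminf_split_initial_segment[OF sm])
    also have "(\<Sum>k<s. ?t k) = (\<Sum>k=1..s. c k * gen k z)" by (simp add: sum.atLeast1_atMost_eq)
    finally have fz: "f z - (\<Sum>k=1..s. c k * poly (F (Suc s) k) z) =
        (\<Sum>j. ?t (j + s)) + (\<Sum>k=1..s. c k * (gen k z - poly (F (Suc s) k) z))"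
      by (simp add: right_diff_distrib sum_subtractf)
    have "norm (\<Sum>j. ?t (j + s)) \<le> (\<Sum>j. B * (1/2) ^ m (Suc s) * (1/2) ^ j)"
    proof (rule norm_suminf_le)
      show "summable (\<lambda>j. B * (1/2) ^ m (Suc s) * (1/2) ^ j)" by (intro summable_mult summable_geometric) auto
      fix j
      have "norm (?t (j + s)) \<le> norm (c (Suc s + j)) * V ^ m (Suc s + j)"
        using far[of j] by (simp add: norm_mult mult_left_mono add.commute)
      also have "\<dots> \<le> B * (1/2) ^ m (Suc s + j)" by (rule c1)
      also have "\<dots> \<le> B * (1/2) ^ (m (Suc s) + j)"
        using B(1) m_add[of "Suc s" j] by (intro mult_left_mono power_decreasing) auto
      finally show "norm (?t (j + s)) \<le> B * (1/2) ^ m (Suc s) * (1/2) ^ j" by (simp add: power_add)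
    qed
    also have "\<dots> = B * (1/2) ^ m (Suc s) * 2"
      by (subst suminf_mult) (auto simp: suminf_geometric intro: summable_geometric)
    also have "\<dots> = B * (4 * (1/2) ^ m (Suc s)) / 2" by simp
    also have "\<dots> \<le> B * \<theta> / 2" using X(4) B(1) by (intro divide_right_mono mult_left_mono) auto
    finally have t1: "norm (\<Sum>j. ?t (j + s)) \<le> B * \<theta> / 2" .
    have "norm (\<Sum>k=1..s. c k * (gen k z - poly (F (Suc s) k) z)) \<le> (\<Sum>k=1..s. B * (2 * e (Suc s)))"
    proof (intro sum_norm_le)
      fix k assume "k \<in> {1..s}"
      then have "norm (gen k z - poly (F (Suc s) k) z) \<le> 2 * e (Suc s)" using zR by (intro gen_dist) auto
      then show "norm (c k * (gen k z - poly (F (Suc s) k) z)) \<le> B * (2 * e (Suc s))"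
        unfolding norm_mult using c2[of k] B(1) by (intro mult_mono) auto
    qed
    also have "\<dots> = B * (4 * real s * e (Suc s)) / 2" by simp
    also have "\<dots> \<le> B * \<theta> / 2"
    proof (intro divide_right_mono mult_left_mono)
      have "4 * real s * e (Suc s) \<le> 4 * (real s + 1) * e (Suc s)"
        using e_pos[of "Suc s"] by (intro mult_right_mono) auto
      then show "4 * real s * e (Suc s) \<le> \<theta>" using X(3) by linarith
    qed (use B(1) in auto)
    finally have t2: "norm (\<Sum>k=1..s. c k * (gen k z - poly (F (Suc s) k) z)) \<le> B * \<theta> / 2" .
    show ?thesis unfolding fz using norm_triangle_mono[OF t1 t2] by simp
  qed
  then have "\<exists>n. \<forall>z\<in>cball 0 (r i). norm ((T ^^ n) f z - poly (h i) z) \<le> B * e s + \<epsilon> i"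
    using X(5)[unfolded steers_def, THEN bspec, OF T, THEN bspec, OF fE, THEN spec, THEN spec, of c B] k0(2) c2
    by (simp add: c_def)
  then obtain n where n: "\<forall>z\<in>cball 0 (r i). norm ((T ^^ n) f z - poly (h i) z) \<le> B * e s + \<epsilon> i" by blast
  show ?thesis
  proof (intro exI[of _ n] ballI)
    fix z :: complex assume "z \<in> cball 0 (r i)"
    then have "norm ((T ^^ n) f z - poly (h i) z) \<le> B * e s + \<epsilon> i" using n by blast
    then show "norm ((T ^^ n) f z - poly (h i) z) \<le> 2 * \<epsilon> i" using Be by linarith
  qed
qed

end

section \<open>Running all tasks in one construction\<close>

text \<open>Within a stage the choices are made in this order: the correction with its tolerance \<open>\<theta>\<close>, then the
order \<open>m'\<close> of the next generator and the accuracy \<open>e'\<close> of the next stage, both depending on \<open>\<theta>\<close>.\<close>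
lemma stages_exist:
  assumes ins: "\<And>i. insertable (Ops i) (h i) (r i) (\<epsilon> i)"
  shows "\<exists>F R e m. stages F R e m task dir Ops h r \<epsilon>"
proof -
  define P :: "nat \<Rightarrow> (nat \<Rightarrow> complex poly) \<times> real \<times> real \<times> nat \<Rightarrow> bool" where
    "P s \<sigma> \<longleftrightarrow> (case \<sigma> of (F, R, e, m) \<Rightarrow> 0 < e \<and> real s \<le> R \<and>
       (s = 0 \<longrightarrow> F 0 = [:0, 1:] \<and> e \<le> 1 \<and> 1 \<le> m))" for s \<sigma>
  define Q :: "nat \<Rightarrow> (nat \<Rightarrow> complex poly) \<times> real \<times> real \<times> nat \<Rightarrow> (nat \<Rightarrow> complex poly) \<times> real \<times> real \<times> nat \<Rightarrow> bool" where
    "Q s \<sigma> \<sigma>' \<longleftrightarrow> (case \<sigma> of (F, R, e, m) \<Rightarrow> case \<sigma>' of (F', R', e', m') \<Rightarrow>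
       e' \<le> e / 2 \<and> R \<le> R' \<and> m < m' \<and> (\<forall>k\<le>s. degree (F' k) < m') \<and>
       (\<forall>k\<le>s. monom 1 (Suc m) dvd F' k - F k) \<and>
       (\<forall>k\<le>s. \<forall>z\<in>cball 0 R. norm (poly (F' k - F k) z) \<le> e) \<and>
       F' (Suc s) = F' 0 ^ m' \<and>
       (1 \<le> dir s \<longrightarrow> dir s \<le> s \<longrightarrow> (\<exists>X \<theta>. X \<subseteq> cball 0 R' \<and>
        (\<forall>z\<in>X. norm z \<le> r (task s) + 1 \<or> norm (poly (F' 0) z) \<le> 1) \<and>
        4 * (real s + 1) * e' \<le> \<theta> \<and> 4 * (1/2) ^ m' \<le> \<theta> \<and>
        steers (Ops (task s)) (h (task s)) (r (task s)) (\<epsilon> (task s)) F' s (dir s) e X \<theta>)))" for s \<sigma> \<sigma>'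
  have "\<exists>\<sigma>. \<forall>s. P s (\<sigma> s) \<and> Q s (\<sigma> s) (\<sigma> (Suc s))"
  proof (rule dependent_nat_choice)
    show "\<exists>\<sigma>. P 0 \<sigma>" by (intro exI[of _ "(\<lambda>_. [:0, 1:], 0, 1, 1)"]) (simp add: P_def)
  next
    fix \<sigma> s assume \<sigma>: "P s \<sigma>"
    obtain F R e m where \<sigma>_eq: "\<sigma> = (F, R, e, m)" by (cases \<sigma>) auto
    have e: "0 < e" and R: "real s \<le> R" using \<sigma> by (auto simp: P_def \<sigma>_eq)
    have "\<exists>P R1 X \<theta>. 0 < \<theta> \<and> X \<subseteq> cball 0 R1 \<and>
      (\<forall>k. monom 1 (Suc m) dvd P k \<and> (\<forall>z\<in>cball 0 R. norm (poly (P k) z) \<le> e)) \<and>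
      (1 \<le> dir s \<longrightarrow> dir s \<le> s \<longrightarrow>
        admissible_step (Ops (task s)) (h (task s)) (r (task s)) (\<epsilon> (task s)) F s R (Suc m) e (dir s) P R1 X \<theta>)"
    proof (cases "1 \<le> dir s \<and> dir s \<le> s")
      case True
      then obtain P R1 X \<theta> where
        "admissible_step (Ops (task s)) (h (task s)) (r (task s)) (\<epsilon> (task s)) F s R (Suc m) e (dir s) P R1 X \<theta>"
        using ins[of "task s"] e unfolding insertable_def by blast
      then show ?thesis unfolding admissible_step_def by blast
    next
      case False
      then show ?thesis
        by (intro exI[of _ "\<lambda>_. 0"] exI[of _ 0] exI[of _ "{}"] exI[of _ 1]) (use e in auto)
    qed
    then obtain P1 R1 X \<theta> where P1: "0 < \<theta>" "X \<subseteq> cball 0 R1"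
      "\<forall>k. monom 1 (Suc m) dvd P1 k \<and> (\<forall>z\<in>cball 0 R. norm (poly (P1 k) z) \<le> e)"
      and adm: "1 \<le> dir s \<longrightarrow> dir s \<le> s \<longrightarrow>
        admissible_step (Ops (task s)) (h (task s)) (r (task s)) (\<epsilon> (task s)) F s R (Suc m) e (dir s) P1 R1 X \<theta>"
      by (elim exE conjE) (rule that)
    have P1_4: "\<forall>z\<in>X. norm z \<le> r (task s) + 1 \<or> norm (poly (F 0 + P1 0) z) \<le> 1"
      "steers (Ops (task s)) (h (task s)) (r (task s)) (\<epsilon> (task s)) (\<lambda>k. F k + P1 k) s (dir s) e X \<theta>"
      if "1 \<le> dir s" "dir s \<le> s"
      using adm that unfolding admissible_step_def by simp_all
    have "(\<lambda>n. 4 * (1/2) ^ n :: real) \<longlonglongrightarrow> 0" by (intro tendsto_mult_right_zero LIMSEQ_realpow_zero) auto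
    then have "eventually (\<lambda>n. 4 * (1/2) ^ n < \<theta>) sequentially" using P1(1) by (rule order_tendstoD(2))
    then obtain n1 where n1: "\<And>n. n \<ge> n1 \<Longrightarrow> 4 * (1/2) ^ n < \<theta>" by (auto simp: eventually_sequentially)
    define m' where "m' = max n1 (Suc (max m (Max ((\<lambda>k. degree (F k + P1 k)) ` {..s}))))"
    have m': "4 * (1/2) ^ m' \<le> \<theta>" "m < m'" "\<And>k. k \<le> s \<Longrightarrow> degree (F k + P1 k) < m'"
    proof -
      show "4 * (1/2) ^ m' \<le> \<theta>" using n1[of m'] by (simp add: m'_def)
      show "m < m'" by (simp add: m'_def)
      fix k assume "k \<le> s"
      then have "degree (F k + P1 k) \<le> Max ((\<lambda>k. degree (F k + P1 k)) ` {..s})" by (intro Max_ge) auto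
      then show "degree (F k + P1 k) < m'" by (simp add: m'_def)
    qed
    define e' where "e' = min (e / 2) (\<theta> / (4 * (real s + 1)))"
    have e': "0 < e'" "e' \<le> e / 2" "4 * (real s + 1) * e' \<le> \<theta>"
    proof -
      show "0 < e'" using e P1(1) by (simp add: e'_def)
      show "e' \<le> e / 2" unfolding e'_def by (rule min.cobounded1)
      have "e' \<le> \<theta> / (4 * (real s + 1))" by (simp add: e'_def)
      moreover have "0 < 4 * (real s + 1)" by simp
      ultimately have "e' * (4 * (real s + 1)) \<le> \<theta>" by (simp only: pos_le_divide_eq)
      then show "4 * (real s + 1) * e' \<le> \<theta>" by (simp add: mult.commute)
    qed
    define R' where "R' = max (R + 1) R1"
    define F' where "F' k = (if k \<le> s then F k + P1 k else (F 0 + P1 0) ^ m')" for k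
    have P': "P (Suc s) (F', R', e', m')" using e' R by (simp add: P_def R'_def)
    have "Q s \<sigma> (F', R', e', m')"
      unfolding Q_def \<sigma>_eq prod.case
    proof (intro conjI allI impI)
      assume d: "1 \<le> dir s" "dir s \<le> s"
      have "steers (Ops (task s)) (h (task s)) (r (task s)) (\<epsilon> (task s)) F' s (dir s) e X \<theta>"
        using P1_4(2)[OF d] steers_cong[of s F' "\<lambda>k. F k + P1 k"] by (simp add: F'_def)
      moreover have "X \<subseteq> cball 0 R'" using P1(2) by (auto simp: R'_def le_max_iff_disj)
      ultimately show "\<exists>X \<theta>. X \<subseteq> cball 0 R' \<and>
        (\<forall>z\<in>X. norm z \<le> r (task s) + 1 \<or> norm (poly (F' 0) z) \<le> 1) \<and>
        4 * (real s + 1) * e' \<le> \<theta> \<and> 4 * (1/2) ^ m' \<le> \<theta> \<and>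
        steers (Ops (task s)) (h (task s)) (r (task s)) (\<epsilon> (task s)) F' s (dir s) e X \<theta>"
        using P1_4(1)[OF d] e'(3) m'(1) by (intro exI[of _ X] exI[of _ \<theta>]) (simp add: F'_def)
    qed (use e' m' P1(3) in \<open>auto simp: F'_def R'_def\<close>)
    with P' show "\<exists>\<sigma>'. P (Suc s) \<sigma>' \<and> Q s \<sigma> \<sigma>'" by blast
  qed
  then obtain \<sigma> where \<sigma>: "\<And>s. P s (\<sigma> s)" "\<And>s. Q s (\<sigma> s) (\<sigma> (Suc s))" by blast
  define F where "F s = fst (\<sigma> s)" for s
  define R where "R s = fst (snd (\<sigma> s))" for s
  define e where "e s = fst (snd (snd (\<sigma> s)))" for s
  define m where "m s = snd (snd (snd (\<sigma> s)))" for s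
  have \<sigma>_eq: "\<sigma> s = (F s, R s, e s, m s)" for s by (simp add: F_def R_def e_def m_def)
  have PP: "0 < e s \<and> real s \<le> R s \<and> (s = 0 \<longrightarrow> F s 0 = [:0, 1:] \<and> e s \<le> 1 \<and> 1 \<le> m s)" for s
    using \<sigma>(1)[of s] unfolding P_def \<sigma>_eq prod.case .
  note QQ = \<sigma>(2)[unfolded Q_def \<sigma>_eq prod.case]
  have "stages F R e m task dir Ops h r \<epsilon>"
  proof
    show "F 0 0 = [:0, 1:]" "e 0 \<le> 1" "1 \<le> m 0" using PP[of 0] by auto
    fix s
    show "0 < e s" "real s \<le> R s" using PP[of s] by auto
    show "e (Suc s) \<le> e s / 2" "R s \<le> R (Suc s)" "m s < m (Suc s)" "F (Suc s) (Suc s) = F (Suc s) 0 ^ m (Suc s)"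
      using QQ[of s] by simp_all
    show "degree (F (Suc s) k) < m (Suc s)" "monom 1 (Suc (m s)) dvd F (Suc s) k - F s k" if "k \<le> s" for k
      using QQ[of s] that by simp_all
    show "norm (poly (F (Suc s) k - F s k) z) \<le> e s" if "k \<le> s" "z \<in> cball 0 (R s)" for k z
      using QQ[of s] that by blast
    show "\<exists>X \<theta>. X \<subseteq> cball 0 (R (Suc s)) \<and>
        (\<forall>z\<in>X. norm z \<le> r (task s) + 1 \<or> norm (poly (F (Suc s) 0) z) \<le> 1) \<and>
        4 * (real s + 1) * e (Suc s) \<le> \<theta> \<and> 4 * (1/2) ^ m (Suc s) \<le> \<theta> \<and>
        steers (Ops (task s)) (h (task s)) (r (task s)) (\<epsilon> (task s)) (F (Suc s)) s (dir s) (e s) X \<theta>"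
      if "1 \<le> dir s" "dir s \<le> s" using QQ[of s] that by blast
  qed
  then show ?thesis by blast
qed

text \<open>Every pair of a task and a generator occurs at infinitely many stages. A nonzero \<open>f\<close> has a nonzero
coefficient at some generator and is normalised by it, with the same factor for all tasks.\<close>
lemma countable_insertable_subspace:
  assumes ins: "\<And>i :: nat. insertable (Ops i) (h i) (r i) (\<epsilon> i)" and \<epsilon>: "\<And>i. 0 < \<epsilon> i"
  shows "\<exists>M. complex_fun.subspace M \<and> closedin entire_topology M \<and> infinite_dimensional M \<and>
    (\<forall>f\<in>M - {0}. \<exists>c. c \<noteq> 0 \<and> (\<forall>i. \<forall>T\<in>Ops i. \<exists>n. \<forall>z\<in>cball 0 (r i).
       norm ((T ^^ n) (scale_fun c f) z - poly (h i) z) \<le> 2 * \<epsilon> i))"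
proof -
  \<comment> \<open>Each value of the outer second component of the decoded triple gives another stage with the same task and generator.\<close>
  define task where "task s = fst (prod_decode (fst (prod_decode s)))" for s
  define dir where "dir s = Suc (snd (prod_decode (fst (prod_decode s))))" for s
  obtain F R e m where st: "stages F R e m task dir Ops h r \<epsilon>" using stages_exist[of Ops h r \<epsilon> task dir, OF ins] by blast
  interpret stages F R e m task dir Ops h r \<epsilon> by (rule st)
  have recur: "\<exists>s\<ge>n. task s = i \<and> dir s = Suc k" for n i k
    by (intro exI[of _ "prod_encode (prod_encode (i, k), n)"]) (simp add: task_def dir_def le_prod_encode_2)
  have "\<exists>c. c \<noteq> 0 \<and> (\<forall>i. \<forall>T\<in>Ops i. \<exists>n. \<forall>z\<in>cball 0 (r i).
       norm ((T ^^ n) (scale_fun c f) z - poly (h i) z) \<le> 2 * \<epsilon> i)" if f: "f \<in> subsp" "f \<noteq> 0" for f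
  proof -
    have "\<exists>k. taylor_coeff (m (Suc k)) f \<noteq> 0"
    proof (rule ccontr)
      assume "\<nexists>k. taylor_coeff (m (Suc k)) f \<noteq> 0"
      then have "f z = 0" for z using f(1) by (simp add: subsp_def)
      then show False using f(2) by (simp add: fun_eq_iff)
    qed
    then obtain k where k: "taylor_coeff (m (Suc k)) f \<noteq> 0" by blast
    define c where "c = 1 / taylor_coeff (m (Suc k)) f"
    have fE: "f \<in> entire_functions" using f(1) by (simp add: subsp_def)
    have "scale_fun c f \<in> subsp" using complex_fun.subspace_scale[OF subspace_subsp f(1)] .
    moreover have "taylor_coeff (m (Suc k)) (scale_fun c f) = 1" using k fE by (simp add: taylor_coeff_scale c_def)
    ultimately have "\<exists>n. \<forall>z\<in>cball 0 (r i). norm ((T ^^ n) (scale_fun c f) z - poly (h i) z) \<le> 2 * \<epsilon> i"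
      if "T \<in> Ops i" for T i
      using recur \<epsilon> that by (intro subsp_steered[of _ "Suc k"]) auto
    moreover have "c \<noteq> 0" using k by (simp add: c_def)
    ultimately show ?thesis by blast
  qed
  then show ?thesis using subspace_subsp closedin_subsp infinite_dimensional_subsp
    by (intro exI[of _ subsp]) blast
qed

text \<open>The Lindelof property reduces an uncountable family of operators to countably many tasks.\<close>
lemma countable_open_cover:
  fixes S :: "'a :: second_countable_topology set"
  assumes "\<And>p. p \<in> S \<Longrightarrow> \<exists>U. open U \<and> p \<in> U \<and> Q U"
  shows "\<exists>\<U>. countable \<U> \<and> (\<forall>U\<in>\<U>. Q U) \<and> S \<subseteq> \<Union>\<U>"
proof -
  obtain \<U> where "\<U> \<subseteq> {U. open U \<and> Q U}" "countable \<U>" "\<Union>\<U> = \<Union>{U. open U \<and> Q U}"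
    using Lindelof[of "{U. open U \<and> Q U}"] by auto
  moreover have "S \<subseteq> \<Union>{U. open U \<and> Q U}" using assms by (auto simp only:)
  ultimately show ?thesis by (intro exI[of _ \<U>]) auto
qed

text \<open>Taylor polynomials with coefficients moved into a countable dense set.\<close>
lemma countable_dense_polys:
  obtains H :: "complex poly set" where "countable H"
    "\<And>g \<rho> \<eta>. g \<in> entire_functions \<Longrightarrow> 0 < \<rho> \<Longrightarrow> 0 < \<eta> \<Longrightarrow> \<exists>p\<in>H. \<forall>z\<in>cball 0 \<rho>. norm (poly p z - g z) < \<eta>"
proof -
  obtain D :: "complex set" where D: "countable D" "\<And>X. open X \<Longrightarrow> X \<noteq> {} \<Longrightarrow> \<exists>d\<in>D. d \<in> X"
    using countable_dense_exists[where 'a = complex] by auto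
  define H where "H = (\<lambda>xs. \<Sum>i<length xs. monom (xs ! i) i) ` lists D"
  show ?thesis
  proof (rule that[of H])
    show "countable H" unfolding H_def using D(1) by (intro countable_image countable_lists)
    fix g \<rho> \<eta> assume g: "g \<in> entire_functions" and \<rho>: "0 < (\<rho> :: real)" and \<eta>: "0 < (\<eta> :: real)"
    obtain B where B: "B > 0" "\<And>z. z \<in> cball 0 (2 * \<rho>) \<Longrightarrow> norm (g z) \<le> B"
      using entire_bounded_cball[OF g, of "2 * \<rho>"] by metis
    define a where "a n = taylor_coeff n g" for n
    have an: "norm (a n) * \<rho> ^ n \<le> B * (1/2) ^ n" for n
    proof -
      have "norm (a n) \<le> B / (2 * \<rho>) ^ n"
        unfolding a_def using \<rho> by (intro norm_taylor_coeff_le[OF g _ B(2)]) auto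
      then have "norm (a n) * \<rho> ^ n \<le> B / (2 * \<rho>) ^ n * \<rho> ^ n" using \<rho> by (intro mult_right_mono) auto
      also have "\<dots> = B * (1/2) ^ n" using \<rho> by (simp add: power_mult_distrib power_one_over)
      finally show ?thesis .
    qed
    have "(\<lambda>n. 2 * B * (1/2) ^ n :: real) \<longlonglongrightarrow> 0" by (intro tendsto_mult_right_zero LIMSEQ_realpow_zero) auto
    then have "eventually (\<lambda>n. 2 * B * (1/2) ^ n < \<eta> / 2) sequentially" using \<eta> by (intro order_tendstoD(2)) auto
    then obtain N where N: "2 * B * (1/2) ^ N < \<eta> / 2" by (auto simp: eventually_sequentially)
    define s where "s = (\<Sum>n<N. \<rho> ^ n) + 1"
    have s: "s > 0" using \<rho> by (auto simp: s_def intro!: add_nonneg_pos sum_nonneg)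
    have "\<exists>d\<in>D. d \<in> ball (a n) (\<eta> / (2 * s))" for n using \<eta> s by (intro D(2) open_ball) (simp add: not_le)
    then obtain b where b: "\<And>n. b n \<in> D" "\<And>n. norm (b n - a n) < \<eta> / (2 * s)"
      by (simp add: dist_norm norm_minus_commute) metis
    define p where "p = (\<Sum>i<N. monom (b i) i)"
    have "p = (\<lambda>xs. \<Sum>i<length xs. monom (xs ! i) i) (map b [0..<N])" by (simp add: p_def)
    then have "p \<in> H" unfolding H_def using b(1) by (intro image_eqI[of _ _ "map b [0..<N]"]) auto
    moreover have "norm (poly p z - g z) < \<eta>" if z: "z \<in> cball 0 \<rho>" for z
    proof -
      have zn: "norm z ^ n \<le> \<rho> ^ n" for n using z by (intro power_mono) auto
      have term_le: "norm (a n * z ^ n) \<le> B * (1/2) ^ n" for n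
      proof -
        have "norm (a n * z ^ n) \<le> norm (a n) * \<rho> ^ n"
          unfolding norm_mult norm_power using zn by (intro mult_left_mono) auto
        then show ?thesis using an[of n] by linarith
      qed
      have gh: "g holomorphic_on ball 0 (\<rho> + 1)" using g holomorphic_on_subset unfolding entire_functions_def by blast
      have sums: "(\<lambda>n. a n * z ^ n) sums g z"
        using holomorphic_power_series[OF gh, of z] z by (simp add: a_def taylor_coeff_def)
      have "g z = (\<Sum>n. a (n + N) * z ^ (n + N)) + (\<Sum>n<N. a n * z ^ n)"
        using suminf_split_initial_segment[OF sums_summable[OF sums], of N] sums_unique[OF sums] by simp
      then have "poly p z - g z = (\<Sum>n<N. (b n - a n) * z ^ n) - (\<Sum>n. a (n + N) * z ^ (n + N))"
        by (simp add: p_def poly_sum poly_monom left_diff_distrib sum_subtractf)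
      also have "norm \<dots> \<le> norm (\<Sum>n<N. (b n - a n) * z ^ n) + norm (\<Sum>n. a (n + N) * z ^ (n + N))"
        by (rule norm_triangle_ineq4)
      also have "norm (\<Sum>n<N. (b n - a n) * z ^ n) \<le> (\<Sum>n<N. \<eta> / (2 * s) * \<rho> ^ n)"
      proof (intro sum_norm_le)
        show "norm ((b n - a n) * z ^ n) \<le> \<eta> / (2 * s) * \<rho> ^ n" for n
          unfolding norm_mult norm_power using b(2)[of n] zn[of n] \<eta> s by (intro mult_mono) auto
      qed
      also have "(\<Sum>n<N. \<eta> / (2 * s) * \<rho> ^ n) = \<eta> / (2 * s) * (s - 1)" by (simp add: s_def sum_distrib_left)
      also have "\<eta> / (2 * s) * (s - 1) \<le> \<eta> / 2" using \<eta> s by (simp add: field_simps)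
      also have "norm (\<Sum>n. a (n + N) * z ^ (n + N)) \<le> (\<Sum>n. B * (1/2) ^ N * (1/2) ^ n)"
      proof (rule norm_suminf_le)
        show "norm (a (n + N) * z ^ (n + N)) \<le> B * (1/2) ^ N * (1/2) ^ n" for n
          using term_le[of "n + N"] by (simp add: power_add mult_ac)
        show "summable (\<lambda>n. B * (1/2) ^ N * (1/2) ^ n)" by (intro summable_mult summable_geometric) auto
      qed
      also have "\<dots> = 2 * B * (1/2) ^ N"
        by (subst suminf_mult) (auto simp: suminf_geometric intro: summable_geometric)
      also have "\<dots> < \<eta> / 2" by (rule N)
      finally show ?thesis by simp
    qed
    ultimately show "\<exists>p\<in>H. \<forall>z\<in>cball 0 \<rho>. norm (poly p z - g z) < \<eta>" by blast
  qed
qed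

section \<open>The common hypercyclic subspace\<close>

lemma hypercyclicI:
  assumes f: "f \<in> entire_functions" and T: "continuous_map entire_topology entire_topology T"
    and hom: "\<And>n. (T ^^ n) (scale_fun c f) = scale_fun c ((T ^^ n) f)" and c: "c \<noteq> 0"
    and approx: "\<And>g \<rho> \<eta>. g \<in> entire_functions \<Longrightarrow> 0 < \<rho> \<Longrightarrow> 0 < \<eta> \<Longrightarrow>
      \<exists>n. \<forall>z\<in>cball 0 \<rho>. norm ((T ^^ n) (scale_fun c f) z - g z) < \<eta>"
  shows "hypercyclic entire_topology T f"
proof -
  have TE: "(T ^^ n) f \<in> entire_functions" for n
  proof (induction n)
    case (Suc n)
    then show ?case using T by (auto simp: continuous_map_def Pi_iff)
  qed (use f in simp)
  have "g \<in> entire_topology closure_of {(T ^^ n) f |n. True}" if g: "g \<in> entire_functions" for g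
    unfolding in_closure_of
  proof (intro conjI allI impI)
    fix U assume "g \<in> U \<and> openin entire_topology U"
    then obtain K e where K: "compact K" "0 < e" "compact_nbhd g K e \<subseteq> U"
      unfolding openin_entire_topology by blast
    obtain \<rho> where \<rho>: "\<rho> > 0" "\<And>z. z \<in> K \<Longrightarrow> norm z \<le> \<rho>"
      using compact_imp_bounded[OF K(1)] bounded_pos by metis
    have cg: "scale_fun c g \<in> entire_functions" using complex_fun.subspace_scale[OF subspace_entire_functions g] .
    obtain n where n: "\<forall>z\<in>cball 0 \<rho>. norm ((T ^^ n) (scale_fun c f) z - scale_fun c g z) < e * norm c"
      using approx[OF cg \<rho>(1), of "e * norm c"] K(2) c by auto
    have "dist ((T ^^ n) f z) (g z) < e" if "z \<in> K" for z
    proof -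
      have "norm (c * (T ^^ n) f z - c * g z) < e * norm c"
        using n \<rho>(2)[OF that] unfolding hom by (simp add: scale_fun_def)
      then have "norm c * norm ((T ^^ n) f z - g z) < norm c * e"
        by (simp add: mult.commute flip: norm_mult right_diff_distrib)
      then show ?thesis using c by (simp add: dist_norm)
    qed
    then have "(T ^^ n) f \<in> U" using K(3) TE by (auto simp: compact_nbhd_def)
    then show "\<exists>y. y \<in> {(T ^^ n) f |n. True} \<and> y \<in> U" by blast
  qed (use g in simp)
  then show ?thesis
    using f closure_of_subset_topspace[of entire_topology] by (auto simp: hypercyclic_def)
qed

text \<open>A task consists of an open set of operators of one of the two kinds, a target from a countable dense
set of polynomials, and a number \<open>j\<close> that fixes both the disc and the accuracy.\<close>
theorem theorem1p3:
  shows "\<exists>M. common_hypercyclic_subspace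
    ({scale_op c diff_op | c. c \<noteq> 0} \<union>
     {scale_op \<mu> (translation_op a) | a \<mu>. a \<noteq> 0 \<and> \<mu> \<noteq> 0}) M"
proof -
  define t where "t = (\<lambda>(a, \<mu>). scale_op \<mu> (translation_op a))"
  define d where "d = (\<lambda>c. scale_op c diff_op)"
  obtain H :: "complex poly set" where H: "countable H"
    "\<And>g \<rho> \<eta>. g \<in> entire_functions \<Longrightarrow> 0 < \<rho> \<Longrightarrow> 0 < \<eta> \<Longrightarrow> \<exists>p\<in>H. \<forall>z\<in>cball 0 \<rho>. norm (poly p z - g z) < \<eta>"
    using countable_dense_polys by blast
  have "\<exists>\<U>. countable \<U> \<and> (\<forall>U\<in>\<U>. insertable (t ` U) h (real j + 1) (1 / (real j + 1))) \<and>
      (UNIV - {0}) \<times> (UNIV - {0}) \<subseteq> \<Union>\<U>" for h j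
  proof (rule countable_open_cover)
    fix p :: "complex \<times> complex" assume "p \<in> (UNIV - {0}) \<times> (UNIV - {0})"
    then obtain a0 \<mu>0 where p: "p = (a0, \<mu>0)" "a0 \<noteq> 0" "\<mu>0 \<noteq> 0" by auto
    have pos: "0 < real j + 1" "0 < 1 / (real j + 1)" by auto
    obtain \<kappa> where \<kappa>: "\<kappa> > 0" "insertable {scale_op \<mu> (translation_op a) |a \<mu>. norm (a - a0) < \<kappa> \<and> norm (\<mu> - \<mu>0) < \<kappa>}
        h (real j + 1) (1 / (real j + 1))"
      using translations_insertable[OF p(2,3) pos] by blast
    have "t ` (ball a0 \<kappa> \<times> ball \<mu>0 \<kappa>) \<subseteq> {scale_op \<mu> (translation_op a) |a \<mu>. norm (a - a0) < \<kappa> \<and> norm (\<mu> - \<mu>0) < \<kappa>}"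
    proof
      fix T assume "T \<in> t ` (ball a0 \<kappa> \<times> ball \<mu>0 \<kappa>)"
      then obtain a \<mu> where "T = scale_op \<mu> (translation_op a)" "a \<in> ball a0 \<kappa>" "\<mu> \<in> ball \<mu>0 \<kappa>" by (auto simp: t_def)
      then show "T \<in> {scale_op \<mu> (translation_op a) |a \<mu>. norm (a - a0) < \<kappa> \<and> norm (\<mu> - \<mu>0) < \<kappa>}"
        unfolding mem_Collect_eq
        by (rule_tac exI[of _ a], rule_tac exI[of _ \<mu>]) (simp add: dist_norm norm_minus_commute)
    qed
    then have "insertable (t ` (ball a0 \<kappa> \<times> ball \<mu>0 \<kappa>)) h (real j + 1) (1 / (real j + 1))"
      by (rule insertable_mono[OF \<kappa>(2)])
    moreover have "open (ball a0 \<kappa> \<times> ball \<mu>0 \<kappa>)" by (intro open_Times open_ball)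
    moreover have "p \<in> ball a0 \<kappa> \<times> ball \<mu>0 \<kappa>" using \<kappa>(1) p(1) by simp
    ultimately show "\<exists>U. open U \<and> p \<in> U \<and> insertable (t ` U) h (real j + 1) (1 / (real j + 1))" by blast
  qed
  then obtain \<T> where \<T>: "\<And>h j. countable (\<T> h j)"
    "\<And>h j U. U \<in> \<T> h j \<Longrightarrow> insertable (t ` U) h (real j + 1) (1 / (real j + 1))"
    "\<And>h j. (UNIV - {0}) \<times> (UNIV - {0}) \<subseteq> \<Union>(\<T> h j)" by metis
  have "\<exists>\<U>. countable \<U> \<and> (\<forall>U\<in>\<U>. insertable (d ` U) h (real j + 1) (1 / (real j + 1))) \<and>
      UNIV - {0} \<subseteq> \<Union>\<U>" for h j
  proof (rule countable_open_cover)
    fix c0 :: complex assume "c0 \<in> UNIV - {0}"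
    then have c0: "c0 \<noteq> 0" by simp
    have pos: "0 < real j + 1" "0 < 1 / (real j + 1)" by auto
    obtain \<kappa> where \<kappa>: "\<kappa> > 0" "insertable {scale_op c diff_op |c. norm (c - c0) < \<kappa>} h (real j + 1) (1 / (real j + 1))"
      using derivatives_insertable[OF c0 pos] by blast
    have "d ` ball c0 \<kappa> \<subseteq> {scale_op c diff_op |c. norm (c - c0) < \<kappa>}"
      by (auto simp: d_def dist_norm norm_minus_commute)
    then have "insertable (d ` ball c0 \<kappa>) h (real j + 1) (1 / (real j + 1))"
      by (rule insertable_mono[OF \<kappa>(2)])
    moreover have "c0 \<in> ball c0 \<kappa>" using \<kappa>(1) by simp
    ultimately show "\<exists>U. open U \<and> c0 \<in> U \<and> insertable (d ` U) h (real j + 1) (1 / (real j + 1))" by blast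
  qed
  then obtain \<D> where \<D>: "\<And>h j. countable (\<D> h j)"
    "\<And>h j U. U \<in> \<D> h j \<Longrightarrow> insertable (d ` U) h (real j + 1) (1 / (real j + 1))"
    "\<And>h j. UNIV - {0} \<subseteq> \<Union>(\<D> h j)" by metis
  define tasks where "tasks = (\<Union>h\<in>H. \<Union>j. (\<lambda>U. (t ` U, h, j)) ` \<T> h j \<union> (\<lambda>U. (d ` U, h, j)) ` \<D> h j)"
  have tasks_ne: "tasks \<noteq> {}"
  proof -
    have "(0 :: complex \<Rightarrow> complex) \<in> entire_functions"
      using subspace_entire_functions complex_fun.subspace_0 by blast
    then obtain p where "p \<in> H" using H(2)[of 0 1 1] by auto
    moreover have "\<D> p 0 \<noteq> {}" using \<D>(3)[of p 0] by (metis Diff_iff UNIV_I Union_empty empty_iff singletonD subset_empty zero_neq_one)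
    ultimately show ?thesis unfolding tasks_def by blast
  qed
  have tasks_count: "countable tasks"
    unfolding tasks_def using H(1) \<T>(1) \<D>(1) by (intro countable_UN countable_Un countable_image) auto
  have tasks_ins: "insertable \<O> h (real j + 1) (1 / (real j + 1))" if "(\<O>, h, j) \<in> tasks" for \<O> h j
    using that \<T>(2) \<D>(2) by (auto simp: tasks_def)
  define enum where "enum = from_nat_into tasks"
  have enum: "range enum = tasks" unfolding enum_def using tasks_ne tasks_count by (rule range_from_nat_into)
  define Ops h J where "Ops i = fst (enum i)" and "h i = fst (snd (enum i))" and "J i = snd (snd (enum i))" for i
  have enum_eq: "enum i = (Ops i, h i, J i)" for i by (simp add: Ops_def h_def J_def)
  have "insertable (Ops i) (h i) (real (J i) + 1) (1 / (real (J i) + 1))" for i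
    using enum enum_eq[of i] by (intro tasks_ins) (metis rangeI)
  then obtain M where M: "complex_fun.subspace M" "closedin entire_topology M" "infinite_dimensional M"
    "\<forall>f\<in>M - {0}. \<exists>c. c \<noteq> 0 \<and> (\<forall>i. \<forall>T\<in>Ops i. \<exists>n. \<forall>z\<in>cball 0 (real (J i) + 1).
       norm ((T ^^ n) (scale_fun c f) z - poly (h i) z) \<le> 2 * (1 / (real (J i) + 1)))"
    using countable_insertable_subspace[of Ops h "\<lambda>i. real (J i) + 1" "\<lambda>i. 1 / (real (J i) + 1)"] by auto
  have hc: "hypercyclic entire_topology T f"
    if f: "f \<in> M - {0}" and T: "(\<exists>c. c \<noteq> 0 \<and> T = d c) \<or> (\<exists>a \<mu>. a \<noteq> 0 \<and> \<mu> \<noteq> 0 \<and> T = t (a, \<mu>))" for f T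
  proof -
    have fE: "f \<in> entire_functions" using f closedin_subset[OF M(2)] by auto
    obtain c where c: "c \<noteq> 0" "\<And>i T. T \<in> Ops i \<Longrightarrow> \<exists>n. \<forall>z\<in>cball 0 (real (J i) + 1).
       norm ((T ^^ n) (scale_fun c f) z - poly (h i) z) \<le> 2 * (1 / (real (J i) + 1))"
      using M(4) f by blast
    have Tc: "\<exists>i. T \<in> Ops i \<and> h i = p \<and> J i = j" if p: "p \<in> H" for p j
    proof -
      have "\<exists>\<O>. T \<in> \<O> \<and> (\<O>, p, j) \<in> tasks"
        using T
      proof (elim disjE exE conjE)
        fix c assume "c \<noteq> 0" "T = d c"
        moreover obtain U where "U \<in> \<D> p j" "c \<in> U" using \<D>(3)[of p j] \<open>c \<noteq> 0\<close> by blast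
        moreover have "(d ` U, p, j) \<in> tasks"
          unfolding tasks_def by (rule UN_I[OF p], rule UN_I[OF UNIV_I], rule UnI2, rule image_eqI[OF refl], fact)
        ultimately show ?thesis by blast
      next
        fix a \<mu> assume "a \<noteq> 0" "\<mu> \<noteq> 0" "T = t (a, \<mu>)"
        moreover obtain U where "U \<in> \<T> p j" "(a, \<mu>) \<in> U"
          using \<T>(3)[of p j] \<open>a \<noteq> 0\<close> \<open>\<mu> \<noteq> 0\<close> by blast
        moreover have "(t ` U, p, j) \<in> tasks"
          unfolding tasks_def by (rule UN_I[OF p], rule UN_I[OF UNIV_I], rule UnI1, rule image_eqI[OF refl], fact)
        ultimately show ?thesis by blast
      qed
      then obtain \<O> where "T \<in> \<O>" "(\<O>, p, j) \<in> range enum" unfolding enum by blast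
      then show ?thesis using enum_eq by (metis Pair_inject imageE)
    qed
    have cont: "continuous_map entire_topology entire_topology T"
      using T continuous_map_scale_op continuous_map_diff_op continuous_map_translation_op
      by (auto simp: d_def t_def)
    have hom: "(T ^^ n) (scale_fun c f) = scale_fun c ((T ^^ n) f)" for n
      using T
    proof (elim disjE exE conjE)
      fix l assume Td: "T = d l"
      have cf: "scale_fun c f \<in> entire_functions" using complex_fun.subspace_scale[OF subspace_entire_functions fE] .
      have "(deriv ^^ n) (scale_fun c f) z = c * (deriv ^^ n) f z" for z
        using fE higher_deriv_cmult[of f UNIV z n c] by (simp add: scale_fun_def entire_functions_def)
      then show ?thesis by (simp add: Td d_def funpow_scale_diff[OF fE] funpow_scale_diff[OF cf]) (simp add: scale_fun_def mult.left_commute)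
    next
      fix a \<mu> assume "T = t (a, \<mu>)"
      then show ?thesis by (simp add: t_def funpow_scale_translation) (simp add: scale_fun_def mult.left_commute)
    qed
    show ?thesis
    proof (rule hypercyclicI[OF fE cont hom c(1)])
      fix g \<rho> \<eta> assume g: "g \<in> entire_functions" and \<rho>: "0 < (\<rho> :: real)" and \<eta>: "0 < (\<eta> :: real)"
      obtain j where j: "max \<rho> (4 / \<eta>) < real j" using reals_Archimedean2 by blast
      obtain p where p: "p \<in> H" "\<forall>z\<in>cball 0 (real j + 1). norm (poly p z - g z) < \<eta> / 2"
        using H(2)[OF g, of "real j + 1" "\<eta> / 2"] \<eta> by auto
      obtain i where i: "T \<in> Ops i" "h i = p" "J i = j" using Tc[OF p(1)] by blast
      obtain n where n: "\<forall>z\<in>cball 0 (real j + 1). norm ((T ^^ n) (scale_fun c f) z - poly p z) \<le> 2 * (1 / (real j + 1))"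
        using c(2)[OF i(1)] i(2,3) by auto
      have "4 < \<eta> * (real j + 1)" using j \<eta> by (simp add: field_simps)
      then have small: "2 * (1 / (real j + 1)) \<le> \<eta> / 2" by (simp add: field_simps)
      have "norm ((T ^^ n) (scale_fun c f) z - g z) < \<eta>" if z: "z \<in> cball 0 \<rho>" for z
      proof -
        have zj: "z \<in> cball 0 (real j + 1)" using z j by simp
        have "norm ((T ^^ n) (scale_fun c f) z - poly p z) \<le> \<eta> / 2" using n zj small by (meson order_trans)
        moreover have "norm (poly p z - g z) < \<eta> / 2" using p(2) zj by blast
        ultimately show ?thesis
          using norm_triangle_ineq[of "(T ^^ n) (scale_fun c f) z - poly p z" "poly p z - g z"] by simp
      qed
      then show "\<exists>n. \<forall>z\<in>cball 0 \<rho>. norm ((T ^^ n) (scale_fun c f) z - g z) < \<eta>" by blast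
    qed
  qed
  have "common_hypercyclic_subspace
    ({scale_op c diff_op | c. c \<noteq> 0} \<union> {scale_op \<mu> (translation_op a) | a \<mu>. a \<noteq> 0 \<and> \<mu> \<noteq> 0}) M"
    unfolding common_hypercyclic_subspace_def
  proof (intro conjI ballI M(1-3))
    fix f T assume f: "f \<in> M - {0}"
      and "T \<in> {scale_op c diff_op | c. c \<noteq> 0} \<union> {scale_op \<mu> (translation_op a) | a \<mu>. a \<noteq> 0 \<and> \<mu> \<noteq> 0}"
    then have "(\<exists>c. c \<noteq> 0 \<and> T = d c) \<or> (\<exists>a \<mu>. a \<noteq> 0 \<and> \<mu> \<noteq> 0 \<and> T = t (a, \<mu>))"
      unfolding d_def t_def prod.case by blast
    then show "hypercyclic entire_topology T f" by (rule hc[OF f])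
  qed
  then show ?thesis by blast
qed

end
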